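(* Let $\mathbb{X},\mathbb{Y}$ be locally finite second countable Hausdorff spaces, $k\in\mathbb{N}$, and let $f:\mathbb{X}^k\times\mathbf{N}_{\mathbb{X}}\to\mathbb{Y}$ and $g:\mathbb{X}^k\times\mathbf{N}_{\mathbb{X}}\to\{0,1\}$ be measurable and symmetric in their $\mathbb{X}^k$-arguments. Let $\eta$ be a Poisson process on $\mathbb{X}$ with locally finite intensity measure $\mathbf{K}$ and $$\xi=\frac1{k!}\sum_{\mathbf{x}\in\eta^k_{\ne}}g(\mathbf{x},\eta)\,\delta_{f(\mathbf{x},\eta)},$$ with intensity measure $\mathbf{L}$ satisfying $\mathbf{L}(\mathbb{Y})<\infty$. Assume there is a measurable symmetric map $S:\mathbb{X}^k\to\mathcal{F}$, $S_{\mathbf{x}}:=S(\mathbf{x})$, such that for all $\omega\in\mathbf{N}_{\mathbb{X}}$ and $\mathbf{x}\in\omega^k_{\ne}$: $\mathbf{x}\in S_{\mathbf{x}}^k$; $g(\mathbf{x},\omega)=g(\mathbf{x},\omega|_{S_{\mathbf{x}}})$; and $f(\mathbf{x},\omega)=f(\mathbf{x},\omega|_{S_{\mathbf{x}}})$ whenever $g(\mathbf{x},\omega)=1$. Let $Z$ be a Poisson random variable with parameter $a\in(0,\infty)$. Then $$\mathrm{d}_{\mathrm{TV}}(\xi(\mathbb{Y}),Z)\le\min\{1,1/\sqrt a\}\,|\mathbb{E}[\xi(\mathbb{Y})]-a|+\frac{\min\{1,1/a\}}2(E_2+E_3+E_4),$$ where $$E_2=\frac2{(k!)^2}\int_{\mathbb{X}^k}\int_{\mathbb{X}^k}\mathbb{1}\{S_{\mathbf{x}}\cap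 S_{\mathbf{z}}\ne\varnothing\}\mathbb{E}[g(\mathbf{x},\eta+\delta_{\mathbf{x}})]\mathbb{E}[g(\mathbf{z},\eta+\delta_{\mathbf{z}})]\,\mathbf{K}^k(\mathrm d\mathbf{z})\mathbf{K}^k(\mathrm d\mathbf{x}),$$ $$E_3=\frac2{(k!)^2}\int_{\mathbb{X}^k}\int_{\mathbb{X}^k}\mathbb{1}\{S_{\mathbf{x}}\cap S_{\mathbf{z}}\ne\varnothing\}\mathbb{E}[g(\mathbf{x},\eta+\delta_{\mathbf{x}}+\delta_{\mathbf{z}})g(\mathbf{z},\eta+\delta_{\mathbf{x}}+\delta_{\mathbf{z}})]\,\mathbf{K}^k(\mathrm d\mathbf{z})\mathbf{K}^k(\mathrm d\mathbf{x}),$$ $$E_4=\frac2{k!}\sum_{\varnothing\subsetneq I\subsetneq\{1,\dots,k\}}\frac1{(k-|I|)!}\int_{\mathbb{X}^k}\int_{\mathbb{X}^{k-|I|}}\mathbb{E}[g(\mathbf{x},\eta+\delta_{\mathbf{x}}+\delta_{\mathbf{z}})g((\mathbf{x}_I,\mathbf{z}),\eta+\delta_{\mathbf{x}}+\delta_{\mathbf{z}})]\,\mathbf{K}^{k-|I|}(\mathrm d\mathbf{z})\mathbf{K}^k(\mathrm d\mathbf{x}),$$ with $(\mathbf{x}_I,\mathbf{z})=(x_{i_1},\dots,x_{i_m},z_1,\dots,z_{k-m})$ for $I=\{i_1,\dots,i_m\}$.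
   Context: $\mathbf{N}_{\mathbb{X}}$ is the space of locally finite counting measures on $\mathbb{X}$; a Poisson process with intensity measure $\mathbf{K}$ is a point process with Poisson distributed counts of mean $\mathbf{K}(A)$ and independent counts on disjoint sets. $\eta^k_{\ne}$ is the set of $k$-tuples of pairwise distinct points of $\eta$. For $\mathbf{x}=(x_1,\dots,x_k)$, $\delta_{\mathbf{x}}=\sum_{i=1}^k\delta_{x_i}$. $\omega|_A$ is the restriction of $\omega$ to $A$. $\mathcal{F}$ is the family of closed subsets of $\mathbb{X}$ with the Borel $\sigma$-field of the Fell topology. For $\mathbb{N}_0$-valued random variables, $\mathrm{d}_{\mathrm{TV}}(X,Y)=\sup_{A\subseteq\mathbb{N}_0}|\mathbb{P}(X\in A)-\mathbb{P}(Y\in A)|$. *)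

theory Defs
  imports "HOL-Probability.Probability" "HOL-Combinatorics.Permutations"
begin

text \<open>A counting measure omega on X is represented by its multiplicity function
  omega :: X => nat, so that omega(A) = sum of omega x over x in A.
  It is locally finite if it charges only finitely many points of every compact set.\<close>

definition lf_count :: "('x::topological_space \<Rightarrow> nat) \<Rightarrow> bool" where
  "lf_count \<omega> \<longleftrightarrow> (\<forall>C. compact C \<longrightarrow> finite {x\<in>C. \<omega> x \<noteq> 0})"

definition cnt :: "('x \<Rightarrow> nat) \<Rightarrow> 'x set \<Rightarrow> ennreal" where
  "cnt \<omega> A = (\<integral>\<^sup>+ x. of_nat (\<omega> x) * indicator A x \<partial>count_space UNIV)"

definition NX :: "('x::topological_space \<Rightarrow> nat) measure" where
  "NX = sigma {\<omega>. lf_count \<omega>}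
     {{\<omega>. lf_count \<omega> \<and> cnt \<omega> A \<in> B} | A B. A \<in> sets borel \<and> B \<in> sets (borel :: ennreal measure)}"

definition restr :: "('x \<Rightarrow> nat) \<Rightarrow> 'x set \<Rightarrow> 'x \<Rightarrow> nat" where
  "restr \<omega> A = (\<lambda>y. if y \<in> A then \<omega> y else 0)"

definition add_pts :: "('x \<Rightarrow> nat) \<Rightarrow> nat \<Rightarrow> (nat \<Rightarrow> 'x) \<Rightarrow> 'x \<Rightarrow> nat" where
  "add_pts \<omega> n x = (\<lambda>y. \<omega> y + card {i. i < n \<and> x i = y})"

text \<open>Multiplicity of the k-tuple x in the factorial measure omega^(k) (the sum over omega^k_\<noteq>):
  the number of ways to pick k pairwise distinct points (counted with multiplicity) of omega
  that form the tuple x, i.e. the product over values v of the falling factorial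
  (omega v)(omega v - 1)...(omega v - m_v + 1), m_v = number of occurrences of v in x.\<close>
definition fmult :: "('x \<Rightarrow> nat) \<Rightarrow> nat \<Rightarrow> (nat \<Rightarrow> 'x) \<Rightarrow> nat" where
  "fmult \<omega> k x = (\<Prod>v \<in> x ` {..<k}. \<Prod>j < card {i. i < k \<and> x i = v}. (\<omega> v - j))"

definition in_fact :: "('x \<Rightarrow> nat) \<Rightarrow> nat \<Rightarrow> (nat \<Rightarrow> 'x) \<Rightarrow> bool" where
  "in_fact \<omega> k x \<longleftrightarrow> x \<in> PiE {..<k} (\<lambda>_. UNIV) \<and> fmult \<omega> k x > 0"

definition fact_sum :: "('x \<Rightarrow> nat) \<Rightarrow> nat \<Rightarrow> ((nat \<Rightarrow> 'x) \<Rightarrow> ennreal) \<Rightarrow> ennreal" where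
  "fact_sum \<omega> k h = (\<integral>\<^sup>+ x. of_nat (fmult \<omega> k x) * h x \<partial>count_space (PiE {..<k} (\<lambda>_. UNIV)))"

definition xi :: "nat \<Rightarrow> ((nat \<Rightarrow> 'x) \<Rightarrow> ('x \<Rightarrow> nat) \<Rightarrow> 'y) \<Rightarrow> ((nat \<Rightarrow> 'x) \<Rightarrow> ('x \<Rightarrow> nat) \<Rightarrow> real)
    \<Rightarrow> ('x \<Rightarrow> nat) \<Rightarrow> 'y set \<Rightarrow> ennreal" where
  "xi k f g \<omega> B = ennreal (1 / fact k) * fact_sum \<omega> k (\<lambda>x. ennreal (g x \<omega>) * indicator B (f x \<omega>))"

definition poisson_process :: "'a measure \<Rightarrow> 'x::topological_space measure \<Rightarrow> ('a \<Rightarrow> 'x \<Rightarrow> nat) \<Rightarrow> bool" where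
  "poisson_process M K \<eta> \<longleftrightarrow> prob_space M \<and> \<eta> \<in> M \<rightarrow>\<^sub>M NX \<and>
     (\<forall>A \<in> sets borel. emeasure K A < \<infinity> \<longrightarrow>
        (\<forall>n::nat. measure M {\<omega> \<in> space M. cnt (\<eta> \<omega>) A = of_nat n}
                 = enn2real (emeasure K A) ^ n / fact n * exp (- enn2real (emeasure K A)))) \<and>
     (\<forall>A \<in> sets borel. emeasure K A = \<infinity> \<longrightarrow> (AE \<omega> in M. cnt (\<eta> \<omega>) A = \<infinity>)) \<and>
     (\<forall>(n::nat) A. (\<forall>i<n. A i \<in> sets borel) \<and> disjoint_family_on A {..<n} \<longrightarrow>
        prob_space.indep_vars M (\<lambda>_. borel) (\<lambda>i \<omega>. cnt (\<eta> \<omega>) (A i)) {..<n})"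

definition fell_topology :: "'x::topological_space set topology" where
  "fell_topology = topology_generated_by
     ({{F. closed F \<and> F \<inter> C = {}} | C. compact C} \<union> {{F. closed F \<and> F \<inter> G \<noteq> {}} | G. open G})"

definition fell_sets :: "'x::topological_space set measure" where
  "fell_sets = sigma (topspace fell_topology) {U. openin fell_topology U}"

definition symmetric_tup :: "nat \<Rightarrow> ((nat \<Rightarrow> 'x) \<Rightarrow> 'b) \<Rightarrow> bool" where
  "symmetric_tup k h \<longleftrightarrow> (\<forall>\<pi> x. \<pi> permutes {..<k} \<and> x \<in> PiE {..<k} (\<lambda>_. UNIV) \<longrightarrow> h (x \<circ> \<pi>) = h x)"

definition join_tup :: "nat \<Rightarrow> nat set \<Rightarrow> (nat \<Rightarrow> 'x) \<Rightarrow> (nat \<Rightarrow> 'x) \<Rightarrow> nat \<Rightarrow> 'x" where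
  "join_tup k I x z = (\<lambda>j. if j < card I then x (sorted_list_of_set I ! j)
                         else if j < k then z (j - card I) else undefined)"

definition dTV :: "'a measure \<Rightarrow> ('a \<Rightarrow> ennreal) \<Rightarrow> nat pmf \<Rightarrow> real" where
  "dTV M X p = (SUP A :: nat set. \<bar>measure M {\<omega> \<in> space M. X \<omega> \<in> of_nat ` A} - measure_pmf.prob p A\<bar>)"

definition E2 :: "'a measure \<Rightarrow> 'x measure \<Rightarrow> ('a \<Rightarrow> 'x \<Rightarrow> nat) \<Rightarrow> nat
   \<Rightarrow> ((nat \<Rightarrow> 'x) \<Rightarrow> ('x \<Rightarrow> nat) \<Rightarrow> real) \<Rightarrow> ((nat \<Rightarrow> 'x) \<Rightarrow> 'x set) \<Rightarrow> ennreal" where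
  "E2 M K \<eta> k g S = ennreal (2 / (fact k)^2) *
     (\<integral>\<^sup>+ x. \<integral>\<^sup>+ z. indicator {p. fst p \<inter> snd p \<noteq> {}} (S x, S z)
        * (\<integral>\<^sup>+ \<omega>. ennreal (g x (add_pts (\<eta> \<omega>) k x)) \<partial>M)
        * (\<integral>\<^sup>+ \<omega>. ennreal (g z (add_pts (\<eta> \<omega>) k z)) \<partial>M)
      \<partial>PiM {..<k} (\<lambda>_. K) \<partial>PiM {..<k} (\<lambda>_. K))"

definition E3 :: "'a measure \<Rightarrow> 'x measure \<Rightarrow> ('a \<Rightarrow> 'x \<Rightarrow> nat) \<Rightarrow> nat
   \<Rightarrow> ((nat \<Rightarrow> 'x) \<Rightarrow> ('x \<Rightarrow> nat) \<Rightarrow> real) \<Rightarrow> ((nat \<Rightarrow> 'x) \<Rightarrow> 'x set) \<Rightarrow> ennreal" where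
  "E3 M K \<eta> k g S = ennreal (2 / (fact k)^2) *
     (\<integral>\<^sup>+ x. \<integral>\<^sup>+ z. indicator {p. fst p \<inter> snd p \<noteq> {}} (S x, S z)
        * (\<integral>\<^sup>+ \<omega>. ennreal (g x (add_pts (add_pts (\<eta> \<omega>) k x) k z)
                           * g z (add_pts (add_pts (\<eta> \<omega>) k x) k z)) \<partial>M)
      \<partial>PiM {..<k} (\<lambda>_. K) \<partial>PiM {..<k} (\<lambda>_. K))"

definition E4 :: "'a measure \<Rightarrow> 'x measure \<Rightarrow> ('a \<Rightarrow> 'x \<Rightarrow> nat) \<Rightarrow> nat
   \<Rightarrow> ((nat \<Rightarrow> 'x) \<Rightarrow> ('x \<Rightarrow> nat) \<Rightarrow> real) \<Rightarrow> ennreal" where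
  "E4 M K \<eta> k g = ennreal (2 / fact k) *
     (\<Sum>I \<in> {I. I \<subseteq> {..<k} \<and> I \<noteq> {} \<and> I \<noteq> {..<k}}. ennreal (1 / fact (k - card I)) *
       (\<integral>\<^sup>+ x. \<integral>\<^sup>+ z.
          (\<integral>\<^sup>+ \<omega>. ennreal (g x (add_pts (add_pts (\<eta> \<omega>) k x) (k - card I) z)
                     * g (join_tup k I x z) (add_pts (add_pts (\<eta> \<omega>) k x) (k - card I) z)) \<partial>M)
        \<partial>PiM {..<k - card I} (\<lambda>_. K) \<partial>PiM {..<k} (\<lambda>_. K)))"

end

theory Submission
  imports Defs
begin

text \<open>The Stein equation \<open>a h(j+1) - j h(j) = 1\<^sub>A(j) - P(Z \<in> A)\<close> reduces the claim to comparing
  \<open>E[W] E[h(W+1)]\<close> with \<open>E[W h(W)]\<close> for \<open>W = \<xi>(Y)\<close>. By the Mecke formula both are integrals over tuples \<open>x\<close>,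
  of \<open>E[g(x, \<eta>+\<delta>\<^sub>x)] E[h(W+1)]\<close> and of \<open>E[g(x, \<eta>+\<delta>\<^sub>x) h(W(\<eta>+\<delta>\<^sub>x))]\<close> respectively. As \<open>g(x, \<eta>+\<delta>\<^sub>x)\<close> depends
  only on the points in \<open>S\<^sub>x\<close>, resampling the points of \<open>\<eta>\<close> in \<open>S\<^sub>x\<close> gives a copy \<open>\<eta>'\<close> of \<open>\<eta>\<close> independent of that
  factor, and turns the first integrand into \<open>E[g(x, \<eta>+\<delta>\<^sub>x) h(W(\<eta>')+1)]\<close>. Tuples \<open>z\<close> with \<open>S\<^sub>z\<close> disjoint from \<open>S\<^sub>x\<close>
  contribute equally to \<open>W(\<eta>')\<close> and \<open>W(\<eta>+\<delta>\<^sub>x)\<close>; the remaining tuples of \<open>\<eta>'\<close>, those of \<open>\<eta>\<close>, and those sharing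
  some but not all points with \<open>x\<close> give \<open>E\<^sub>2\<close>, \<open>E\<^sub>3\<close> and \<open>E\<^sub>4\<close>.\<close>

section \<open>Stein's equation for the Poisson distribution\<close>

text \<open>The sums compared may be infinite, so no difference of them is formed: every comparison
  is a pair of one-sided inequalities in \<open>ennreal\<close>. For the same reason the Stein
  solution is shifted by the bound on its size to become nonnegative, and it is given the value 0 at
  infinity. Evaluating it requires the sum to be a natural number or infinity; symmetry provides
  this, since the \<open>k!\<close> orderings of a choice of points carry equal weight. The two
  bounds on the Stein solution have separate duties: its size, at most min 1 (1 / sqrt a),
  multiplies |E[W] - a|, and its increments, at most min 1 (1 / a), multiply the expected parts that
  the two sums do not share. Intensities with atoms are allowed, so points carry multiplicities and
  sums over tuples of distinct points are weighted by falling factorials. The Poisson property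
  enters only through the joint law of the counts of finitely many disjoint relatively compact
  sets.\<close>

context
  fixes a :: real and p F T :: "nat \<Rightarrow> real" and \<pi> :: "nat set \<Rightarrow> real"
  assumes a_pos: "a > 0"
  defines "\<pi> \<equiv> measure_pmf.prob (poisson_pmf a)"
  defines "p \<equiv> pmf (poisson_pmf a)"
  defines "F \<equiv> \<lambda>j. \<pi> {..j}" and "T \<equiv> \<lambda>j. \<pi> {j<..}"
begin

lemma p_pos: "p j > 0"
  using a_pos by (simp add: p_def)

lemma p_Suc: "p (Suc j) * real (Suc j) = a * p j"
  using a_pos by (simp add: p_def divide_simps del: of_nat_Suc)

lemma prob_singleton: "\<pi> {j} = p j"
  by (simp add: \<pi>_def p_def measure_pmf_single)

lemma prob_Un: "A \<inter> B = {} \<Longrightarrow> \<pi> (A \<union> B) = \<pi> A + \<pi> B"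
  unfolding \<pi>_def by (rule measure_pmf.finite_measure_Union) auto

lemma prob_mono: "A \<subseteq> B \<Longrightarrow> \<pi> A \<le> \<pi> B"
  unfolding \<pi>_def by (rule measure_pmf.finite_measure_mono) auto

lemma prob_nonneg: "\<pi> A \<ge> 0"
  by (simp add: \<pi>_def)

lemma F_plus_T: "F j + T j = 1"
proof -
  have "\<pi> ({..j} \<union> {j<..}) = F j + T j" unfolding F_def T_def by (rule prob_Un) auto
  moreover have "{..j} \<union> {j<..} = UNIV" by auto
  ultimately show ?thesis by (simp add: \<pi>_def)
qed

lemma F_0: "F 0 = p 0"
proof -
  have "{..0::nat} = {0}" by auto
  then show ?thesis by (simp add: F_def prob_singleton)
qed

lemma F_Suc: "F (Suc j) = F j + p (Suc j)"
proof -
  have "{..Suc j} = {..j} \<union> {Suc j}" by auto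
  then show ?thesis using prob_Un[of "{..j}" "{Suc j}"] by (simp add: F_def prob_singleton)
qed

lemma T_Suc: "T j = T (Suc j) + p (Suc j)"
  using F_plus_T[of j] F_plus_T[of "Suc j"] F_Suc[of j] by simp

lemma F_pos: "F j > 0"
  by (induction j) (simp_all add: F_0 F_Suc p_pos add_pos_pos)

lemma T_pos: "T j > 0"
  using T_Suc[of j] p_pos[of "Suc j"] prob_nonneg[of "{Suc j<..}"] unfolding T_def by linarith

text \<open>The identity \<open>(j + 1) * p (j + 1) = a * p j\<close> gives a one-step recursion, so
  that each upper bound on \<open>F j / p j\<close> below is an induction starting from
  \<open>F 0 / p 0 = 1\<close>.\<close>

lemma head_ratio_Suc: "F (Suc j) / p (Suc j) = 1 + real (Suc j) / a * (F j / p j)"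
proof -
  have "real (Suc j) / a / p j = 1 / p (Suc j)"
    using p_Suc[of j] p_pos[of j] p_pos[of "Suc j"] a_pos by (simp add: divide_simps del: of_nat_Suc) (simp add: mult_ac del: of_nat_Suc)
  then have "real (Suc j) / a * (F j / p j) = F j / p (Suc j)"
    by (metis (no_types, lifting) divide_divide_eq_left' divide_inverse mult.assoc mult.commute mult.left_neutral times_divide_eq_right)
  then show ?thesis using p_pos[of "Suc j"] by (simp add: F_Suc add_divide_distrib)
qed

text \<open>The ratio \<open>T j / p j\<close> obeys a recursion that expresses the value at
  \<open>j\<close> by the one at \<open>j + 1\<close> and so has no base case. Cutting the tail
  after \<open>n\<close> terms gives a recursion in \<open>n\<close> that starts at 0; bounds
  uniform in \<open>n\<close> pass to the limit.\<close>

definition tail :: "nat \<Rightarrow> nat \<Rightarrow> real" where "tail n j = (\<Sum>i\<in>{j<..j+n}. p i) / p j"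

lemma tail_0: "tail 0 j = 0"
  by (simp add: tail_def)

lemma tail_Suc: "tail (Suc n) j = a / real (Suc j) * (1 + tail n (Suc j))"
proof -
  have e: "{j<..j + Suc n} = insert (Suc j) {Suc j<..Suc j + n}" by auto
  have "(\<Sum>i\<in>{j<..j + Suc n}. p i) = p (Suc j) + (\<Sum>i\<in>{Suc j<..Suc j+n}. p i)"
    unfolding e by (subst sum.insert) auto
  also have "\<dots> = p (Suc j) * (1 + tail n (Suc j))"
    using p_pos[of "Suc j"] by (simp add: tail_def distrib_left)
  finally have "tail (Suc n) j = p (Suc j) / p j * (1 + tail n (Suc j))" by (simp add: tail_def)
  moreover have "p (Suc j) / p j = a / real (Suc j)"
    using p_Suc[of j] p_pos[of j] by (simp add: divide_simps del: of_nat_Suc)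
  ultimately show ?thesis by simp
qed

lemma tail_nonneg: "tail n j \<ge> 0"
  unfolding tail_def using p_pos by (intro divide_nonneg_pos sum_nonneg) (auto intro: less_imp_le)

lemma tail_tendsto: "(\<lambda>n. tail n j) \<longlonglongrightarrow> T j / p j"
proof -
  have "(\<lambda>n. \<pi> {j<..j+n}) \<longlonglongrightarrow> \<pi> (\<Union>n. {j<..j+n})"
    unfolding \<pi>_def by (rule measure_pmf.finite_Lim_measure_incseq) (auto simp: incseq_def)
  moreover have "(\<Union>n. {j<..j+n}) = {j<..}" 
  proof safe
    fix x assume "x > j" 
    then have "x \<in> {j<..j+x}" by auto
    then show "x \<in> (\<Union>n. {j<..j+n})" by blast
  qed auto
  moreover have "\<pi> {j<..j+n} = (\<Sum>i\<in>{j<..j+n}. p i)" for n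
    unfolding \<pi>_def p_def by (simp add: measure_measure_pmf_finite)
  ultimately have "(\<lambda>n. \<Sum>i\<in>{j<..j+n}. p i) \<longlonglongrightarrow> T j" by (simp add: T_def)
  then show ?thesis unfolding tail_def using p_pos[of j] by (intro tendsto_divide tendsto_const) auto
qed

lemma T_ratio_le: "(\<And>n. tail n j \<le> b) \<Longrightarrow> T j / p j \<le> b"
  by (rule LIMSEQ_le_const2[OF tail_tendsto]) auto

text \<open>If \<open>F j / p j \<le> c / u\<close> and \<open>T j / p j \<le> c / v\<close> then \<open>F j * T j / p j \<le> c / (u + v)\<close>. The bounds below have \<open>u\<close>
  decreasing and \<open>v\<close> increasing in \<open>j\<close> with the same slope, so that \<open>u + v\<close> is constant.\<close>

lemma head_ratio_bound_linear: "real j < a \<Longrightarrow> F j / p j \<le> a / (a - real j)"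
proof (induction j)
  case 0 then show ?case using p_pos[of 0] by (simp add: F_0)
next
  case (Suc j)
  have "F (Suc j) / p (Suc j) \<le> 1 + real (Suc j) / a * (a / (a - real j))"
    unfolding head_ratio_Suc using Suc a_pos by (intro add_left_mono mult_left_mono) auto
  also have "\<dots> = 1 + real (Suc j) / (a - real j)" using a_pos by simp
  also have "\<dots> \<le> a / (a - real (Suc j))"
  proof -
    define b where "b = a - real (Suc j)"
    have b: "b > 0" "a - real j = b + 1" "real (Suc j) = a - b" using Suc.prems by (auto simp: b_def)
    have ab: "b \<le> a" using b(3) by (metis diff_ge_0_iff_ge of_nat_0_le_iff)
    have "1 + (a - b) / (b + 1) = (a + 1) / (b + 1)" using b(1) by (simp add: field_simps)
    also have "\<dots> \<le> a / b" using b(1) ab by (simp add: divide_simps) (simp add: algebra_simps)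
    finally show ?thesis unfolding b_def[symmetric] b(2) unfolding b(3) .
  qed
  finally show ?case .
qed

text \<open>With \<open>b = j + 1 - a\<close> the recursion factor is \<open>a / (a + b)\<close>,
  and the step reduces to \<open>(a + b + 1) * b \<le> (a + b) * (b + 1)\<close>, whose two sides
  differ by \<open>a\<close>.\<close>

lemma tail_bound_linear: "real j + 1 > a \<Longrightarrow> tail n j \<le> a / (real j + 1 - a)"
proof (induction n arbitrary: j)
  case 0 then show ?case using a_pos by (simp add: tail_0)
next
  case (Suc n)
  define b where "b = real j + 1 - a"
  have b: "b > 0" using Suc.prems by (simp add: b_def)
  have "tail (Suc n) j \<le> a / real (Suc j) * (1 + a / (real (Suc j) + 1 - a))"
    unfolding tail_Suc using Suc.IH[of "Suc j"] Suc.prems a_pos by (intro mult_left_mono add_left_mono) auto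
  also have "\<dots> = a / (a + b) * (1 + a / (b + 1))" by (simp add: b_def algebra_simps)
  also have "\<dots> \<le> a / b"
  proof -
    have "1 + a / (b + 1) = (a + b + 1) / (b + 1)" using b by (simp add: field_simps)
    moreover have "(a + b + 1) * b \<le> (a + b) * (b + 1)" using a_pos by (simp add: algebra_simps)
    then have "(a + b + 1) / (b + 1) \<le> (a + b) / b" using b a_pos by (simp add: divide_simps)
    ultimately have "a / (a + b) * (1 + a / (b + 1)) \<le> a / (a + b) * ((a + b) / b)"
      using a_pos b by (intro mult_left_mono) auto
    also have "\<dots> = a / b" using a_pos b by simp
    finally show ?thesis .
  qed
  finally show ?case by (simp add: b_def)
qed

text \<open>The denominators here and in \<open>tail_bound_sqrt\<close> add up to
  \<open>2 * sqrt a\<close>, which with the numerator \<open>2 * a\<close> yields the bound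
  \<open>sqrt a\<close> on \<open>F j * T j / p j\<close>. The offset 1/2 cancels the constant that
  the recursion adds, so that after clearing denominators the induction step is
  \<open>0 \<le> (L - s)^2 + a\<close>.\<close>

lemma head_ratio_bound_sqrt:
  "sqrt a + a - real j - 1/2 > 0 \<Longrightarrow> F j / p j \<le> 2 * a / (sqrt a + a - real j - 1/2)"
proof (induction j)
  case 0
  have "0 \<le> (sqrt a - 1/2)^2" by simp
  also have "\<dots> = a - sqrt a + 1/4" using a_pos by (simp add: power2_eq_square algebra_simps)
  finally have "sqrt a + a - 1/2 \<le> 2 * a" by simp
  then show ?case using p_pos[of 0] 0 by (simp add: F_0)
next
  case (Suc j)
  define s L where "s = sqrt a" and "L = s + a - real (Suc j) - 1/2"
  have L: "L > 0" "sqrt a + a - real j - 1/2 = L + 1" "real (Suc j) = s + a - L - 1/2"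
    using Suc.prems by (auto simp: L_def s_def)
  have a: "a = s * s" using a_pos by (simp add: s_def)
  have "F (Suc j) / p (Suc j) \<le> 1 + real (Suc j) / a * (2 * a / (L + 1))"
    unfolding head_ratio_Suc using Suc.IH L a_pos by (intro add_left_mono mult_left_mono) auto
  also have "\<dots> = (L + 1 + 2 * real (Suc j)) / (L + 1)"
    using a_pos L(1) by (simp add: field_simps del: of_nat_Suc)
  also have "\<dots> = (L + 1 + 2 * (s + a - L - 1/2)) / (L + 1)"
    unfolding L(3) ..
  also have "\<dots> \<le> 2 * a / L"
  proof -
    have "0 \<le> (L - s)^2 + a" using a_pos by simp
    then have "(L + 1 + 2 * (s + a - L - 1/2)) * L \<le> 2 * a * (L + 1)"
      by (simp add: power2_eq_square algebra_simps a)
    then show ?thesis using L(1) by (simp add: divide_simps) (simp add: algebra_simps)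
  qed
  finally show ?case by (simp add: L_def s_def)
qed

text \<open>The counterpart of \<open>head_ratio_bound_sqrt\<close> for the tail: clearing
  denominators turns the induction step into \<open>0 \<le> (R + 1 - s)^2 + a\<close>.\<close>

lemma tail_bound_sqrt:
  "sqrt a + real j - a + 1/2 > 0 \<Longrightarrow> tail n j \<le> 2 * a / (sqrt a + real j - a + 1/2)"
proof (induction n arbitrary: j)
  case 0 then show ?case using a_pos by (simp add: tail_0)
next
  case (Suc n)
  define s R where "s = sqrt a" and "R = s + real j - a + 1/2"
  have R: "R > 0" "sqrt a + real (Suc j) - a + 1/2 = R + 1" "2 * real (Suc j) = 2 * R - 2 * s + 2 * a + 1"
    using Suc.prems by (auto simp: R_def s_def)
  have a: "a = s * s" using a_pos by (simp add: s_def)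
  have "tail (Suc n) j \<le> a / real (Suc j) * (1 + 2 * a / (R + 1))"
    unfolding tail_Suc using Suc.IH[of "Suc j"] R a_pos by (intro mult_left_mono add_left_mono) auto
  also have "\<dots> = a * (R + 1 + 2 * a) / (real (Suc j) * (R + 1))" 
    using R(1) by (simp add: field_simps)
  also have "\<dots> \<le> 2 * a / R"
  proof -
    have "0 \<le> (R + 1 - s)^2 + a" using a_pos by simp
    then have "(R + 1 + 2 * a) * R \<le> 2 * real (Suc j) * (R + 1)"
      unfolding R(3) by (simp add: power2_eq_square algebra_simps a)
    then have "(R + 1 + 2 * a) / (real (Suc j) * (R + 1)) \<le> 2 / R" 
      using R(1) by (simp add: divide_simps del: of_nat_Suc)
    then have "a * ((R + 1 + 2 * a) / (real (Suc j) * (R + 1))) \<le> a * (2 / R)" 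
      using a_pos by (intro mult_left_mono) auto
    then show ?thesis by (simp add: mult_ac)
  qed
  finally show ?case by (simp add: R_def s_def)
qed

text \<open>Since \<open>F j + T j = 1\<close>, the reciprocals satisfy
  \<open>p / F + p / T = p / (F * T)\<close>, so lower bounds \<open>u / c\<close> and
  \<open>v / c\<close> on them add up to \<open>d / c\<close>. A nonpositive \<open>u\<close> or
  \<open>v\<close> is a lower bound for free; hence the premises ask for a bound only where the
  denominator is positive.\<close>

lemma head_tail_bound:
  assumes F1: "u > 0 \<Longrightarrow> F j / p j \<le> c / u" and T1: "v > 0 \<Longrightarrow> T j / p j \<le> c / v"
    and uv: "u + v = d" "d > 0" and c: "c > 0"
  shows "F j * T j / p j \<le> c / d"
proof -
  have "u / c \<le> p j / F j"
  proof (cases "u > 0")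
    case True
    then show ?thesis using F1 p_pos[of j] F_pos[of j] c by (simp add: divide_simps mult_ac)
  next
    case False
    then have "u / c \<le> 0" using c by (simp add: divide_nonpos_pos)
    also have "0 \<le> p j / F j" using p_pos[of j] F_pos[of j] by simp
    finally show ?thesis .
  qed
  moreover have "v / c \<le> p j / T j"
  proof (cases "v > 0")
    case True
    then show ?thesis using T1 p_pos[of j] T_pos[of j] c by (simp add: divide_simps mult_ac)
  next
    case False
    then have "v / c \<le> 0" using c by (simp add: divide_nonpos_pos)
    also have "0 \<le> p j / T j" using p_pos[of j] T_pos[of j] by simp
    finally show ?thesis .
  qed
  moreover have "d / c = u / c + v / c" using uv by (auto simp: add_divide_distrib)
  ultimately have "d / c \<le> p j / F j + p j / T j" by linarith
  also have "\<dots> = p j * (F j + T j) / (F j * T j)"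
    using F_pos[of j] T_pos[of j] by (simp add: field_simps)
  finally have "d / c \<le> p j / (F j * T j)" by (simp add: F_plus_T)
  then show ?thesis using F_pos[of j] T_pos[of j] p_pos[of j] uv c by (simp add: divide_simps mult_ac)
qed

text \<open>The linear bounds have \<open>u + v = 1\<close> and \<open>c = a\<close>, the
  square-root bounds \<open>u + v = 2 * sqrt a\<close> and \<open>c = 2 * a\<close>. Dividing by
  \<open>a\<close> leaves 1 and \<open>1 / sqrt a\<close>.\<close>

lemma head_tail_le: "F j * T j / (a * p j) \<le> min 1 (1 / sqrt a)"
proof -
  have "F j * T j / p j \<le> a / 1"
    by (rule head_tail_bound[where u = "a - real j" and v = "real j + 1 - a"])
       (use head_ratio_bound_linear T_ratio_le tail_bound_linear a_pos in auto)
  then have 1: "F j * T j / (a * p j) \<le> 1" using a_pos p_pos[of j] by (simp add: divide_simps mult_ac)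
  have "F j * T j / p j \<le> 2 * a / (2 * sqrt a)"
    by (rule head_tail_bound[where u = "sqrt a + a - real j - 1/2" and v = "sqrt a + real j - a + 1/2"])
       (use head_ratio_bound_sqrt T_ratio_le tail_bound_sqrt a_pos in auto)
  then have "F j * T j / p j / a \<le> 2 * a / (2 * sqrt a) / a" using a_pos by (intro divide_right_mono) auto
  then have "F j * T j / (a * p j) \<le> 1 / sqrt a" using a_pos by (simp add: mult_ac)
  with 1 show ?thesis by simp
qed

text \<open>Together with \<open>T_ratio_antimono\<close> this fixes the signs in the increment of
  the Stein solution: mass of \<open>A\<close> strictly below or strictly above the current point
  can only lower it.\<close>

lemma head_ratio_mono: "F j / p j \<le> F (Suc j) / p (Suc j)"
proof (induction j)
  case 0
  then show ?case unfolding head_ratio_Suc using p_pos[of 0] F_0 a_pos by simp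
next
  case (Suc j)
  have "real (Suc j) / a * (F j / p j) \<le> real (Suc (Suc j)) / a * (F (Suc j) / p (Suc j))"
    using Suc a_pos F_pos[of j] p_pos[of j] by (intro mult_mono divide_right_mono) (auto intro: less_imp_le)
  then show ?case unfolding head_ratio_Suc[of "Suc j"] by (subst head_ratio_Suc) simp
qed

lemma tail_antimono: "tail n (Suc j) \<le> tail n j"
proof (induction n arbitrary: j)
  case (Suc n)
  show ?case unfolding tail_Suc using Suc a_pos tail_nonneg
    by (intro mult_mono divide_left_mono add_left_mono add_nonneg_nonneg) auto
qed (simp add: tail_0)

lemma T_ratio_antimono: "T (Suc j) / p (Suc j) \<le> T j / p j"
  by (rule LIMSEQ_le[OF tail_tendsto tail_tendsto]) (auto intro: tail_antimono)

text \<open>Multiplying the Stein equation at \<open>i\<close> by \<open>p i\<close> and using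
  \<open>i * p i = a * p (i - 1)\<close> makes it telescope; summing over \<open>i < j\<close> gives
  this solution. At \<open>j = 0\<close> the numerator vanishes, so the truncated index
  \<open>j - 1\<close> does no harm.\<close>

definition stein :: "nat set \<Rightarrow> nat \<Rightarrow> real" where
  "stein A j = (\<pi> (A \<inter> {..<j}) - \<pi> A * \<pi> {..<j}) / (a * p (j - 1))"

text \<open>Splitting \<open>A\<close> at \<open>j\<close> exhibits the numerator as a difference of
  two terms that both lie between 0 and \<open>F j * T j\<close>. The bound on the size and the
  increment formula both start from this form.\<close>

lemma stein_Suc: "stein A (Suc j) = (\<pi> (A \<inter> {..j}) * T j - \<pi> (A \<inter> {j<..}) * F j) / (a * p j)"
proof -
  have "A \<inter> {..j} \<union> A \<inter> {j<..} = A" by auto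
  then have 1: "\<pi> A = \<pi> (A \<inter> {..j}) + \<pi> (A \<inter> {j<..})" using prob_Un[of "A \<inter> {..j}" "A \<inter> {j<..}"] by fastforce
  have 2: "T j = 1 - F j" using F_plus_T[of j] by simp
  have "\<pi> {..<Suc j} = F j" by (simp add: F_def lessThan_Suc_atMost)
  then show ?thesis unfolding 2 by (simp add: stein_def lessThan_Suc_atMost 1) (simp add: algebra_simps)
qed

lemma stein_equation: "a * stein A (Suc j) - real j * stein A j = indicator A j - \<pi> A"
proof -
  have s: "a * stein A (Suc i) = (\<pi> (A \<inter> {..i}) - \<pi> A * F i) / p i" for i
    using a_pos p_pos[of i] by (simp add: stein_def lessThan_Suc_atMost F_def)
  have ind: "\<pi> (A \<inter> {i}) = indicator A i * p i" for i
    by (cases "i \<in> A") (simp_all add: prob_singleton, simp add: \<pi>_def)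
  show ?thesis
  proof (cases j)
    case 0
    have "{..0::nat} = {0}" by auto
    then show ?thesis unfolding 0 s using p_pos[of 0] ind[of 0] by (simp add: F_0 field_simps)
  next
    case (Suc i)
    have "real j * stein A j = (\<pi> (A \<inter> {..i}) - \<pi> A * F i) / p j"
    proof -
      have "real j / (a * p i) = 1 / p j"
        using p_Suc[of i] p_pos[of i] p_pos[of j] a_pos Suc by (simp add: divide_simps mult_ac)
      then have "real j * (X / (a * p i)) = X / p j" for X
        by (metis (no_types, opaque_lifting) mult.commute mult_1 times_divide_eq_left times_divide_eq_right)
      then show ?thesis unfolding stein_def Suc by (simp add: lessThan_Suc_atMost F_def)
    qed
    moreover have prob_disj: "A \<inter> {..i} \<inter> (A \<inter> {j}) = {}" using Suc by auto
    have "A \<inter> {..j} = A \<inter> {..i} \<union> A \<inter> {j}" using Suc by auto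
    then have "\<pi> (A \<inter> {..j}) = \<pi> (A \<inter> {..i}) + indicator A j * p j"
      using prob_disj unfolding ind[of j, symmetric] by (simp only: prob_Un)
    moreover have "F j = F i + p j" using F_Suc Suc by simp
    ultimately show ?thesis unfolding s using p_pos[of j] by (simp add: field_simps)
  qed
qed

lemma stein_bound: "\<bar>stein A (Suc j)\<bar> \<le> min 1 (1 / sqrt a)"
proof -
  have 1: "0 \<le> \<pi> (A \<inter> {..j}) * T j" "\<pi> (A \<inter> {..j}) * T j \<le> F j * T j"
    "0 \<le> \<pi> (A \<inter> {j<..}) * F j" "\<pi> (A \<inter> {j<..}) * F j \<le> T j * F j"
    using T_pos[of j] F_pos[of j] prob_nonneg by (auto simp: F_def T_def intro!: mult_right_mono prob_mono)
  then have "\<bar>\<pi> (A \<inter> {..j}) * T j - \<pi> (A \<inter> {j<..}) * F j\<bar> \<le> F j * T j" 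
    unfolding abs_le_iff by (simp add: mult.commute)
  then have "\<bar>stein A (Suc j)\<bar> \<le> F j * T j / (a * p j)"
    unfolding stein_Suc using a_pos p_pos[of j] by (simp add: abs_divide abs_mult divide_right_mono)
  with head_tail_le[of j] show ?thesis by simp
qed

text \<open>Only an atom of \<open>A\<close> at \<open>Suc i\<close> can raise the solution, by the
  monotonicity of the two ratios. After multiplication by \<open>a\<close> its contribution is at
  most \<open>1 - exp (- a)\<close>, which is bounded both by 1 and by \<open>a\<close>; dividing by
  \<open>a\<close> gives the minimum.\<close>

lemma stein_increment_le: "stein A (Suc (Suc i)) - stein A (Suc i) \<le> min 1 (1 / a)"
proof -
  let ?j = "Suc i"
  define u v w where "u = \<pi> (A \<inter> {..i})" and "v = \<pi> (A \<inter> {?j})" and "w = \<pi> (A \<inter> {?j<..})"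
  have nn: "u \<ge> 0" "v \<ge> 0" "w \<ge> 0" "v \<le> p ?j"
    using prob_mono[of "A \<inter> {?j}" "{?j}"] by (auto simp: u_def v_def w_def prob_nonneg prob_singleton)
  have "A \<inter> {..?j} = A \<inter> {..i} \<union> A \<inter> {?j}" "A \<inter> {i<..} = A \<inter> {?j} \<union> A \<inter> {?j<..}" by auto
  moreover have "A \<inter> {..i} \<inter> (A \<inter> {?j}) = {}" "A \<inter> {?j} \<inter> (A \<inter> {?j<..}) = {}" by auto
  ultimately have uv: "\<pi> (A \<inter> {..?j}) = u + v" "\<pi> (A \<inter> {i<..}) = v + w"
    by (simp_all only: u_def v_def w_def prob_Un)
  let ?A = "\<lambda>j. F j / p j" and ?B = "\<lambda>j. T j / p j"
  have "a * (stein A (Suc ?j) - stein A ?j)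
      = ((u + v) * ?B ?j - w * ?A ?j) - (u * ?B i - (v + w) * ?A i)"
    unfolding stein_Suc uv w_def[symmetric] u_def[symmetric] using a_pos
    by (simp add: diff_divide_distrib right_diff_distrib)
  also have "\<dots> = u * (?B ?j - ?B i) + w * (?A i - ?A ?j) + v * (?B ?j + ?A i)"
    by (simp add: algebra_simps add_divide_distrib)
  also have "\<dots> \<le> 0 + 0 + p ?j * (?B ?j + ?A i)"
    using nn head_ratio_mono[of i] T_ratio_antimono[of i] T_pos[of ?j] F_pos[of i] p_pos[of i] p_pos[of ?j]
    by (intro add_mono mult_nonneg_nonpos mult_right_mono) (auto intro!: add_nonneg_nonneg less_imp_le)
  also have "\<dots> = T ?j + a / real ?j * F i"
  proof -
    have "p ?j / p i = a / real ?j" using p_Suc[of i] p_pos[of i] by (simp add: divide_simps mult_ac del: of_nat_Suc)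
    then have "p ?j * ?A i = a / real ?j * F i" by (metis times_divide_eq_left times_divide_eq_right mult.commute)
    then show ?thesis using p_pos[of ?j] by (simp add: distrib_left)
  qed
  \<comment> \<open>Each \<open>a * p l\<close> equals \<open>(l + 1) * p (l + 1)\<close> with
    \<open>l + 1\<close> at most \<open>?j\<close>, so the sum for \<open>F i\<close> is shifted by
    one index. The shifted sum lacks \<open>p 0\<close>, and this is the origin of
    \<open>exp (- a)\<close>.\<close>
  also have "a / real ?j * F i \<le> F ?j - p 0"
  proof -
    have F: "F n = (\<Sum>l\<le>n. p l)" for n
      unfolding F_def \<pi>_def p_def by (simp add: measure_measure_pmf_finite)
    have "a / real ?j * F i = (\<Sum>l\<le>i. a * p l / real ?j)" unfolding F sum_distrib_left by simp
    also have "\<dots> \<le> (\<Sum>l\<le>i. p (Suc l))"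
    proof (rule sum_mono)
      fix l assume "l \<in> {..i}"
      then have "p (Suc l) * real (Suc l) \<le> p (Suc l) * real ?j" using p_pos[of "Suc l"] by (intro mult_left_mono) auto
      then show "a * p l / real ?j \<le> p (Suc l)" unfolding p_Suc[of l] by (simp add: divide_simps del: of_nat_Suc)
    qed
    also have "\<dots> = F ?j - p 0" unfolding F by (simp only: sum.atMost_Suc_shift)
    finally show ?thesis .
  qed
  also have "T ?j + (F ?j - p 0) = 1 - exp (- a)" using F_plus_T[of ?j] a_pos by (simp add: p_def)
  finally have *: "a * (stein A (Suc ?j) - stein A ?j) \<le> 1 - exp (- a)" by simp
  then have "a * (stein A (Suc ?j) - stein A ?j) \<le> 1" 
    using exp_gt_zero[of "-a"] by linarith
  moreover have "1 - exp (- a) \<le> a" using exp_ge_add_one_self[of "-a"] by simp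
  with * have "a * (stein A (Suc ?j) - stein A ?j) \<le> a * 1" by simp
  then have "stein A (Suc ?j) - stein A ?j \<le> 1" using a_pos by (simp only: mult_le_cancel_left_pos)
  ultimately show ?thesis using a_pos by (simp add: field_simps)
qed

text \<open>Passing to the complement flips the sign, so the one-sided increment bound, which holds
  for every set, yields the bound on the absolute value.\<close>

lemma stein_Compl: "stein (- A) j = - stein A j"
proof -
  have "\<pi> (- A \<inter> {..<j}) + \<pi> (A \<inter> {..<j}) = \<pi> {..<j}"
    by (subst prob_Un[symmetric]) (auto intro!: arg_cong[where f = \<pi>])
  then have 1: "\<pi> (- A \<inter> {..<j}) = \<pi> {..<j} - \<pi> (A \<inter> {..<j})" by linarith
  have "\<pi> (- A) + \<pi> A = 1" by (subst prob_Un[symmetric]) (auto simp: \<pi>_def)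
  then have 2: "\<pi> (- A) = 1 - \<pi> A" by linarith
  show ?thesis unfolding stein_def 1 2 by (simp add: algebra_simps minus_divide_left)
qed

lemma stein_increment: "\<bar>stein A (Suc (Suc i)) - stein A (Suc i)\<bar> \<le> min 1 (1 / a)"
  using stein_increment_le[of A i] stein_increment_le[of "- A" i] by (simp add: stein_Compl abs_le_iff)

end

text \<open>The bounds concern positive arguments only. The value at 0 enters the equation with the
  factor 0 and may be redefined at will, which is exploited when the solution is shifted.\<close>

lemma stein_chen_solution:
  fixes a :: real
  assumes "a > 0"
  obtains h :: "nat \<Rightarrow> real" where
    "\<And>j. a * h (Suc j) - real j * h j = indicator A j - measure_pmf.prob (poisson_pmf a) A"
    "\<And>j. \<bar>h (Suc j)\<bar> \<le> min 1 (1 / sqrt a)"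
    "\<And>j. \<bar>h (Suc (Suc j)) - h (Suc j)\<bar> \<le> min 1 (1 / a)"
  using stein_equation[OF assms] stein_bound[OF assms] stein_increment[OF assms] that by blast

section \<open>Counting measures\<close>

definition relcompact :: "'x::topological_space set \<Rightarrow> bool" where
  "relcompact A \<longleftrightarrow> A \<in> sets borel \<and> (\<exists>C. compact C \<and> A \<subseteq> C)"

lemma relcompact_borel: "relcompact A \<Longrightarrow> A \<in> sets borel"
  by (simp add: relcompact_def)

lemma relcompact_subset: "relcompact A \<Longrightarrow> B \<subseteq> A \<Longrightarrow> B \<in> sets borel \<Longrightarrow> relcompact B"
  unfolding relcompact_def by blast

lemma relcompact_Int: "relcompact A \<Longrightarrow> B \<in> sets borel \<Longrightarrow> relcompact (A \<inter> B)"
  by (rule relcompact_subset) (auto intro: relcompact_borel)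

lemma relcompact_Diff: "relcompact A \<Longrightarrow> B \<in> sets borel \<Longrightarrow> relcompact (A - B)"
  by (rule relcompact_subset) (auto intro: relcompact_borel)

text \<open>A countable partition into pieces with finite counts localises what would otherwise need
  a finite measure: measurability of integrals against configurations, generation of the
  \<sigma>-field of \<open>NX\<close> by finite counts, and \<sigma>-finiteness of the
  intensity.\<close>

locale relcompact_partition =
  fixes X :: "nat \<Rightarrow> 'x::{second_countable_topology, t2_space} set"
  assumes relcompact_X: "relcompact (X n)"
    and disjoint_X: "disjoint_family X"
    and UN_X: "(\<Union>n. X n) = UNIV"

lemma ex_relcompact_partition:
  assumes lc: "locally_compact_space (euclidean :: 'x::{second_countable_topology, t2_space} topology)"
  shows "\<exists>X :: nat \<Rightarrow> 'x set. relcompact_partition X"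
proof -
  obtain B :: "'x set set" where B: "countable B" "topological_basis B"
    using ex_countable_basis by auto
  define D where "D = {b \<in> B. \<exists>C. compact C \<and> b \<subseteq> C}"
  have D: "countable D" using B(1) by (simp add: D_def)
  have "\<exists>b\<in>D. x \<in> b" for x
  proof -
    obtain U C where UC: "open U" "compact C" "x \<in> U" "U \<subseteq> C"
      using lc by (simp add: locally_compact_space_def) metis
    then obtain b where "b \<in> B" "x \<in> b" "b \<subseteq> U" using topological_basisE[OF B(2)] by metis
    with UC show ?thesis unfolding D_def by blast
  qed
  then have UD: "\<Union>D = UNIV" by blast
  then have ne: "D \<noteq> {}" by auto
  let ?A = "from_nat_into D"
  have A: "relcompact (?A n)" for n
    using from_nat_into[OF ne, of n] topological_basis_open[OF B(2)] unfolding relcompact_def D_def by auto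
  have "relcompact_partition (disjointed ?A)"
  proof
    show "disjoint_family (disjointed ?A)" by (rule disjoint_family_disjointed)
    show "(\<Union>n. disjointed ?A n) = UNIV"
      unfolding UN_disjointed_eq using range_from_nat_into[OF ne D] UD by simp
    show "relcompact (disjointed ?A n)" for n
      by (rule relcompact_subset[OF A disjointed_subset])
         (unfold disjointed_def, intro sets.Diff sets.finite_UN finite_atLeastLessThan relcompact_borel A)
  qed
  then show ?thesis by blast
qed

section \<open>Integration against a configuration and the measurable space of
  configurations\<close>

definition csum :: "('x \<Rightarrow> nat) \<Rightarrow> ('x \<Rightarrow> ennreal) \<Rightarrow> ennreal" where
  "csum w h = (\<integral>\<^sup>+ y. of_nat (w y) * h y \<partial>count_space UNIV)"

text \<open>The sum \<open>csum\<close> makes sense for every integrand; this Borel measure is its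
  companion wherever densities and kernels are needed.\<close>

definition cmeas :: "('x::topological_space \<Rightarrow> nat) \<Rightarrow> 'x measure" where
  "cmeas w = distr (density (count_space UNIV) (\<lambda>x. of_nat (w x))) borel (\<lambda>x. x)"

lemma sets_cmeas[simp, measurable_cong]: "sets (cmeas w) = sets borel"
  by (simp add: cmeas_def)

lemma nn_integral_cmeas: "h \<in> borel_measurable borel \<Longrightarrow> integral\<^sup>N (cmeas w) h = csum w h"
  by (simp add: cmeas_def csum_def nn_integral_distr nn_integral_density)

lemma cnt_eq_csum: "cnt w A = csum w (indicator A)"
  by (simp add: cnt_def csum_def)

lemma emeasure_cmeas: "A \<in> sets borel \<Longrightarrow> emeasure (cmeas w) A = cnt w A"
  using nn_integral_cmeas[of "indicator A" w] by (simp add: cnt_eq_csum)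

lemma csum_cong: "(\<And>y. w y \<noteq> 0 \<Longrightarrow> h y = h' y) \<Longrightarrow> csum w h = csum w h'"
  unfolding csum_def by (rule nn_integral_cong) (metis mult_eq_0_iff of_nat_0)

lemma csum_add: "csum w (\<lambda>y. h y + h' y) = csum w h + csum w h'"
  unfolding csum_def by (simp add: distrib_left nn_integral_add)

lemma csum_cmult: "csum w (\<lambda>y. c * h y) = c * csum w h"
  unfolding csum_def by (simp add: nn_integral_cmult mult.left_commute[of _ c])

lemma csum_eq_sum:
  assumes "finite V" "\<And>y. y \<notin> V \<Longrightarrow> w y = 0 \<or> h y = 0"
  shows "csum w h = (\<Sum>y\<in>V. of_nat (w y) * h y)"
  unfolding csum_def using assms by (intro nn_integral_count_space') auto

lemma cnt_Un: "A \<inter> B = {} \<Longrightarrow> cnt w (A \<union> B) = cnt w A + cnt w B"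
  unfolding cnt_eq_csum by (subst csum_add[symmetric]) (auto intro!: csum_cong simp: indicator_def)

lemma cnt_UN_finite:
  assumes "finite I" "disjoint_family_on A I"
  shows "cnt w (\<Union>i\<in>I. A i) = (\<Sum>i\<in>I. cnt w (A i))"
  using assms
proof (induction I rule: finite_induct)
  case empty then show ?case by (simp add: cnt_def)
next
  case (insert i I)
  have "A i \<inter> (\<Union>j\<in>I. A j) = {}" using insert.prems insert.hyps(2) unfolding disjoint_family_on_def by auto
  moreover have "disjoint_family_on A I" using insert.prems unfolding disjoint_family_on_def by auto
  ultimately show ?case using insert by (simp add: cnt_Un)
qed

lemma cnt_relcompact_nat:
  assumes "lf_count w" "relcompact A"
  shows "\<exists>n::nat. cnt w A = of_nat n"
proof -
  obtain C where C: "compact C" "A \<subseteq> C" using assms(2) unfolding relcompact_def by blast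
  let ?V = "{x \<in> C. w x \<noteq> 0}"
  have "cnt w A = (\<Sum>y\<in>?V. of_nat (w y) * indicator A y)"
    unfolding cnt_eq_csum using assms(1) C by (intro csum_eq_sum) (auto simp: lf_count_def indicator_def split: if_splits)
  also have "\<dots> = of_nat (\<Sum>y\<in>?V. w y * (if y \<in> A then 1 else 0))"
    by (auto simp: of_nat_sum intro!: sum.cong)
  finally show ?thesis by blast
qed

lemma space_NX: "space NX = {w. lf_count w}"
  unfolding NX_def by (rule space_measure_of) auto

lemma measurable_cnt[measurable]:
  assumes "A \<in> sets borel" shows "(\<lambda>w. cnt w A) \<in> borel_measurable NX"
proof (rule measurableI)
  fix B :: "ennreal set" assume "B \<in> sets borel"
  then have "{w. lf_count w \<and> cnt w A \<in> B} \<in> sets NX"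
    unfolding NX_def using assms by (subst sets_measure_of) (auto intro!: sigma_sets.Basic)
  moreover have "(\<lambda>w. cnt w A) -` B \<inter> space NX = {w. lf_count w \<and> cnt w A \<in> B}"
    by (auto simp: space_NX)
  ultimately show "(\<lambda>w. cnt w A) -` B \<inter> space NX \<in> sets NX" by simp
qed simp

lemma measurable_NX:
  fixes L :: "'p \<Rightarrow> 'x::topological_space \<Rightarrow> nat"
  assumes "\<And>p. p \<in> space N \<Longrightarrow> lf_count (L p)"
    and "\<And>A. A \<in> sets borel \<Longrightarrow> (\<lambda>p. cnt (L p) A) \<in> borel_measurable N"
  shows "L \<in> N \<rightarrow>\<^sub>M NX"
  unfolding NX_def
proof (rule measurable_measure_of)
  fix Y :: "('x \<Rightarrow> nat) set" assume "Y \<in> {{w. lf_count w \<and> cnt w A \<in> B} | A B. A \<in> sets borel \<and> B \<in> sets (borel :: ennreal measure)}"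
  then obtain A and B :: "ennreal set" where Y: "Y = {w. lf_count w \<and> cnt w A \<in> B}" "A \<in> sets borel" "B \<in> sets borel" by auto
  have "L -` Y \<inter> space N = (\<lambda>p. cnt (L p) A) -` B \<inter> space N" using assms(1) unfolding Y by auto
  then show "L -` Y \<inter> space N \<in> sets N" using assms(2)[OF Y(2)] Y(3) by (simp add: measurable_sets)
next
  show "L \<in> space N \<rightarrow> {w. lf_count w}" using assms(1) by simp
qed auto

lemma lf_count_measurable: "L \<in> N \<rightarrow>\<^sub>M NX \<Longrightarrow> p \<in> space N \<Longrightarrow> lf_count (L p)"
  using measurable_space[of L N NX p] by (simp add: space_NX)

context relcompact_partition begin

lemma X_borel[measurable, simp]: "X n \<in> sets borel"
  by (rule relcompact_borel[OF relcompact_X])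

lemma suminf_indicator_X: "(\<Sum>n. indicator (X n) y) = (1::ennreal)"
  using suminf_indicator[OF disjoint_X, of y] by (simp add: UN_X)

lemma csum_suminf_X: "csum w h = (\<Sum>n. csum w (\<lambda>y. indicator (X n) y * h y))"
proof -
  have "(\<Sum>n. of_nat (w y) * (indicator (X n) y * h y)) = of_nat (w y) * h y" for y
  proof -
    have "(\<Sum>n. of_nat (w y) * (indicator (X n) y * h y)) = (\<Sum>n. indicator (X n) y * (of_nat (w y) * h y))"
      by (simp only: mult.left_commute)
    also have "\<dots> = of_nat (w y) * h y"
      by (simp only: ennreal_suminf_multc suminf_indicator_X mult_1_left)
    finally show ?thesis .
  qed
  then show ?thesis
    unfolding csum_def by (subst nn_integral_suminf[symmetric]) simp_all
qed

text \<open>The configuration and the integrand may both depend on the parameter. On each piece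
  \<open>X n\<close> the counting measure is finite; dividing it by its mass gives a subprobability
  kernel, for which integrals depend measurably on the parameter. The mass is multiplied back and
  the pieces are summed.\<close>

lemma borel_measurable_csum:
  fixes H :: "'p \<Rightarrow> 'x \<Rightarrow> ennreal"
  assumes H[measurable]: "(\<lambda>(p, y). H p y) \<in> borel_measurable (N \<Otimes>\<^sub>M borel)"
    and L[measurable]: "L \<in> N \<rightarrow>\<^sub>M NX"
  shows "(\<lambda>p. csum (L p) (H p)) \<in> borel_measurable N"
proof -
  have [measurable]: "(\<lambda>p. csum (L p) (\<lambda>y. indicator (X n) y * H p y)) \<in> borel_measurable N" for n
  proof -
    \<comment> \<open>On a piece without points the density is infinite but carries no mass, and
      \<open>0 / 0 = 0\<close> makes \<open>\<kappa> p\<close> the zero measure there.\<close>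
    define \<kappa> where "\<kappa> p = density (cmeas (L p)) (\<lambda>y. indicator (X n) y / cnt (L p) (X n))" for p
    have em: "emeasure (\<kappa> p) A = cnt (L p) (X n \<inter> A) / cnt (L p) (X n)" if [measurable]: "A \<in> sets borel" for A p
    proof -
      have "emeasure (\<kappa> p) A = (\<integral>\<^sup>+ y. indicator (X n \<inter> A) y / cnt (L p) (X n) \<partial>cmeas (L p))"
        unfolding \<kappa>_def by (subst emeasure_density) (auto intro!: nn_integral_cong simp: indicator_def)
      also have "\<dots> = emeasure (cmeas (L p)) (X n \<inter> A) / cnt (L p) (X n)"
        by (subst nn_integral_divide) auto
      finally show ?thesis by (simp add: emeasure_cmeas)
    qed
    have fin: "cnt (L p) (X n) \<noteq> \<infinity>" if "p \<in> space N" for p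
      using cnt_relcompact_nat[OF lf_count_measurable[OF L that] relcompact_X] by (metis ennreal_of_nat_neq_top infinity_ennreal_def)
    have \<kappa>: "\<kappa> \<in> N \<rightarrow>\<^sub>M subprob_algebra borel"
    proof (rule measurable_subprob_algebra)
      fix p assume p: "p \<in> space N"
      show "subprob_space (\<kappa> p)"
      proof (rule subprob_spaceI)
        have "space (\<kappa> p) = UNIV" by (simp add: \<kappa>_def cmeas_def)
        then show "emeasure (\<kappa> p) (space (\<kappa> p)) \<le> 1"
          using em[of UNIV p] fin[OF p] by (cases "cnt (L p) (X n) = 0") (simp_all add: ennreal_divide_self less_top)
        show "space (\<kappa> p) \<noteq> {}" by (simp add: \<kappa>_def cmeas_def)
      qed
    next
      fix A :: "'x set" assume [measurable]: "A \<in> sets borel"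
      show "(\<lambda>p. emeasure (\<kappa> p) A) \<in> borel_measurable N" unfolding em[OF \<open>A \<in> sets borel\<close>] by measurable
    qed (simp add: \<kappa>_def)
    have 1: "(\<lambda>p. integral\<^sup>N (\<kappa> p) (H p)) \<in> borel_measurable N"
      by (rule nn_integral_measurable_subprob_algebra2[OF H \<kappa>])
    have 2: "csum (L p) (\<lambda>y. indicator (X n) y * H p y) = cnt (L p) (X n) * integral\<^sup>N (\<kappa> p) (H p)" if p: "p \<in> space N" for p
    proof -
      have [measurable]: "H p \<in> borel_measurable borel" using measurable_compose[OF measurable_Pair1'[OF p] H] by simp
      have c: "csum (L p) (\<lambda>y. indicator (X n) y * H p y) = (\<integral>\<^sup>+ y. indicator (X n) y * H p y \<partial>cmeas (L p))"
        by (subst nn_integral_cmeas) auto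
      show ?thesis
      proof (cases "cnt (L p) (X n) = 0")
        case True
        then have "X n \<in> null_sets (cmeas (L p))" by (auto simp: emeasure_cmeas)
        then have "AE y in cmeas (L p). y \<notin> X n" by (rule AE_not_in)
        then have "(\<integral>\<^sup>+ y. indicator (X n) y * H p y \<partial>cmeas (L p)) = (\<integral>\<^sup>+ y. 0 \<partial>cmeas (L p))"
          by (intro nn_integral_cong_AE) auto
        then show ?thesis using True c by simp
      next
        case False
        have "integral\<^sup>N (\<kappa> p) (H p) = (\<integral>\<^sup>+ y. indicator (X n) y * H p y / cnt (L p) (X n) \<partial>cmeas (L p))"
          unfolding \<kappa>_def by (subst nn_integral_density) (auto intro!: nn_integral_cong simp: divide_ennreal_def mult_ac)
        also have "\<dots> = csum (L p) (\<lambda>y. indicator (X n) y * H p y) / cnt (L p) (X n)"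
          by (subst nn_integral_divide) (auto simp: c)
        finally show ?thesis using False fin[OF p]
          by (simp add: ennreal_times_divide mult.commute[of "cnt (L p) (X n)"] ennreal_mult_divide_eq)
      qed
    qed
    have "(\<lambda>p. cnt (L p) (X n) * integral\<^sup>N (\<kappa> p) (H p)) \<in> borel_measurable N" using 1 by measurable
    then show ?thesis by (subst measurable_cong[OF 2])
  qed
  show ?thesis by (subst csum_suminf_X) measurable
qed

end

section \<open>Adding and removing a single point\<close>

definition ins :: "'x \<Rightarrow> ('x \<Rightarrow> nat) \<Rightarrow> 'x \<Rightarrow> nat" where "ins y w = fun_upd w y (Suc (w y))"

definition del :: "'x \<Rightarrow> ('x \<Rightarrow> nat) \<Rightarrow> 'x \<Rightarrow> nat" where "del y w = fun_upd w y (w y - 1)"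

lemma ins_del: "w y > 0 \<Longrightarrow> ins y (del y w) = w" and del_ins: "del y (ins y w) = w"
  by (auto simp: ins_def del_def fun_eq_iff)

lemma del_ins_commute: "w z > 0 \<Longrightarrow> del z (ins y w) = ins y (del z w)"
  by (auto simp: ins_def del_def fun_eq_iff)

lemma csum_ins: "csum (ins y w) h = csum w h + h y"
proof -
  have "csum (ins y w) h = (\<integral>\<^sup>+ z. of_nat (w z) * h z + h z * indicator {y} z \<partial>count_space UNIV)"
    unfolding csum_def by (rule nn_integral_cong) (auto simp: ins_def distrib_right add.commute)
  also have "\<dots> = csum w h + (\<integral>\<^sup>+ z. h z * indicator {y} z \<partial>count_space UNIV)"
    unfolding csum_def by (rule nn_integral_add) simp_all
  also have "(\<integral>\<^sup>+ z. h z * indicator {y} z \<partial>count_space UNIV) = (\<Sum>z\<in>{y}. h z * indicator {y} z)"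
    by (rule nn_integral_count_space') auto
  also have "csum w h + \<dots> = csum w h + h y" by simp
  finally show ?thesis .
qed

lemma lf_count_ins:
  fixes w :: "'x::topological_space \<Rightarrow> nat"
  shows "lf_count w \<Longrightarrow> lf_count (ins y w)"
  unfolding lf_count_def ins_def
proof (intro allI impI)
  fix C :: "'x set" assume *: "\<forall>C. compact C \<longrightarrow> finite {x \<in> C. w x \<noteq> 0}" "compact C"
  have "{x \<in> C. (fun_upd w y (Suc (w y))) x \<noteq> 0} \<subseteq> insert y {x \<in> C. w x \<noteq> 0}" by auto
  then show "finite {x \<in> C. (fun_upd w y (Suc (w y))) x \<noteq> 0}" using * by (meson finite.insertI finite_subset)
qed

lemma lf_count_mono:
  assumes "lf_count w" "\<And>y. w' y \<noteq> 0 \<Longrightarrow> w y \<noteq> 0"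
  shows "lf_count w'"
  unfolding lf_count_def
proof (intro allI impI)
  fix C :: "'a set" assume "compact C"
  then have "finite {x \<in> C. w x \<noteq> 0}" using assms(1) by (simp add: lf_count_def)
  then show "finite {x \<in> C. w' x \<noteq> 0}" by (rule finite_subset[rotated]) (use assms(2) in auto)
qed

lemma lf_count_del: "lf_count w \<Longrightarrow> lf_count (del y w)"
  by (erule lf_count_mono) (auto simp: del_def split: if_splits)

lemma measurable_ins[measurable (raw)]:
  fixes Y :: "'p \<Rightarrow> 'x::topological_space"
  assumes Y[measurable]: "Y \<in> borel_measurable N" and L[measurable]: "L \<in> N \<rightarrow>\<^sub>M NX"
  shows "(\<lambda>p. ins (Y p) (L p)) \<in> N \<rightarrow>\<^sub>M NX"
proof (rule measurable_NX)
  fix A :: "'x set" assume [measurable]: "A \<in> sets borel"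
  show "(\<lambda>p. cnt (ins (Y p) (L p)) A) \<in> borel_measurable N"
    unfolding cnt_eq_csum csum_ins unfolding cnt_eq_csum[symmetric] by measurable
qed (auto intro!: lf_count_ins lf_count_measurable[OF L])

context relcompact_partition begin

text \<open>The multiplicity at a moving point is the integral of the indicator of the graph of
  \<open>Y\<close>, and that graph is measurable because the space is second countable and
  Hausdorff.\<close>

lemma borel_measurable_multiplicity:
  fixes Y :: "'p \<Rightarrow> 'x"
  assumes Y[measurable]: "Y \<in> borel_measurable N" and L[measurable]: "L \<in> N \<rightarrow>\<^sub>M NX"
  shows "(\<lambda>p. of_nat (L p (Y p)) :: ennreal) \<in> borel_measurable N"
proof -
  have [measurable]: "{w \<in> space (N \<Otimes>\<^sub>M borel). Y (fst w) = snd w} \<in> sets (N \<Otimes>\<^sub>M borel)"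
    by (rule measurable_equality_set) measurable
  have "(\<lambda>p. csum (L p) (\<lambda>y. indicator {w \<in> space (N \<Otimes>\<^sub>M borel). Y (fst w) = snd w} (p, y))) \<in> borel_measurable N"
    by (rule borel_measurable_csum) (auto simp: case_prod_beta)
  moreover have "csum (L p) (\<lambda>y. indicator {w \<in> space (N \<Otimes>\<^sub>M borel). Y (fst w) = snd w} (p, y)) = of_nat (L p (Y p))" if "p \<in> space N" for p
    using that by (subst csum_eq_sum[where V = "{Y p}"]) (auto simp: space_pair_measure)
  ultimately show ?thesis by (subst measurable_cong) auto
qed

lemma measurable_del:
  fixes Y :: "'p \<Rightarrow> 'x"
  assumes Y[measurable]: "Y \<in> borel_measurable N" and L[measurable]: "L \<in> N \<rightarrow>\<^sub>M NX"
  shows "(\<lambda>p. del (Y p) (L p)) \<in> N \<rightarrow>\<^sub>M NX"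
proof (rule measurable_NX)
  fix A :: "'x set" assume [measurable]: "A \<in> sets borel"
  \<comment> \<open>Truncated subtraction leaves a multiplicity 0 unchanged, so the count drops only
    if \<open>y\<close> is a point of \<open>w\<close>. The test for this is measurable by the lemma
    on multiplicities.\<close>
  have *: "cnt (del y w) A = cnt w A - indicator A y * (if of_nat (w y) = (0::ennreal) then 0 else 1)" for y w
  proof (cases "w y = 0")
    case True
    then have "del y w = w" by (auto simp: del_def fun_eq_iff)
    then show ?thesis using True by simp
  next
    case False
    then have "cnt w A = cnt (del y w) A + indicator A y"
      using csum_ins[of y "del y w" "indicator A"] ins_del[of w y] by (simp add: cnt_eq_csum)
    then show ?thesis using False by (simp add: indicator_def)
  qed
  note borel_measurable_multiplicity[OF Y L, measurable]
  show "(\<lambda>p. cnt (del (Y p) (L p)) A) \<in> borel_measurable N"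
    unfolding * by measurable
qed (auto intro!: lf_count_del lf_count_measurable[OF L])

end

section \<open>Sums over tuples of distinct points: recursion and measurability\<close>

lemma fmult_eq_prod:
  assumes "finite V" "x ` {..<k} \<subseteq> V"
  shows "fmult w k x = (\<Prod>v\<in>V. \<Prod>j < card {i. i < k \<and> x i = v}. (w v - j))"
  unfolding fmult_def
proof (rule prod.mono_neutral_left[OF assms], rule ballI)
  fix v assume "v \<in> V - x ` {..<k}"
  then have "{i. i < k \<and> x i = v} = {}" by auto
  then show "(\<Prod>j<card {i. i < k \<and> x i = v}. w v - j) = 1"
    by (simp only: card.empty lessThan_0 prod.empty)
qed

text \<open>If the last entry is chosen first, there are \<open>w y\<close> copies to choose from
  and one copy fewer for the remaining entries. In the falling factorial at \<open>y\<close> this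
  splits off the leading factor; other points are unaffected.\<close>

lemma fmult_Suc: "fmult w (Suc k) (x(k := y)) = w y * fmult (del y w) k x"
proof -
  let ?V = "insert y (x ` {..<k})"
  let ?m = "\<lambda>v. card {i. i < k \<and> x i = v}"
  have m: "card {i. i < Suc k \<and> (x(k := y)) i = v} = (if v = y then Suc (?m y) else ?m v)" for v
  proof -
    have "{i. i < Suc k \<and> (x(k := y)) i = v} = {i. i < k \<and> x i = v} \<union> (if v = y then {k} else {})" by (auto simp: less_Suc_eq)
    then show ?thesis by (auto simp: card_insert_disjoint)
  qed
  have V: "(x(k := y)) ` {..<Suc k} \<subseteq> ?V" by (auto simp: less_Suc_eq)
  have "fmult w (Suc k) (x(k := y)) = (\<Prod>v\<in>?V. \<Prod>j < (if v = y then Suc (?m y) else ?m v). (w v - j))"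
    by (simp only: fmult_eq_prod[OF _ V] finite_insert finite_imageI finite_lessThan m)
  also have "\<dots> = (\<Prod>j < Suc (?m y). (w y - j)) * (\<Prod>v\<in>?V - {y}. \<Prod>j < ?m v. (w v - j))"
    by (subst prod.remove[of _ y]) (auto intro!: prod.cong arg_cong2[where f = "(*)"])
  also have "(\<Prod>j < Suc (?m y). (w y - j)) = w y * (\<Prod>j < ?m y. (del y w y - j))"
    by (simp only: prod.lessThan_Suc_shift) (simp add: del_def)
  also have "(\<Prod>v\<in>?V - {y}. \<Prod>j < ?m v. (w v - j)) = (\<Prod>v\<in>?V - {y}. \<Prod>j < ?m v. (del y w v - j))"
    by (intro prod.cong) (auto simp: del_def)
  also have "w y * (\<Prod>j < ?m y. (del y w y - j)) * \<dots> = w y * (\<Prod>v\<in>?V. \<Prod>j < ?m v. (del y w v - j))"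
    by (subst prod.remove[of ?V y]) (auto simp: mult_ac)
  also have "\<dots> = w y * fmult (del y w) k x"
    by (subst fmult_eq_prod[where V = ?V]) auto
  finally show ?thesis .
qed

lemma fact_sum_0: "fact_sum w 0 h = h (\<lambda>_. undefined)"
  by (simp add: fact_sum_def fmult_def nn_integral_count_space_finite)

text \<open>A sum over tuples becomes an iterated sum over single points, each deleted once chosen.
  The inductions on \<open>k\<close> for measurability, for the Mecke formula and for added points
  all rest on this recursion.\<close>

lemma fact_sum_Suc:
  "fact_sum w (Suc k) h = csum w (\<lambda>y. fact_sum (del y w) k (\<lambda>x. h (x(k := y))))"
proof -
  let ?P = "\<lambda>k. PiE {..<k} (\<lambda>_. UNIV :: 'a set)"
  define F where "F = (\<lambda>x. of_nat (fmult w (Suc k) x) * h x)"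
  have "?P (Suc k) = (\<lambda>(y, x). x(k := y)) ` (UNIV \<times> ?P k)"
    unfolding lessThan_Suc by (rule PiE_insert_eq)
  moreover have "inj_on (\<lambda>(y, x). x(k := y)) (UNIV \<times> ?P k)"
    using inj_combinator[of k "{..<k}" "\<lambda>_. UNIV"] by simp
  ultimately have bij: "bij_betw (\<lambda>(y, x). x(k := y)) (UNIV \<times> ?P k) (?P (Suc k))"
    by (simp add: bij_betw_def)
  have "fact_sum w (Suc k) h = integral\<^sup>N (count_space (?P (Suc k))) F"
    by (simp add: fact_sum_def F_def)
  also have "\<dots> = (\<integral>\<^sup>+ p. F ((\<lambda>(y, x). x(k := y)) p) \<partial>count_space (UNIV \<times> ?P k))"
    by (rule nn_integral_bij_count_space[OF bij, symmetric])
  also have "\<dots> = (\<integral>\<^sup>+ p. F ((\<lambda>(y, x). x(k := y)) p) * indicator (UNIV \<times> ?P k) p \<partial>count_space UNIV)"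
    by (rule nn_integral_count_space_indicator) simp
  also have "\<dots> = (\<integral>\<^sup>+ p. (case p of (y, x) \<Rightarrow> F (x(k := y)) * indicator (?P k) x) \<partial>count_space UNIV)"
    by (rule nn_integral_cong) (simp add: case_prod_beta indicator_def mem_Times_iff)
  also have "\<dots> = (\<integral>\<^sup>+ y. \<integral>\<^sup>+ x. F (x(k := y)) * indicator (?P k) x \<partial>count_space UNIV \<partial>count_space UNIV)"
    by (subst nn_integral_fst_count_space[symmetric]) simp
  also have "\<dots> = csum w (\<lambda>y. fact_sum (del y w) k (\<lambda>x. h (x(k := y))))"
    unfolding csum_def
  proof (rule nn_integral_cong)
    fix y
    have "(\<integral>\<^sup>+ x. F (x(k := y)) * indicator (?P k) x \<partial>count_space UNIV) = (\<integral>\<^sup>+ x. F (x(k := y)) \<partial>count_space (?P k))"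
      by (rule nn_integral_count_space_indicator[symmetric]) simp
    also have "\<dots> = (\<integral>\<^sup>+ x. of_nat (w y) * (of_nat (fmult (del y w) k x) * h (x(k := y))) \<partial>count_space (?P k))"
      by (simp only: F_def fmult_Suc of_nat_mult mult.assoc)
    also have "\<dots> = of_nat (w y) * fact_sum (del y w) k (\<lambda>x. h (x(k := y)))"
      unfolding fact_sum_def by (rule nn_integral_cmult) simp
    finally show "(\<integral>\<^sup>+ x. F (x(k := y)) * indicator (?P k) x \<partial>count_space UNIV) = of_nat (w y) * fact_sum (del y w) k (\<lambda>x. h (x(k := y)))" .
  qed
  finally show ?thesis .
qed

lemma fact_sum_cong:
  assumes "\<And>x. in_fact w k x \<Longrightarrow> h x = h' x" shows "fact_sum w k h = fact_sum w k h'"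
  unfolding fact_sum_def
proof (rule nn_integral_cong)
  fix x assume "x \<in> space (count_space (PiE {..<k} (\<lambda>_. UNIV :: 'a set)))"
  then have "fmult w k x = 0 \<or> h x = h' x" using assms[of x] unfolding in_fact_def by (cases "fmult w k x = 0") auto
  then show "of_nat (fmult w k x) * h x = of_nat (fmult w k x) * h' x" by auto
qed

lemma fact_sum_cmult: "fact_sum w k (\<lambda>x. c * h x) = c * fact_sum w k h"
  unfolding fact_sum_def by (simp add: nn_integral_cmult mult.left_commute[of _ c])

lemma fact_sum_add: "fact_sum w k (\<lambda>x. h x + h' x) = fact_sum w k h + fact_sum w k h'"
  unfolding fact_sum_def by (simp add: distrib_left nn_integral_add)

context relcompact_partition begin

text \<open>The entries already chosen are kept in an infinite sequence \<open>u\<close>, so that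
  the parameter space stays the same throughout the induction. The configuration may depend on them
  through deletions, but only on entries with index at least \<open>k\<close>; this is what permits
  the entry \<open>k\<close> to be overwritten by the summation variable.\<close>

lemma borel_measurable_fact_sum_aux:
  fixes N :: "'p measure"
  assumes "(\<lambda>(p, u). H p u) \<in> borel_measurable (N \<Otimes>\<^sub>M PiM UNIV (\<lambda>_. borel))"
    and "(\<lambda>(p, u). L p u) \<in> (N \<Otimes>\<^sub>M PiM UNIV (\<lambda>_::nat. borel :: 'x measure)) \<rightarrow>\<^sub>M NX"
    and "\<And>p u u'. (\<And>i. i \<ge> k \<Longrightarrow> u i = u' i) \<Longrightarrow> L p u = L p u'"
  shows "(\<lambda>(p, u). fact_sum (L p u) k (\<lambda>x. H p (\<lambda>i. if i < k then x i else u i)))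
    \<in> borel_measurable (N \<Otimes>\<^sub>M PiM UNIV (\<lambda>_. borel))"
  using assms(2,3)
proof (induction k arbitrary: L)
  case 0
  show ?case using assms(1) by (simp add: fact_sum_0)
next
  case (Suc k)
  let ?NU = "N \<Otimes>\<^sub>M PiM UNIV (\<lambda>_::nat. borel :: 'x measure)"
  let ?L = "\<lambda>p u. del (u k) (L p u)"
  have L[measurable]: "(\<lambda>(p, u). L p u) \<in> ?NU \<rightarrow>\<^sub>M NX" by fact
  have L': "(\<lambda>(p, u). ?L p u) \<in> ?NU \<rightarrow>\<^sub>M NX"
    unfolding case_prod_unfold using L by (intro measurable_del) (auto simp: case_prod_beta)
  have "?L p u = ?L p u'" if "\<And>i. i \<ge> k \<Longrightarrow> u i = u' i" for p u u'
    using that Suc.prems(2)[of u u' p] by auto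
  from Suc.IH[OF L' this]
  have IH[measurable]: "(\<lambda>(p, u). fact_sum (?L p u) k (\<lambda>x. H p (\<lambda>i. if i < k then x i else u i))) \<in> borel_measurable ?NU" by simp
  have "(\<lambda>((p, u), y). (p, u(k := y))) \<in> ?NU \<Otimes>\<^sub>M borel \<rightarrow>\<^sub>M ?NU"
    unfolding case_prod_unfold
    by (intro measurable_Pair measurable_fun_upd[where J = UNIV]) auto
  from measurable_compose[OF this IH]
  have "(\<lambda>((p, u), y). fact_sum (?L p (u(k := y))) k (\<lambda>x. H p (\<lambda>i. if i < k then x i else (u(k := y)) i))) \<in> borel_measurable (?NU \<Otimes>\<^sub>M borel)"
    by (simp add: case_prod_unfold cong: if_cong)
  then have "(\<lambda>pu. csum (case pu of (p, u) \<Rightarrow> L p u) ((\<lambda>(p, u) y. fact_sum (?L p (u(k := y))) k (\<lambda>x. H p (\<lambda>i. if i < k then x i else (u(k := y)) i))) pu)) \<in> borel_measurable ?NU"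
    by (intro borel_measurable_csum) (auto simp: case_prod_unfold)
  moreover have "fact_sum (L p u) (Suc k) (\<lambda>x. H p (\<lambda>i. if i < Suc k then x i else u i))
      = csum (L p u) (\<lambda>y. fact_sum (?L p (u(k := y))) k (\<lambda>x. H p (\<lambda>i. if i < k then x i else (u(k := y)) i)))" for p u
  proof -
    have "L p (u(k := y)) = L p u" for y by (rule Suc.prems(2)) auto
    moreover have "(\<lambda>i. if i < Suc k then (x(k := y)) i else u i) = (\<lambda>i. if i < k then x i else (u(k := y)) i)" for x y
      by (auto simp: fun_eq_iff)
    ultimately show ?thesis unfolding fact_sum_Suc by simp
  qed
  ultimately show ?case by (simp add: case_prod_unfold)
qed

lemma borel_measurable_fact_sum:
  fixes N :: "'p measure" and L :: "'p \<Rightarrow> 'x \<Rightarrow> nat"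
  assumes H[measurable]: "(\<lambda>(p, x). H p x) \<in> borel_measurable (N \<Otimes>\<^sub>M PiM {..<k} (\<lambda>_. borel))"
    and L[measurable]: "L \<in> N \<rightarrow>\<^sub>M NX"
  shows "(\<lambda>p. fact_sum (L p) k (H p)) \<in> borel_measurable N"
proof -
  let ?NU = "N \<Otimes>\<^sub>M PiM UNIV (\<lambda>_::nat. borel :: 'x measure)"
  have F: "(\<lambda>(p, u). fact_sum (L p) k (\<lambda>x. H p (restrict (\<lambda>i. if i < k then x i else u i) {..<k}))) \<in> borel_measurable ?NU"
  proof (rule borel_measurable_fact_sum_aux)
    have "(\<lambda>(p, u). (p, restrict u {..<k})) \<in> ?NU \<rightarrow>\<^sub>M N \<Otimes>\<^sub>M PiM {..<k} (\<lambda>_. borel)"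
      unfolding case_prod_unfold by (intro measurable_Pair measurable_restrict) auto
    from measurable_compose[OF this H]
    show "(\<lambda>(p, u). H p (restrict u {..<k})) \<in> borel_measurable ?NU" by (simp add: case_prod_unfold)
  qed (auto simp: case_prod_unfold)
  have "(\<lambda>p. (p, \<lambda>_. undefined)) \<in> N \<rightarrow>\<^sub>M ?NU"
    by (rule measurable_Pair) (auto simp: space_PiM)
  from measurable_compose[OF this F]
  have "(\<lambda>p. fact_sum (L p) k (\<lambda>x. H p (restrict (\<lambda>i. if i < k then x i else undefined) {..<k}))) \<in> borel_measurable N"
    by (simp add: case_prod_unfold cong: if_cong)
  moreover have "restrict (\<lambda>i. if i < k then x i else undefined) {..<k} = x" if "x \<in> PiE {..<k} (\<lambda>_. UNIV :: 'x set)" for x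
    using that by (auto simp: fun_eq_iff PiE_def extensional_def)
  then have "fact_sum (L p) k (\<lambda>x. H p (restrict (\<lambda>i. if i < k then x i else undefined) {..<k})) = fact_sum (L p) k (H p)" for p
    by (intro fact_sum_cong) (auto simp: in_fact_def)
  ultimately show ?thesis by simp
qed

lemma fact_sum_measurable_NX:
  fixes H :: "('x \<Rightarrow> nat) \<Rightarrow> (nat \<Rightarrow> 'x) \<Rightarrow> ennreal"
  assumes "(\<lambda>(w, x). H w x) \<in> borel_measurable (NX \<Otimes>\<^sub>M PiM {..<k} (\<lambda>_. borel))"
  shows "(\<lambda>w. fact_sum w k (H w)) \<in> borel_measurable NX"
  using borel_measurable_fact_sum[OF assms, of "\<lambda>w. w"] by simp

end

section \<open>Laws of Poisson processes\<close>

text \<open>Counts of relatively compact sets are natural numbers, so each event about the counts of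
  finitely many such sets is a countable disjoint union of cells over a disjoint refinement.
  Agreement of measures need only be checked on cells.\<close>

definition cell :: "'x::topological_space set set \<Rightarrow> ('x set \<Rightarrow> nat) \<Rightarrow> ('x \<Rightarrow> nat) set" where
  "cell \<D> n = {w. lf_count w \<and> (\<forall>D\<in>\<D>. cnt w D = of_nat (n D))}"

definition refines :: "'x::topological_space set set \<Rightarrow> 'x set set \<Rightarrow> bool" where
  "refines \<D> \<A> \<longleftrightarrow> finite \<D> \<and> disjoint \<D> \<and> (\<forall>D\<in>\<D>. relcompact D) \<and> (\<forall>A\<in>\<A>. \<exists>\<B>\<subseteq>\<D>. A = \<Union>\<B>)"

lemma refinesD:
  assumes "refines \<D> \<A>"
  shows "finite \<D>" "disjoint \<D>" "\<And>D. D \<in> \<D> \<Longrightarrow> relcompact D" "\<And>A. A \<in> \<A> \<Longrightarrow> \<exists>\<B>\<subseteq>\<D>. A = \<Union>\<B>"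
  using assms unfolding refines_def by blast+

text \<open>A new set \<open>A\<close> cuts every old piece in two and adds the part of
  \<open>A\<close> not yet covered. That no piece leaves the union is needed later, when each piece
  has to lie on one side of a given set.\<close>

lemma disjoint_refinement:
  assumes "finite \<A>" "\<And>A. A \<in> \<A> \<Longrightarrow> relcompact A"
  shows "\<exists>\<D>. refines \<D> \<A> \<and> \<Union>\<D> \<subseteq> \<Union>\<A>"
  using assms unfolding refines_def
proof (induction \<A> rule: finite_induct)
  case empty
  show ?case by (rule exI[of _ "{}"]) (auto simp: disjoint_def)
next
  case (insert A \<A>)
  then obtain \<D> where D: "finite \<D>" "disjoint \<D>" "\<And>D. D \<in> \<D> \<Longrightarrow> relcompact D"
    "\<And>A. A \<in> \<A> \<Longrightarrow> \<exists>\<B>\<subseteq>\<D>. A = \<Union>\<B>" "\<Union>\<D> \<subseteq> \<Union>\<A>" by auto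
  have A: "relcompact A" "A \<in> sets borel" using insert.prems relcompact_borel by auto
  let ?\<D> = "(\<lambda>D. D \<inter> A) ` \<D> \<union> (\<lambda>D. D - A) ` \<D> \<union> {A - \<Union>\<D>}"
  have UD: "\<Union>\<D> \<in> sets borel" using D(1,3) by (intro sets.finite_Union) (auto intro: relcompact_borel)
  have "finite ?\<D>" using D(1) by simp
  moreover have "disjoint ?\<D>"
  proof (rule disjointI)
    fix a b assume ab: "a \<in> ?\<D>" "b \<in> ?\<D>" "a \<noteq> b"
    have dj: "D = E \<or> D \<inter> E = {}" if "D \<in> \<D>" "E \<in> \<D>" for D E using disjointD[OF D(2)] that by blast
    show "a \<inter> b = {}" using ab
      by (elim UnE imageE singletonE) (use dj in \<open>blast+\<close>)
  qed
  moreover have "\<forall>D\<in>?\<D>. relcompact D"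
    using D(3) A UD by (auto intro: relcompact_Int relcompact_Diff)
  moreover have "\<forall>B\<in>insert A \<A>. \<exists>\<B>\<subseteq>?\<D>. B = \<Union>\<B>"
  proof
    fix B assume "B \<in> insert A \<A>"
    then consider "B = A" | "B \<in> \<A>" by blast
    then show "\<exists>\<B>\<subseteq>?\<D>. B = \<Union>\<B>"
    proof cases
      case 1
      then show ?thesis by (intro exI[of _ "(\<lambda>D. D \<inter> A) ` \<D> \<union> {A - \<Union>\<D>}"]) auto
    next
      case 2
      then obtain \<B> where "\<B> \<subseteq> \<D>" "B = \<Union>\<B>" using D(4) by blast
      then show ?thesis by (intro exI[of _ "(\<lambda>D. D \<inter> A) ` \<B> \<union> (\<lambda>D. D - A) ` \<B>"]) auto
    qed
  qed
  moreover have "\<Union>?\<D> \<subseteq> \<Union>(insert A \<A>)" using D(5) by auto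
  ultimately show ?case by (intro exI[of _ ?\<D>]) blast
qed

lemma sets_cell:
  assumes "finite \<D>" "\<And>D. D \<in> \<D> \<Longrightarrow> D \<in> sets borel"
  shows "cell \<D> n \<in> sets NX"
proof -
  have "cell \<D> n = {w \<in> space NX. \<forall>D\<in>\<D>. cnt w D = of_nat (n D)}" by (auto simp: cell_def space_NX)
  also have "\<dots> \<in> sets NX" using assms by (intro sets.sets_Collect_finite_All borel_measurable_eq) auto
  finally show ?thesis .
qed

lemma cnt_Union_disjoint:
  assumes "finite \<D>" "disjoint \<D>" "\<B> \<subseteq> \<D>"
  shows "cnt w (\<Union>\<B>) = (\<Sum>D\<in>\<B>. cnt w D)"
  using cnt_UN_finite[of \<B> "\<lambda>D. D" w] assms finite_subset[of \<B> \<D>]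
  by (auto simp: disjoint_family_on_def disjoint_def subset_eq)

context relcompact_partition begin

text \<open>Events on the counts of finitely many relatively compact sets form an
  intersection-stable generator, because the count of a Borel set is the sum of its counts on the
  pieces \<open>X n\<close>. The premise lets the refinement be chosen to suit the measures at
  hand.\<close>

lemma NX_measure_eqI:
  fixes \<mu> \<nu> :: "('x \<Rightarrow> nat) measure"
  assumes sets: "sets \<mu> = sets NX" "sets \<nu> = sets NX" and fin: "emeasure \<mu> (space NX) \<noteq> \<infinity>"
    and cells: "\<And>\<A>. finite \<A> \<Longrightarrow> (\<And>A. A \<in> \<A> \<Longrightarrow> relcompact A) \<Longrightarrow>
      \<exists>\<D>. refines \<D> \<A> \<and> (\<forall>n. emeasure \<mu> (cell \<D> n) = emeasure \<nu> (cell \<D> n))"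
  shows "\<mu> = \<nu>"
proof -
  define ev where "ev \<A> C = {w :: 'x \<Rightarrow> nat. lf_count w \<and> (\<forall>A\<in>\<A>. cnt w A \<in> C A)}" for \<A> and C :: "'x set \<Rightarrow> ennreal set"
  define G where "G = {ev \<A> C | \<A> C. finite \<A> \<and> (\<forall>A\<in>\<A>. relcompact A) \<and> (\<forall>A. C A \<in> sets borel)}"
  let ?\<Omega> = "{w :: 'x \<Rightarrow> nat. lf_count w}"
  have G: "G \<subseteq> Pow ?\<Omega>" by (auto simp: G_def ev_def)
  have ev_empty: "?\<Omega> = ev {} (\<lambda>_. UNIV)" by (simp add: ev_def)
  have G_I: "ev \<A> C \<in> G" if "finite \<A>" "\<forall>A\<in>\<A>. relcompact A" "\<forall>A. C A \<in> sets borel" for \<A> C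
    unfolding G_def using that by blast
  have \<Omega>: "?\<Omega> \<in> G" unfolding ev_empty by (rule G_I) auto
  have GNX: "G \<subseteq> sets NX"
  proof
    fix Y assume "Y \<in> G"
    then obtain \<A> C where Y: "Y = ev \<A> C" "finite \<A>" "\<And>A. A \<in> \<A> \<Longrightarrow> relcompact A" "\<And>A. C A \<in> sets borel"
      unfolding G_def by blast
    have "Y = {w \<in> space NX. \<forall>A\<in>\<A>. cnt w A \<in> C A}" by (auto simp: Y ev_def space_NX)
    also have "\<dots> \<in> sets NX"
    proof (rule sets.sets_Collect_finite_All[OF _ Y(2)])
      fix A assume "A \<in> \<A>"
      then have "(\<lambda>w. cnt w A) -` C A \<inter> space NX \<in> sets NX"
        using Y(3,4) by (intro measurable_sets[OF measurable_cnt]) (auto intro: relcompact_borel)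
      then show "{w \<in> space NX. cnt w A \<in> C A} \<in> sets NX" by (simp add: vimage_def Int_def conj_commute)
    qed
    finally show "Y \<in> sets NX" .
  qed
  have sN: "sets NX = sigma_sets ?\<Omega> G"
  proof
    show "sigma_sets ?\<Omega> G \<subseteq> sets NX"
      using sets.sigma_sets_subset[OF GNX] by (simp add: space_NX)
    have "(\<lambda>w. w) \<in> sigma ?\<Omega> G \<rightarrow>\<^sub>M NX"
    proof (rule measurable_NX)
      fix A :: "'x set" assume A: "A \<in> sets borel"
      have m: "(\<lambda>w. cnt w (X n \<inter> A)) \<in> borel_measurable (sigma ?\<Omega> G)" for n
      proof (rule measurableI)
        fix B :: "ennreal set" assume B: "B \<in> sets borel"
        have "relcompact (X n \<inter> A)" using relcompact_Int[OF relcompact_X A] .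
        then have "ev {X n \<inter> A} (\<lambda>_. B) \<in> G" using B by (intro G_I) auto
        moreover have "(\<lambda>w. cnt w (X n \<inter> A)) -` B \<inter> space (sigma ?\<Omega> G) = ev {X n \<inter> A} (\<lambda>_. B)"
          using G by (auto simp: ev_def space_measure_of)
        ultimately show "(\<lambda>w. cnt w (X n \<inter> A)) -` B \<inter> space (sigma ?\<Omega> G) \<in> sets (sigma ?\<Omega> G)"
          using G by (simp add: sets_measure_of sigma_sets.Basic)
      qed simp
      have "cnt w A = (\<Sum>n. cnt w (X n \<inter> A))" for w
        unfolding cnt_eq_csum
        by (subst csum_suminf_X) (auto simp: indicator_def intro!: suminf_cong arg_cong[where f = "csum w"])
      then show "(\<lambda>w. cnt w A) \<in> borel_measurable (sigma ?\<Omega> G)"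
        using m by simp
    qed (use G in \<open>auto simp: space_measure_of\<close>)
    then show "sets NX \<subseteq> sigma_sets ?\<Omega> G"
      using G by (auto dest!: measurable_sets simp: space_measure_of sets_measure_of)
        (metis (no_types, lifting) Int_absorb2 sets.sets_into_space space_NX)
  qed
  show ?thesis
  proof (rule measure_eqI_generator_eq[where A = "\<lambda>_. ?\<Omega>"])
    show "Int_stable G"
    proof (rule Int_stableI)
      fix a b assume "a \<in> G" "b \<in> G"
      then obtain \<A> C \<A>' C' where ab: "a = ev \<A> C" "finite \<A>" "\<forall>A\<in>\<A>. relcompact A" "\<forall>A. C A \<in> sets borel"
        "b = ev \<A>' C'" "finite \<A>'" "\<forall>A\<in>\<A>'. relcompact A" "\<forall>A. C' A \<in> sets borel" unfolding G_def by blast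
      let ?C = "\<lambda>A. (if A \<in> \<A> then C A else UNIV) \<inter> (if A \<in> \<A>' then C' A else UNIV)"
      have "a \<inter> b = ev (\<A> \<union> \<A>') ?C" unfolding ab ev_def by auto
      moreover have "ev (\<A> \<union> \<A>') ?C \<in> G" using ab by (intro G_I) auto
      ultimately show "a \<inter> b \<in> G" by (simp only:)
    qed
    show "G \<subseteq> Pow ?\<Omega>" by fact
    show "sets \<mu> = sigma_sets ?\<Omega> G" "sets \<nu> = sigma_sets ?\<Omega> G" unfolding sets sN by simp_all
    show "range (\<lambda>_::nat. ?\<Omega>) \<subseteq> G" "(\<Union>i::nat. ?\<Omega>) = ?\<Omega>" using \<Omega> by auto
    show "emeasure \<mu> ?\<Omega> \<noteq> \<infinity>" using fin by (simp add: space_NX)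
    fix Y assume "Y \<in> G"
    then obtain \<A> C where Y: "Y = ev \<A> C" "finite \<A>" "\<And>A. A \<in> \<A> \<Longrightarrow> relcompact A" "\<And>A. C A \<in> sets borel"
      unfolding G_def by blast
    obtain \<D> where *: "refines \<D> \<A> \<and> (\<forall>n. emeasure \<mu> (cell \<D> n) = emeasure \<nu> (cell \<D> n))"
      using cells[OF Y(2,3)] ..
    note D = refinesD[OF *[THEN conjunct1]] and eq = spec[OF *[THEN conjunct2]]
    have "\<exists>\<B>. \<forall>A\<in>\<A>. \<B> A \<subseteq> \<D> \<and> A = \<Union>(\<B> A)" by (intro bchoice ballI D(4))
    then obtain \<B> where B0: "\<forall>A\<in>\<A>. \<B> A \<subseteq> \<D> \<and> A = \<Union>(\<B> A)" ..
    note B = bspec[OF B0, THEN conjunct1] bspec[OF B0, THEN conjunct2]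
    \<comment> \<open>Extensionality makes two different count vectors differ on some member of
      \<open>\<D>\<close>, so their cells are disjoint; finiteness of \<open>\<D>\<close> makes the
      index set countable.\<close>
    define I where "I = {n \<in> PiE \<D> (\<lambda>_. UNIV :: nat set). \<forall>A\<in>\<A>. of_nat (\<Sum>D\<in>\<B> A. n D) \<in> C A}"
    have I: "countable I" unfolding I_def
      by (rule countable_subset[OF _ countable_PiE[OF D(1)]]) auto
    have cntA: "cnt w A = of_nat (\<Sum>D\<in>\<B> A. n D)" if "A \<in> \<A>" "w \<in> cell \<D> n" for A w n
    proof -
      have "cnt w (\<Union>(\<B> A)) = (\<Sum>D\<in>\<B> A. cnt w D)" by (rule cnt_Union_disjoint[OF D(1,2) B(1)[OF that(1)]])
      also have "\<dots> = (\<Sum>D\<in>\<B> A. of_nat (n D))" using B(1)[OF that(1)] that(2) by (auto simp: cell_def intro!: sum.cong)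
      finally show ?thesis using B(2)[OF that(1)] by (simp add: of_nat_sum)
    qed
    have YI: "Y = \<Union>(cell \<D> ` I)"
    proof (intro set_eqI iffI)
      fix w assume w: "w \<in> Y"
      then have lf: "lf_count w" by (simp add: Y ev_def)
      have "\<forall>D\<in>\<D>. \<exists>n::nat. cnt w D = of_nat n" using cnt_relcompact_nat[OF lf D(3)] by blast
      then obtain n where n: "\<And>D. D \<in> \<D> \<Longrightarrow> cnt w D = of_nat (n D)" by metis
      then have c: "w \<in> cell \<D> (restrict n \<D>)" using lf by (simp add: cell_def)
      have "restrict n \<D> \<in> I" unfolding I_def using cntA[OF _ c] w by (auto simp: Y ev_def)
      with c show "w \<in> \<Union>(cell \<D> ` I)" by blast
    next
      fix w assume "w \<in> \<Union>(cell \<D> ` I)"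
      then obtain n where n: "n \<in> I" "w \<in> cell \<D> n" by blast
      then show "w \<in> Y" using cntA[OF _ n(2)] by (auto simp: Y(1) ev_def I_def cell_def)
    qed
    have dj: "disjoint_family_on (cell \<D>) I"
    unfolding disjoint_family_on_def
    proof (intro ballI impI)
      fix m n assume mn: "m \<in> I" "n \<in> I" "m \<noteq> n"
      then obtain D where "D \<in> \<D>" "m D \<noteq> n D" unfolding I_def by (metis (mono_tags, lifting) PiE_ext mem_Collect_eq)
      then show "cell \<D> m \<inter> cell \<D> n = {}" by (auto simp: cell_def)
    qed
    have "cell \<D> n \<in> sets NX" for n using sets_cell[OF D(1)] D(3) relcompact_borel by blast
    then show "emeasure \<mu> Y = emeasure \<nu> Y"
      unfolding YI using sets I dj by (subst (1 2) emeasure_UN_countable) (auto simp: eq)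
  qed
qed

end

section \<open>Poisson weights, mixtures of configurations and the law of a Poisson process\<close>

definition pois :: "real \<Rightarrow> nat \<Rightarrow> real" where "pois r n = r ^ n / fact n * exp (- r)"

lemma pois_Suc: "r * pois r n = real (Suc n) * pois r (Suc n)"
  by (simp add: pois_def del: of_nat_Suc)

definition mix :: "'x set \<Rightarrow> ('x \<Rightarrow> nat) \<Rightarrow> ('x \<Rightarrow> nat) \<Rightarrow> 'x \<Rightarrow> nat" where
  "mix S w w' = (\<lambda>y. if y \<in> S then w y else w' y)"

lemma cnt_mix: "cnt (mix S w w') A = cnt w (A \<inter> S) + cnt w' (A - S)"
  unfolding cnt_eq_csum csum_def
  by (subst nn_integral_add[symmetric]) (auto intro!: nn_integral_cong simp: mix_def indicator_def)

lemma cnt_mix_subset: "D \<subseteq> S \<Longrightarrow> cnt (mix S w w') D = cnt w D"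
  and cnt_mix_disjoint: "D \<inter> S = {} \<Longrightarrow> cnt (mix S w w') D = cnt w' D"
  unfolding cnt_def by (auto intro!: nn_integral_cong simp: mix_def indicator_def)

lemma lf_count_mix: 
  fixes w :: "'x::topological_space \<Rightarrow> nat"
  assumes "lf_count w" "lf_count w'" shows "lf_count (mix S w w')"
  unfolding lf_count_def
proof (intro allI impI)
  fix C :: "'x set" assume "compact C"
  then have "finite ({x \<in> C. w x \<noteq> 0} \<union> {x \<in> C. w' x \<noteq> 0})" using assms by (simp add: lf_count_def)
  then show "finite {x \<in> C. mix S w w' x \<noteq> 0}"
    by (rule finite_subset[rotated]) (auto simp: mix_def)
qed

lemma measurable_mix:
  fixes S :: "'x::topological_space set"
  assumes [measurable]: "S \<in> sets borel" "L \<in> N \<rightarrow>\<^sub>M NX" "L' \<in> N \<rightarrow>\<^sub>M NX"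
  shows "(\<lambda>p. mix S (L p) (L' p)) \<in> N \<rightarrow>\<^sub>M NX"
proof (rule measurable_NX)
  fix A :: "'x set" assume [measurable]: "A \<in> sets borel"
  show "(\<lambda>p. cnt (mix S (L p) (L' p)) A) \<in> borel_measurable N"
    unfolding cnt_mix by measurable
next
  fix p assume "p \<in> space N"
  then show "lf_count (mix S (L p) (L' p))"
    using assms(2,3) by (intro lf_count_mix) (auto intro: lf_count_measurable)
qed

lemma lf_count_add_pts: "lf_count w \<Longrightarrow> lf_count (add_pts w k x)"
  and add_pts_Suc: "add_pts w (Suc k) x = ins (x k) (add_pts w k x)"
  and add_pts_0: "add_pts w 0 x = w"
proof -
  show s: "add_pts w (Suc k) x = ins (x k) (add_pts w k x)" for w :: "'c \<Rightarrow> nat" and k x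
  proof
    fix y
    have "{i. i < Suc k \<and> x i = y} = {i. i < k \<and> x i = y} \<union> (if x k = y then {k} else {})" by (auto simp: less_Suc_eq)
    then show "add_pts w (Suc k) x y = ins (x k) (add_pts w k x) y"
      by (auto simp: add_pts_def ins_def card_insert_disjoint)
  qed
  show z: "add_pts w 0 x = w" for w :: "'c \<Rightarrow> nat" and x by (simp add: add_pts_def)
  show "lf_count w \<Longrightarrow> lf_count (add_pts w k x)" for w :: "'d::topological_space \<Rightarrow> nat" and k x
    by (induction k) (simp_all add: s z lf_count_ins)
qed

lemma add_pts_cong: "(\<And>i. i < k \<Longrightarrow> x i = x' i) \<Longrightarrow> add_pts w k x = add_pts w k x'"
  unfolding add_pts_def by (auto intro!: ext arg_cong[where f = card])

lemma add_pts_commute: "add_pts (add_pts w k x) j z = add_pts (add_pts w j z) k x"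
  by (auto simp: add_pts_def)

lemma measurable_add_pts:
  fixes L :: "'p \<Rightarrow> 'x::topological_space \<Rightarrow> nat"
  assumes "L \<in> N \<rightarrow>\<^sub>M NX" "\<And>i. i < k \<Longrightarrow> (\<lambda>p. x p i) \<in> borel_measurable N"
  shows "(\<lambda>p. add_pts (L p) k (x p)) \<in> N \<rightarrow>\<^sub>M NX"
  using assms by (induction k) (auto simp: add_pts_0 add_pts_Suc intro!: measurable_ins)

text \<open>Everything is done for the law \<open>P\<close> on configurations instead of the process
  on its probability space, so that an independent copy is available as the second factor of
  \<open>P \<Otimes>\<^sub>M P\<close>.\<close>

locale poisson_law = relcompact_partition X + prob_space P
  for X :: "nat \<Rightarrow> 'x::{second_countable_topology, t2_space} set" and P :: "('x \<Rightarrow> nat) measure" +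
  fixes K :: "'x measure"
  assumes sets_P[measurable_cong, simp]: "sets P = sets NX"
    and sets_K[measurable_cong, simp]: "sets K = sets borel"
    and K_finite: "relcompact A \<Longrightarrow> emeasure K A \<noteq> \<infinity>"
    and prob_cell: "finite \<D> \<Longrightarrow> disjoint \<D> \<Longrightarrow> (\<And>D. D \<in> \<D> \<Longrightarrow> relcompact D) \<Longrightarrow>
      prob (cell \<D> n) = (\<Prod>D\<in>\<D>. pois (measure K D) (n D))"
begin

lemma space_P[simp]: "space P = {w. lf_count w}"
  using sets_eq_imp_space_eq[OF sets_P] by (simp add: space_NX)

lemma space_K[simp]: "space K = UNIV"
  using sets_eq_imp_space_eq[OF sets_K] by simp

sublocale K: sigma_finite_measure K
proof
  show "\<exists>A. countable A \<and> A \<subseteq> sets K \<and> \<Union>A = space K \<and> (\<forall>a\<in>A. emeasure K a \<noteq> \<infinity>)"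
    using UN_X K_finite[OF relcompact_X] by (intro exI[of _ "range X"]) auto
qed

sublocale Kk: product_sigma_finite "\<lambda>_::nat. K"
  by unfold_locales

sublocale KP: pair_sigma_finite K P
  by unfold_locales

sublocale PP: pair_prob_space P P
  by unfold_locales

text \<open>Both sides are finite measures in \<open>B\<close>, so cells of a refinement containing
  \<open>A\<close> as a union suffice. A point added in a piece \<open>D\<close> raises its count by
  one, and \<open>r * pois r m = (m + 1) * pois r (m + 1)\<close> exchanges the intensity of
  \<open>D\<close> for the count \<open>n D\<close>; the sum over the pieces of \<open>A\<close> is
  then the count of \<open>A\<close>.\<close>

lemma mecke_rectangle:
  assumes A: "relcompact A" and B: "B \<in> sets NX"
  shows "(\<integral>\<^sup>+ w. cnt w A * indicator B w \<partial>P) = (\<integral>\<^sup>+ y. \<integral>\<^sup>+ w. indicator A y * indicator B (ins y w) \<partial>P \<partial>K)"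
proof -
  note [measurable] = relcompact_borel[OF A]
  define \<mu> where "\<mu> = distr (density (K \<Otimes>\<^sub>M P) (\<lambda>(y, w). indicator A y)) NX (\<lambda>(y, w). ins y w)"
  define \<nu> where "\<nu> = density P (\<lambda>w. cnt w A)"
  have ins_m[measurable]: "(\<lambda>(y, w). ins y w) \<in> K \<Otimes>\<^sub>M P \<rightarrow>\<^sub>M NX" by (auto simp: case_prod_beta intro!: measurable_ins)
  have \<mu>: "emeasure \<mu> B = (\<integral>\<^sup>+ y. \<integral>\<^sup>+ w. indicator A y * indicator B (ins y w) \<partial>P \<partial>K)" if [measurable]: "B \<in> sets NX" for B
  proof -
    have "emeasure \<mu> B = (\<integral>\<^sup>+ p. indicator B p \<partial>\<mu>)" using that by (simp add: \<mu>_def)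
    also have "\<dots> = (\<integral>\<^sup>+ p. indicator A (fst p) * indicator B (ins (fst p) (snd p)) \<partial>(K \<Otimes>\<^sub>M P))"
      unfolding \<mu>_def using that by (subst nn_integral_distr, simp, simp, subst nn_integral_density) (auto simp: case_prod_beta)
    also have "\<dots> = (\<integral>\<^sup>+ y. \<integral>\<^sup>+ w. indicator A y * indicator B (ins y w) \<partial>P \<partial>K)"
      using that by (subst nn_integral_fst[symmetric]) (auto simp: case_prod_beta)
    finally show ?thesis .
  qed
  have \<nu>: "emeasure \<nu> B = (\<integral>\<^sup>+ w. cnt w A * indicator B w \<partial>P)" if [measurable]: "B \<in> sets NX" for B
    unfolding \<nu>_def by (subst emeasure_density) auto
  have "\<mu> = \<nu>"
  proof (rule NX_measure_eqI)
    show "sets \<mu> = sets NX" "sets \<nu> = sets NX" by (simp_all add: \<mu>_def \<nu>_def)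
    have "emeasure \<mu> (space NX) = (\<integral>\<^sup>+ y. indicator A y \<partial>K)"
      by (subst \<mu>, simp, intro nn_integral_cong, subst nn_integral_cong[where v = "\<lambda>_. indicator A _"])
         (auto simp: space_NX lf_count_ins emeasure_space_1[simplified])
    then show "emeasure \<mu> (space NX) \<noteq> \<infinity>" using K_finite[OF A] by simp
    fix \<A> :: "'x set set" assume A': "finite \<A>" "\<And>A. A \<in> \<A> \<Longrightarrow> relcompact A"
    obtain \<D> where R: "refines \<D> (insert A \<A>)"
      using disjoint_refinement[of "insert A \<A>"] A' A by (metis finite_insert insert_iff)
    note D = refinesD[OF R]
    obtain \<B> where B: "\<B> \<subseteq> \<D>" "A = \<Union>\<B>" using D(4) by blast
    have finB: "finite \<B>" using B(1) D(1) finite_subset by blast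
    have "emeasure \<mu> (cell \<D> n) = emeasure \<nu> (cell \<D> n)" for n
    proof -
      have c: "cell \<D> n \<in> sets NX" for n using sets_cell[OF D(1)] D(3) relcompact_borel by blast
      have disj: "E = D" if "D \<in> \<D>" "y \<in> D" "E \<in> \<D>" "y \<in> E" for D E y
        using disjointD[OF D(2)] that by blast
      \<comment> \<open>If \<open>n D = 0\<close>, no configuration with a point added in
        \<open>D\<close> lies in the cell; this case must be separated because
        \<open>n D - 1\<close> truncates.\<close>
      define q where "q D = (if n D = 0 then 0 else emeasure P (cell \<D> (n(D := n D - 1))))" for D
      have ins_cell: "ins y w \<in> cell \<D> n \<longleftrightarrow> n D \<noteq> 0 \<and> w \<in> cell \<D> (n(D := n D - 1))"
        if D': "D \<in> \<B>" "y \<in> D" and lf: "lf_count w" for D y w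
      proof -
        have DD: "D \<in> \<D>" using D' B(1) by blast
        have cntE: "cnt (ins y w) E = cnt w E + (if E = D then 1 else 0)" if "E \<in> \<D>" for E
        proof (cases "E = D")
          case True
          then show ?thesis using D'(2) by (simp add: cnt_eq_csum csum_ins)
        next
          case False
          then have "y \<notin> E" using disj[OF DD D'(2) that] by blast
          then show ?thesis using False by (simp add: cnt_eq_csum csum_ins)
        qed
        have E1: "cnt w D + 1 = of_nat (n D) \<longleftrightarrow> n D \<noteq> 0 \<and> cnt w D = of_nat (n D - 1)"
        proof -
          obtain m :: nat where m: "cnt w D = of_nat m" using cnt_relcompact_nat[OF lf D(3)[OF DD]] by blast
          have "(of_nat m + 1 :: ennreal) = of_nat (n D) \<longleftrightarrow> Suc m = n D"
            by (metis of_nat_Suc of_nat_eq_iff add.commute)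
          also have "\<dots> \<longleftrightarrow> n D \<noteq> 0 \<and> (of_nat m :: ennreal) = of_nat (n D - 1)" by auto
          finally show ?thesis unfolding m .
        qed
        have "ins y w \<in> cell \<D> n \<longleftrightarrow> (\<forall>E\<in>\<D>. cnt w E + (if E = D then 1 else 0) = of_nat (n E))"
          using lf lf_count_ins[OF lf] cntE by (simp add: cell_def)
        also have "\<dots> \<longleftrightarrow> cnt w D + 1 = of_nat (n D) \<and> (\<forall>E\<in>\<D>. E \<noteq> D \<longrightarrow> cnt w E = of_nat (n E))"
          using DD by auto
        also have "\<dots> \<longleftrightarrow> n D \<noteq> 0 \<and> w \<in> cell \<D> (n(D := n D - 1))"
          unfolding E1 using lf DD by (auto simp: cell_def)
        finally show ?thesis .
      qed
      have "(\<integral>\<^sup>+ w. indicator A y * indicator (cell \<D> n) (ins y w) \<partial>P) = (\<Sum>D\<in>\<B>. indicator D y * q D)" for y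
      proof (cases "y \<in> A")
        case False
        then show ?thesis using B(2) by (auto simp: indicator_def intro!: sum.neutral)
      next
        case True
        then obtain D where D': "D \<in> \<B>" "y \<in> D" using B(2) by blast
        have "(\<Sum>E\<in>\<B>. indicator E y * q E) = (\<Sum>E\<in>{D}. indicator E y * q E)"
        proof (rule sum.mono_neutral_right[OF finB])
          show "\<forall>E\<in>\<B> - {D}. indicator E y * q E = 0"
          proof
            fix E assume "E \<in> \<B> - {D}"
            then have "y \<notin> E" using disj[of D y E] D' B(1) by blast
            then show "indicator E y * q E = 0" by simp
          qed
        qed (use D' in simp)
        moreover have "(\<integral>\<^sup>+ w. indicator A y * indicator (cell \<D> n) (ins y w) \<partial>P)
           = (\<integral>\<^sup>+ w. (if n D = 0 then 0 else indicator (cell \<D> (n(D := n D - 1))) w) \<partial>P)"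
          using ins_cell[OF D'] True by (intro nn_integral_cong) (auto simp: indicator_def)
        moreover have "\<dots> = q D" using c by (simp add: q_def)
        ultimately show ?thesis using D' by simp
      qed
      then have "emeasure \<mu> (cell \<D> n) = (\<integral>\<^sup>+ y. (\<Sum>D\<in>\<B>. indicator D y * q D) \<partial>K)"
        by (simp add: \<mu>[OF c])
      also have "\<dots> = (\<Sum>D\<in>\<B>. emeasure K D * q D)"
      proof -
        have [measurable]: "D \<in> sets borel" if "D \<in> \<B>" for D using that D(3) B(1) relcompact_borel by blast
        then show ?thesis by (subst nn_integral_sum) (auto simp: nn_integral_multc intro!: sum.cong)
      qed
      also have "\<dots> = (\<Sum>D\<in>\<B>. of_nat (n D) * emeasure P (cell \<D> n))"
      proof (rule sum.cong[OF refl])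
        fix D assume "D \<in> \<B>"
        then have DD: "D \<in> \<D>" using B(1) by blast
        show "emeasure K D * q D = of_nat (n D) * emeasure P (cell \<D> n)"
        proof (cases "n D")
          case (Suc m)
          let ?r = "\<Prod>E\<in>\<D> - {D}. pois (measure K E) (n E)"
          have "prob (cell \<D> (n(D := m))) = pois (measure K D) m * ?r"
            using D DD by (subst prob_cell) (auto simp: prod.remove[of \<D> D] intro!: arg_cong2[where f = "(*)"] prod.cong)
          moreover have "prob (cell \<D> n) = pois (measure K D) (Suc m) * ?r"
            using D DD Suc by (subst prob_cell) (auto simp: prod.remove[of \<D> D])
          ultimately have "measure K D * prob (cell \<D> (n(D := m))) = real (Suc m) * prob (cell \<D> n)"
            using pois_Suc[of "measure K D" m] by (metis mult.assoc)
          then have "ennreal (measure K D) * ennreal (prob (cell \<D> (n(D := m)))) = ennreal (real (Suc m)) * ennreal (prob (cell \<D> n))"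
            by (simp only: ennreal_mult[symmetric] measure_nonneg of_nat_0_le_iff)
          moreover have "emeasure K D = ennreal (measure K D)"
            using K_finite[OF D(3)[OF DD]] by (simp add: emeasure_eq_ennreal_measure)
          ultimately show ?thesis by (simp add: q_def Suc emeasure_eq_measure ennreal_of_nat_eq_real_of_nat del: of_nat_Suc)
        qed (simp add: q_def)
      qed
      also have "\<dots> = (\<integral>\<^sup>+ w. of_nat (\<Sum>D\<in>\<B>. n D) * indicator (cell \<D> n) w \<partial>P)"
        using c by (subst nn_integral_cmult_indicator) (auto simp: sum_distrib_right of_nat_sum)
      also have "\<dots> = (\<integral>\<^sup>+ w. cnt w A * indicator (cell \<D> n) w \<partial>P)"
      proof (rule nn_integral_cong)
        fix w
        have "cnt w A = of_nat (\<Sum>D\<in>\<B>. n D)" if "w \<in> cell \<D> n"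
          using cnt_Union_disjoint[OF D(1,2) B(1), of w] that B by (auto simp: cell_def of_nat_sum intro!: sum.cong)
        then show "of_nat (\<Sum>D\<in>\<B>. n D) * indicator (cell \<D> n) w = cnt w A * indicator (cell \<D> n) w"
          by (simp add: indicator_def)
      qed
      also have "\<dots> = emeasure \<nu> (cell \<D> n)" by (simp add: \<nu>[OF c])
      finally show ?thesis .
    qed
    then show "\<exists>\<D>. refines \<D> \<A> \<and> (\<forall>n. emeasure \<mu> (cell \<D> n) = emeasure \<nu> (cell \<D> n))"
      using R by (intro exI[of _ \<D>]) (simp add: refines_def)
  qed
  then show ?thesis using \<mu>[OF B] \<nu>[OF B] by simp
qed

text \<open>With a refinement whose pieces lie inside or outside \<open>S\<close>, the preimage of a
  cell is a rectangle: the first copy decides the inner counts, the second the outer ones. Its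
  probability is the product of the same Poisson weights.\<close>

lemma distr_mix:
  assumes S[measurable]: "S \<in> sets borel"
  shows "distr (P \<Otimes>\<^sub>M P) NX (\<lambda>(w, w'). mix S w w') = P"
proof (rule NX_measure_eqI)
  let ?\<mu> = "distr (P \<Otimes>\<^sub>M P) NX (\<lambda>(w, w'). mix S w w')"
  have m[measurable]: "(\<lambda>(w, w'). mix S w w') \<in> P \<Otimes>\<^sub>M P \<rightarrow>\<^sub>M NX"
    unfolding case_prod_unfold by (intro measurable_mix) auto
  show "emeasure ?\<mu> (space NX) \<noteq> \<infinity>"
    by (simp add: emeasure_distr PP.P.emeasure_finite)
  fix \<A> :: "'x set set" assume A: "finite \<A>" "\<And>A. A \<in> \<A> \<Longrightarrow> relcompact A"
  let ?\<A> = "(\<lambda>A. A \<inter> S) ` \<A> \<union> (\<lambda>A. A - S) ` \<A>"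
  have A': "finite ?\<A>" "\<And>B. B \<in> ?\<A> \<Longrightarrow> relcompact B"
    using A by (auto intro!: relcompact_Int relcompact_Diff)
  obtain \<D> where *: "refines \<D> ?\<A> \<and> \<Union>\<D> \<subseteq> \<Union>?\<A>"
    using disjoint_refinement[OF A'] ..
  note D = refinesD[OF *[THEN conjunct1]]
  have cover: "\<exists>\<B>\<subseteq>\<D>. A = \<Union>\<B>" if "A \<in> \<A>" for A
  proof -
    have AS: "A \<inter> S \<in> ?\<A>" "A - S \<in> ?\<A>" using that by simp_all
    obtain \<B> where B: "\<B> \<subseteq> \<D> \<and> A \<inter> S = \<Union>\<B>" using D(4)[OF AS(1)] ..
    obtain \<B>' where B': "\<B>' \<subseteq> \<D> \<and> A - S = \<Union>\<B>'" using D(4)[OF AS(2)] ..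
    have "A = (A \<inter> S) \<union> (A - S)" by blast
    also have "\<dots> = \<Union>(\<B> \<union> \<B>')" using B B' by simp
    finally show ?thesis using B B' by (intro exI[of _ "\<B> \<union> \<B>'"]) simp
  qed
  show "\<exists>\<D>. refines \<D> \<A> \<and> (\<forall>n. emeasure ?\<mu> (cell \<D> n) = emeasure P (cell \<D> n))"
  proof (rule exI[of _ \<D>], intro conjI allI)
    show "refines \<D> \<A>" unfolding refines_def by (intro conjI ballI D cover)
    fix n
    define \<D>1 \<D>2 where "\<D>1 = {D \<in> \<D>. D \<subseteq> S}" and "\<D>2 = {D \<in> \<D>. \<not> D \<subseteq> S}"
    have DD: "\<D> = \<D>1 \<union> \<D>2" "\<D>1 \<inter> \<D>2 = {}" "finite \<D>1" "finite \<D>2" "disjoint \<D>1" "disjoint \<D>2"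
      using D(1,2) by (auto simp: \<D>1_def \<D>2_def disjoint_def)
    \<comment> \<open>A point of \<open>D\<close> outside \<open>S\<close> lies in a member of
      \<open>?\<A>\<close> of the form \<open>A - S\<close>. That member is a union of pieces, and
      by disjointness the piece through the point is \<open>D\<close> itself, so all of
      \<open>D\<close> avoids \<open>S\<close>.\<close>
    have D2: "D \<inter> S = {}" if "D \<in> \<D>2" for D
    proof -
      have DD: "D \<in> \<D>" "\<not> D \<subseteq> S" using that by (auto simp: \<D>2_def)
      then obtain y where y: "y \<in> D" "y \<notin> S" by blast
      have "y \<in> \<Union>?\<A>" using *[THEN conjunct2] UnionI[OF DD(1) y(1)] by (rule subsetD)
      then obtain B where B: "B \<in> ?\<A>" "y \<in> B" by (rule UnionE)
      then have "B \<inter> S = {}" using y(2) by auto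
      moreover obtain \<B> where \<B>0: "\<B> \<subseteq> \<D> \<and> B = \<Union>\<B>" using D(4)[OF B(1)] ..
      note \<B> = \<B>0[THEN conjunct1] \<B>0[THEN conjunct2]
      then obtain E where "E \<in> \<B>" "y \<in> E" using B(2) by auto
      then have "E = D" using disjointD[OF D(2)] DD(1) y(1) \<B>(1) by blast
      ultimately show ?thesis using \<open>E \<in> \<B>\<close> \<B>(2) by blast
    qed
    have c: "cell \<D> n \<in> sets NX" "cell \<D>1 n \<in> sets NX" "cell \<D>2 n \<in> sets NX"
      using D(3) DD by (auto intro!: sets_cell relcompact_borel)
    have pr: "prob (cell \<D> n) = prob (cell \<D>1 n) * prob (cell \<D>2 n)"
      using D(1,2) DD D(3) by (subst (1 2 3) prob_cell) (auto simp: prod.union_disjoint)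
    have "(\<lambda>(w, w'). mix S w w') -` cell \<D> n \<inter> space (P \<Otimes>\<^sub>M P) = cell \<D>1 n \<times> cell \<D>2 n"
    proof (intro set_eqI iffI)
      fix p assume p: "p \<in> (\<lambda>(w, w'). mix S w w') -` cell \<D> n \<inter> space (P \<Otimes>\<^sub>M P)"
      obtain w w' where p': "p = (w, w')" by (rule prod.exhaust)
      have w: "p = (w, w')" "lf_count w" "lf_count w'" "mix S w w' \<in> cell \<D> n"
        using p unfolding p' by (simp_all add: space_pair_measure)
      have "cnt w D = of_nat (n D)" if "D \<in> \<D>1" for D
      proof -
        have "D \<subseteq> S" "D \<in> \<D>" using that by (auto simp: \<D>1_def)
        then show ?thesis using w(4) cnt_mix_subset[of D S w w'] by (simp add: cell_def)
      qed
      moreover have "cnt w' D = of_nat (n D)" if "D \<in> \<D>2" for D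
      proof -
        have "D \<in> \<D>" using that by (simp add: \<D>2_def)
        then show ?thesis using w(4) cnt_mix_disjoint[OF D2[OF that], of w w'] by (simp add: cell_def)
      qed
      ultimately show "p \<in> cell \<D>1 n \<times> cell \<D>2 n" using w by (simp add: cell_def)
    next
      fix p assume "p \<in> cell \<D>1 n \<times> cell \<D>2 n"
      then obtain w w' where w: "p = (w, w')" "w \<in> cell \<D>1 n" "w' \<in> cell \<D>2 n" by auto
      have "cnt (mix S w w') D = of_nat (n D)" if "D \<in> \<D>" for D
      proof (cases "D \<in> \<D>1")
        case True
        then have "D \<subseteq> S" by (simp add: \<D>1_def)
        then show ?thesis using w(2) True by (simp add: cell_def cnt_mix_subset)
      next
        case False
        then have "D \<in> \<D>2" using that DD(1) by blast
        then show ?thesis using w(3) D2 by (simp add: cell_def cnt_mix_disjoint)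
      qed
      then show "p \<in> (\<lambda>(w, w'). mix S w w') -` cell \<D> n \<inter> space (P \<Otimes>\<^sub>M P)"
        using w by (auto simp: cell_def space_pair_measure lf_count_mix)
    qed
    then have "emeasure ?\<mu> (cell \<D> n) = emeasure (P \<Otimes>\<^sub>M P) (cell \<D>1 n \<times> cell \<D>2 n)"
      using c by (subst emeasure_distr) auto
    also have "\<dots> = emeasure P (cell \<D>1 n) * emeasure P (cell \<D>2 n)"
      using c by (intro emeasure_pair_measure_Times) auto
    also have "\<dots> = emeasure P (cell \<D> n)"
      by (simp add: emeasure_eq_measure pr ennreal_mult)
    finally show "emeasure ?\<mu> (cell \<D> n) = emeasure P (cell \<D> n)" .
  qed
qed simp_all

end

section \<open>The Mecke formula and resampling\<close>

lemma csum_suminf: "csum w (\<lambda>y. \<Sum>i. f i y) = (\<Sum>i. csum w (f i))"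
  unfolding csum_def by (subst nn_integral_suminf[symmetric]) (simp_all add: ennreal_suminf_cmult)

lemma csum_SUP: "incseq f \<Longrightarrow> csum w (\<lambda>y. SUP i. f i y) = (SUP i. csum w (f i))"
  unfolding csum_def
  by (subst nn_integral_monotone_convergence_SUP[symmetric])
     (auto simp: SUP_mult_left_ennreal incseq_def le_fun_def intro!: mult_left_mono)

lemma csum_mono: "(\<And>y. h y \<le> h' y) \<Longrightarrow> csum w h \<le> csum w h'"
  unfolding csum_def by (intro nn_integral_mono mult_left_mono) auto

context poisson_law begin

lemma borel_measurable_csum_P:
  assumes "u \<in> borel_measurable (NX \<Otimes>\<^sub>M borel)"
  shows "(\<lambda>w. csum w (\<lambda>y. u (w, y))) \<in> borel_measurable P"
proof -
  have "(\<lambda>w. csum ((\<lambda>w. w) w) ((\<lambda>w y. u (w, y)) w)) \<in> borel_measurable NX"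
    by (rule borel_measurable_csum) (use assms in simp_all)
  then show ?thesis by simp
qed

lemma measurable_ins_Pair: "(\<lambda>(y, w). (ins y w, y)) \<in> K \<Otimes>\<^sub>M P \<rightarrow>\<^sub>M NX \<Otimes>\<^sub>M borel"
  unfolding case_prod_unfold by (intro measurable_Pair measurable_ins) simp_all

text \<open>Both sides are measures in \<open>E\<close>, so the formula extends from rectangles to
  the whole product \<sigma>-field. The rectangles over the pieces \<open>X i\<close> have finite
  measure and exhaust the space.\<close>

lemma mecke_indicator:
  assumes "E \<in> sets (NX \<Otimes>\<^sub>M borel)"
  shows "(\<integral>\<^sup>+ w. csum w (\<lambda>y. indicator E (w, y)) \<partial>P)
    = emeasure (distr (K \<Otimes>\<^sub>M P) (NX \<Otimes>\<^sub>M borel) (\<lambda>(y, w). (ins y w, y))) E"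
proof -
  let ?Q = "NX \<Otimes>\<^sub>M borel :: (('x \<Rightarrow> nat) \<times> 'x) measure"
  define \<mu> where "\<mu> E = (\<integral>\<^sup>+ w. csum w (\<lambda>y. indicator E (w, y)) \<partial>P)" for E
  define M1 where "M1 = measure_of (space ?Q) (sets ?Q) \<mu>"
  define M2 where "M2 = distr (K \<Otimes>\<^sub>M P) ?Q (\<lambda>(y, w). (ins y w, y))"
  have sets_M1: "sets M1 = sets ?Q" and sets_M2: "sets M2 = sets ?Q" by (simp_all add: M1_def M2_def)
  have pos: "positive (sets ?Q) \<mu>" by (simp add: positive_def \<mu>_def csum_def)
  have ca: "countably_additive (sets ?Q) \<mu>"
  proof (rule countably_additiveI)
    fix A :: "nat \<Rightarrow> _" assume A: "range A \<subseteq> sets ?Q" "disjoint_family A"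
    have "(\<Sum>i. \<mu> (A i)) = (\<integral>\<^sup>+ w. (\<Sum>i. csum w (\<lambda>y. indicator (A i) (w, y))) \<partial>P)"
      unfolding \<mu>_def using A(1)
      by (subst nn_integral_suminf) (auto intro!: borel_measurable_csum_P)
    also have "\<dots> = \<mu> (\<Union>i. A i)"
      unfolding \<mu>_def csum_suminf[symmetric] by (simp only: suminf_indicator[OF A(2)])
    finally show "(\<Sum>i. \<mu> (A i)) = \<mu> (\<Union>i. A i)" .
  qed
  have em1: "emeasure M1 E = \<mu> E" if "E \<in> sets ?Q" for E
    unfolding M1_def using pos ca that by (intro emeasure_measure_of_sigma) (simp_all add: sets.sigma_algebra_axioms)
  have rect: "B \<times> A \<in> sets ?Q" if "B \<in> sets NX" "A \<in> sets borel" for A :: "'x set" and B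
    using that by simp
  have em2: "emeasure M2 (B \<times> A) = (\<integral>\<^sup>+ y. \<integral>\<^sup>+ w. indicator A y * indicator B (ins y w) \<partial>P \<partial>K)"
    if [measurable]: "B \<in> sets NX" "A \<in> sets borel" for A B
  proof -
    have "emeasure M2 (B \<times> A) = (\<integral>\<^sup>+ p. indicator (B \<times> A) p \<partial>M2)"
      using rect[OF that] by (simp add: sets_M2)
    also have "\<dots> = (\<integral>\<^sup>+ p. indicator (B \<times> A) ((\<lambda>(y, w). (ins y w, y)) p) \<partial>(K \<Otimes>\<^sub>M P))"
      unfolding M2_def by (rule nn_integral_distr[OF measurable_ins_Pair]) simp
    also have "\<dots> = (\<integral>\<^sup>+ p. (\<lambda>(y, w). indicator A y * indicator B (ins y w)) p \<partial>(K \<Otimes>\<^sub>M P))"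
      by (rule nn_integral_cong) (auto simp: indicator_def)
    also have "\<dots> = (\<integral>\<^sup>+ y. \<integral>\<^sup>+ w. (\<lambda>(y, w). indicator A y * indicator B (ins y w)) (y, w) \<partial>P \<partial>K)"
      by (rule nn_integral_fst[symmetric]) (simp add: case_prod_unfold)
    finally show ?thesis by simp
  qed
  have eq_rel: "emeasure M1 (B \<times> A) = emeasure M2 (B \<times> A)" if B: "B \<in> sets NX" and A: "relcompact A" for A B
  proof -
    note A' = relcompact_borel[OF A]
    have "csum w (\<lambda>y. indicator (B \<times> A) (w, y)) = cnt w A * indicator B w" for w
      unfolding cnt_eq_csum by (cases "w \<in> B") (simp_all add: indicator_times csum_def)
    then show ?thesis
      using mecke_rectangle[OF A B] by (simp add: em1[OF rect[OF B A']] em2[OF B A'] \<mu>_def)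
  qed
  have "M2 = M1"
  proof (rule measure_eqI_generator_eq[OF Int_stable_pair_measure_generator[of NX borel], where A = "\<lambda>n. space NX \<times> X n"])
    show "{a \<times> b |a b. a \<in> sets NX \<and> b \<in> sets borel} \<subseteq> Pow (space NX \<times> (UNIV :: 'x set))"
      using sets.sets_into_space by fast
    show "sets M2 = sigma_sets (space NX \<times> UNIV) {a \<times> b |a b. a \<in> sets NX \<and> b \<in> sets borel}"
      "sets M1 = sigma_sets (space NX \<times> UNIV) {a \<times> b |a b. a \<in> sets NX \<and> b \<in> sets borel}"
      unfolding sets_M1 sets_M2 by (simp_all add: sets_pair_measure)
    show "range (\<lambda>n. space NX \<times> X n) \<subseteq> {a \<times> b |a b. a \<in> sets NX \<and> b \<in> sets borel}"
      using X_borel by fast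
    show "(\<Union>i. space NX \<times> X i) = space NX \<times> UNIV"
      using UN_X by (auto simp: set_eq_iff)
    have "emeasure M2 (space NX \<times> X i) \<le> emeasure K (X i)" for i
    proof -
      have "emeasure M2 (space NX \<times> X i) = (\<integral>\<^sup>+ y. \<integral>\<^sup>+ w. indicator (X i) y * indicator (space NX) (ins y w) \<partial>P \<partial>K)"
        by (rule em2) simp_all
      also have "\<dots> \<le> (\<integral>\<^sup>+ y. \<integral>\<^sup>+ w. indicator (X i) y \<partial>P \<partial>K)"
        by (intro nn_integral_mono) (simp add: indicator_def)
      also have "\<dots> = emeasure K (X i)" by (simp add: emeasure_space_1[simplified])
      finally show ?thesis .
    qed
    then show "emeasure M2 (space NX \<times> X i) \<noteq> \<infinity>" for i
      using K_finite[OF relcompact_X[of i]] by (metis infinity_ennreal_def top.extremum_unique)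
    fix Y :: "(('x \<Rightarrow> nat) \<times> 'x) set" assume "Y \<in> {a \<times> b |a b. a \<in> sets NX \<and> b \<in> sets (borel :: 'x measure)}"
    then obtain B :: "('x \<Rightarrow> nat) set" and A :: "'x set" where Y: "Y = B \<times> A" "B \<in> sets NX" "A \<in> sets borel" by blast
    \<comment> \<open>The rectangle identity is known for relatively compact sides only, so a Borel
      side is cut along the partition.\<close>
    let ?A = "\<lambda>n. A \<inter> X n"
    have Yn: "Y = (\<Union>n. B \<times> ?A n)" using UN_X unfolding Y(1) by (auto simp: set_eq_iff)
    have dj: "disjoint_family (\<lambda>n. B \<times> ?A n)" using disjoint_X unfolding disjoint_family_on_def by fast
    have A: "relcompact (?A n)" for n using relcompact_Int[OF relcompact_X Y(3)] by (simp add: Int_commute)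
    have r: "range (\<lambda>n. B \<times> ?A n) \<subseteq> sets ?Q" using Y by (auto intro!: rect)
    have "(\<Sum>n. emeasure M2 (B \<times> ?A n)) = emeasure M2 Y" unfolding Yn using r dj by (intro suminf_emeasure) (simp_all add: sets_M2)
    moreover have "(\<Sum>n. emeasure M1 (B \<times> ?A n)) = emeasure M1 Y" unfolding Yn using r dj by (intro suminf_emeasure) (simp_all add: sets_M1)
    ultimately show "emeasure M2 Y = emeasure M1 Y" using eq_rel[OF Y(2) A] by simp
  qed
  then show ?thesis using em1[OF assms] by (simp add: \<mu>_def M2_def)
qed

lemma mecke_univariate:
  assumes "u \<in> borel_measurable (NX \<Otimes>\<^sub>M borel)"
  shows "(\<integral>\<^sup>+ w. csum w (\<lambda>y. u (w, y)) \<partial>P) = (\<integral>\<^sup>+ y. \<integral>\<^sup>+ w. u (ins y w, y) \<partial>P \<partial>K)"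
proof -
  let ?Q = "NX \<Otimes>\<^sub>M borel :: (('x \<Rightarrow> nat) \<times> 'x) measure"
  let ?M = "distr (K \<Otimes>\<^sub>M P) ?Q (\<lambda>(y, w). (ins y w, y))"
  have "(\<integral>\<^sup>+ w. csum w (\<lambda>y. u (w, y)) \<partial>P) = integral\<^sup>N ?M u"
    using assms
  proof (induction u rule: borel_measurable_induct)
    case (cong f g)
    have "(\<integral>\<^sup>+ w. csum w (\<lambda>y. f (w, y)) \<partial>P) = (\<integral>\<^sup>+ w. csum w (\<lambda>y. g (w, y)) \<partial>P)"
      using cong(3) by (intro nn_integral_cong csum_cong) (simp add: space_pair_measure space_NX)
    moreover have "integral\<^sup>N ?M f = integral\<^sup>N ?M g"
      using cong(3) by (intro nn_integral_cong) simp
    ultimately show ?case using cong.hyps cong by simp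
  next
    case (set A)
    then show ?case using mecke_indicator[OF set] by simp
  next
    case (mult u c)
    have "integral\<^sup>N ?M (\<lambda>p. c * u p) = c * integral\<^sup>N ?M u"
      using mult by (intro nn_integral_cmult) simp
    moreover have "(\<integral>\<^sup>+ w. csum w (\<lambda>y. c * u (w, y)) \<partial>P) = c * (\<integral>\<^sup>+ w. csum w (\<lambda>y. u (w, y)) \<partial>P)"
      unfolding csum_cmult using mult by (intro nn_integral_cmult borel_measurable_csum_P) simp
    ultimately show ?case using mult by simp
  next
    case (add u v)
    have "integral\<^sup>N ?M (\<lambda>p. v p + u p) = integral\<^sup>N ?M v + integral\<^sup>N ?M u"
      using add by (intro nn_integral_add) simp_all
    moreover have "(\<integral>\<^sup>+ w. csum w (\<lambda>y. v (w, y) + u (w, y)) \<partial>P)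
        = (\<integral>\<^sup>+ w. csum w (\<lambda>y. v (w, y)) \<partial>P) + (\<integral>\<^sup>+ w. csum w (\<lambda>y. u (w, y)) \<partial>P)"
      unfolding csum_add using add by (intro nn_integral_add borel_measurable_csum_P) simp_all
    ultimately show ?case using add by simp
  next
    case (seq U)
    have U: "(SUP i. U i) = (\<lambda>p. SUP i. U i p)" by (simp add: fun_eq_iff image_comp)
    have "integral\<^sup>N ?M (SUP i. U i) = (SUP i. integral\<^sup>N ?M (U i))"
      unfolding U by (rule nn_integral_monotone_convergence_SUP) (use seq(1,3) in simp_all)
    moreover have "(\<integral>\<^sup>+ w. csum w (\<lambda>y. (SUP i. U i) (w, y)) \<partial>P) = (SUP i. \<integral>\<^sup>+ w. csum w (\<lambda>y. U i (w, y)) \<partial>P)"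
    proof -
      have inc: "incseq (\<lambda>i y. U i (w, y))" for w
        using seq(3) by (simp add: incseq_def le_fun_def)
      have "csum w (\<lambda>y. (SUP i. U i) (w, y)) = (SUP i. csum w (\<lambda>y. U i (w, y)))" for w
        unfolding U using csum_SUP[OF inc] .
      moreover have "incseq (\<lambda>i w. csum w (\<lambda>y. U i (w, y)))"
        using seq(3) by (simp add: incseq_def le_fun_def csum_mono)
      then have "(\<integral>\<^sup>+ w. (SUP i. csum w (\<lambda>y. U i (w, y))) \<partial>P) = (SUP i. \<integral>\<^sup>+ w. csum w (\<lambda>y. U i (w, y)) \<partial>P)"
        by (rule nn_integral_monotone_convergence_SUP) (rule borel_measurable_csum_P[OF seq(1)])
      ultimately show ?thesis by simp
    qed
    ultimately show ?case by (simp only: seq(5))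
  qed
  also have "\<dots> = (\<integral>\<^sup>+ p. u ((\<lambda>(y, w). (ins y w, y)) p) \<partial>(K \<Otimes>\<^sub>M P))"
    by (rule nn_integral_distr[OF measurable_ins_Pair]) (simp add: assms)
  also have "\<dots> = (\<integral>\<^sup>+ y. \<integral>\<^sup>+ w. u ((\<lambda>(y, w). (ins y w, y)) (y, w)) \<partial>P \<partial>K)"
    by (rule nn_integral_fst[symmetric]) (rule measurable_compose[OF measurable_ins_Pair assms])
  finally show ?thesis by simp
qed

text \<open>Splitting off the last entry and using the formula for one point replaces
  \<open>w\<close> by \<open>ins y w\<close>. The deletion of \<open>y\<close> in the recursion then
  cancels, which leaves a shorter sum over \<open>w\<close> itself; the inserted point becomes part
  of the integrand to which the induction hypothesis applies.\<close>

theorem mecke: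
  assumes "(\<lambda>(w, x). H w x) \<in> borel_measurable (NX \<Otimes>\<^sub>M PiM {..<k} (\<lambda>_. borel))"
  shows "(\<integral>\<^sup>+ w. fact_sum w k (H w) \<partial>P)
    = (\<integral>\<^sup>+ x. \<integral>\<^sup>+ w. H (add_pts w k x) x \<partial>P \<partial>PiM {..<k} (\<lambda>_. K))"
  using assms
proof (induction k arbitrary: H)
  case 0
  show ?case by (simp add: fact_sum_0 add_pts_0 nn_integral_count_space_finite PiM_empty)
next
  case (Suc k)
  let ?Q = "NX \<Otimes>\<^sub>M borel :: (('x \<Rightarrow> nat) \<times> 'x) measure"
  have H[measurable]: "(\<lambda>(w, x). H w x) \<in> borel_measurable (NX \<Otimes>\<^sub>M PiM (insert k {..<k}) (\<lambda>_. borel))"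
    using Suc.prems by (simp add: lessThan_Suc)
  define u where "u p = fact_sum (del (snd p) (fst p)) k (\<lambda>x. H (ins (snd p) (del (snd p) (fst p))) (x(k := snd p)))" for p
  have upd[measurable]: "(\<lambda>p. (snd p)(k := snd (fst p))) \<in> ?Q \<Otimes>\<^sub>M PiM {..<k} (\<lambda>_. borel) \<rightarrow>\<^sub>M PiM (insert k {..<k}) (\<lambda>_. borel)"
    by (rule measurable_fun_upd[where J = "{..<k}"]) auto
  have del_m[measurable]: "(\<lambda>p. del (snd p) (fst p)) \<in> ?Q \<rightarrow>\<^sub>M NX"
    by (rule measurable_del) simp_all
  have u[measurable]: "u \<in> borel_measurable ?Q"
    unfolding u_def
  proof (rule borel_measurable_fact_sum[OF _ del_m])
    have "(\<lambda>p. (ins (snd (fst p)) (del (snd (fst p)) (fst (fst p))), (snd p)(k := snd (fst p))))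
      \<in> ?Q \<Otimes>\<^sub>M PiM {..<k} (\<lambda>_. borel) \<rightarrow>\<^sub>M NX \<Otimes>\<^sub>M PiM (insert k {..<k}) (\<lambda>_. borel)"
      by (intro measurable_Pair measurable_ins measurable_del upd) simp_all
    from measurable_compose[OF this H]
    show "(\<lambda>(p, x). H (ins (snd p) (del (snd p) (fst p))) (x(k := snd p))) \<in> borel_measurable (?Q \<Otimes>\<^sub>M PiM {..<k} (\<lambda>_. borel))"
      by (simp add: case_prod_unfold)
  qed
  have "(\<integral>\<^sup>+ w. fact_sum w (Suc k) (H w) \<partial>P) = (\<integral>\<^sup>+ w. csum w (\<lambda>y. u (w, y)) \<partial>P)"
    unfolding fact_sum_Suc u_def by (intro nn_integral_cong csum_cong) (simp add: ins_del)
  also have "\<dots> = (\<integral>\<^sup>+ y. \<integral>\<^sup>+ w. u (ins y w, y) \<partial>P \<partial>K)"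
    by (rule mecke_univariate[OF u])
  also have "\<dots> = (\<integral>\<^sup>+ y. \<integral>\<^sup>+ w. fact_sum w k (\<lambda>x. H (ins y w) (x(k := y))) \<partial>P \<partial>K)"
    by (simp add: u_def del_ins)
  also have "\<dots> = (\<integral>\<^sup>+ y. \<integral>\<^sup>+ x. \<integral>\<^sup>+ w. H (ins y (add_pts w k x)) (x(k := y)) \<partial>P \<partial>PiM {..<k} (\<lambda>_. K) \<partial>K)"
  proof (intro nn_integral_cong Suc.IH)
    fix y :: 'x
    have "(\<lambda>p. (ins y (fst p), (snd p)(k := y))) \<in> NX \<Otimes>\<^sub>M PiM {..<k} (\<lambda>_. borel) \<rightarrow>\<^sub>M NX \<Otimes>\<^sub>M PiM (insert k {..<k}) (\<lambda>_. borel)"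
      by (intro measurable_Pair measurable_ins measurable_fun_upd[where J = "{..<k}"]) auto
    from measurable_compose[OF this H]
    show "(\<lambda>(w, x). H (ins y w) (x(k := y))) \<in> borel_measurable (NX \<Otimes>\<^sub>M PiM {..<k} (\<lambda>_. borel))"
      by (simp add: case_prod_unfold)
  qed
  also have "\<dots> = (\<integral>\<^sup>+ y. \<integral>\<^sup>+ x. (\<integral>\<^sup>+ w. H (add_pts w (Suc k) (x(k := y))) (x(k := y)) \<partial>P) \<partial>PiM {..<k} (\<lambda>_. K) \<partial>K)"
  proof -
    have "add_pts w (Suc k) (x(k := y)) = ins y (add_pts w k x)" for w :: "'x \<Rightarrow> nat" and x y
      using add_pts_cong[of k "x(k := y)" x w] by (simp add: add_pts_Suc)
    then show ?thesis by simp
  qed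
  also have "\<dots> = (\<integral>\<^sup>+ x. \<integral>\<^sup>+ w. H (add_pts w (Suc k) x) x \<partial>P \<partial>PiM {..<Suc k} (\<lambda>_. K))"
    unfolding lessThan_Suc
  proof (subst Kk.product_nn_integral_insert_rev)
    let ?PK = "PiM (insert k {..<k}) (\<lambda>_. K)"
    have "(\<lambda>p. (add_pts (snd p) (Suc k) (fst p), fst p)) \<in> ?PK \<Otimes>\<^sub>M P \<rightarrow>\<^sub>M NX \<Otimes>\<^sub>M PiM (insert k {..<k}) (\<lambda>_. borel)"
    proof (intro measurable_Pair measurable_add_pts)
      show "fst \<in> ?PK \<Otimes>\<^sub>M P \<rightarrow>\<^sub>M PiM (insert k {..<k}) (\<lambda>_. borel)"
        by (subst measurable_cong_sets[OF refl sets_PiM_cong[OF refl, of _ _ "\<lambda>_. K"]]) simp_all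
      fix i assume i: "i < Suc k"
      have "(\<lambda>p. fst p i) \<in> ?PK \<Otimes>\<^sub>M P \<rightarrow>\<^sub>M K"
        using i by (intro measurable_compose[OF measurable_fst measurable_component_singleton]) auto
      then show "(\<lambda>p. fst p i) \<in> borel_measurable (?PK \<Otimes>\<^sub>M P)"
        unfolding measurable_cong_sets[OF refl sets_K] .
    qed simp
    from measurable_compose[OF this H]
    show "(\<lambda>x. \<integral>\<^sup>+ w. H (add_pts w (Suc k) x) x \<partial>P) \<in> borel_measurable ?PK"
      by (intro borel_measurable_nn_integral) (simp add: case_prod_unfold)
  qed simp_all
  finally show ?case .
qed

text \<open>Replacing the points inside \<^term>\<open>S\<close> by those of an independent copy decouples a functional of
  the configuration inside \<^term>\<open>S\<close> from any functional of the resampled configuration.\<close>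

lemma resample:
  assumes [measurable]: "S \<in> sets borel" "G \<in> borel_measurable NX" "\<Psi> \<in> borel_measurable NX"
    and G: "\<And>w w'. lf_count w \<Longrightarrow> lf_count w' \<Longrightarrow> G (mix S w w') = G w"
  shows "(\<integral>\<^sup>+ w. \<integral>\<^sup>+ w'. G w * \<Psi> (mix S w' w) \<partial>P \<partial>P) = (\<integral>\<^sup>+ w. G w \<partial>P) * (\<integral>\<^sup>+ w. \<Psi> w \<partial>P)"
proof -
  have mix_m[measurable]: "(\<lambda>p. mix S (f p) (g p)) \<in> N \<rightarrow>\<^sub>M NX" if "f \<in> N \<rightarrow>\<^sub>M NX" "g \<in> N \<rightarrow>\<^sub>M NX" for f g and N :: "'b measure"
    using that by (intro measurable_mix) simp_all
  have mix2: "(\<lambda>(w, w'). mix S w w') \<in> P \<Otimes>\<^sub>M P \<rightarrow>\<^sub>M NX"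
    unfolding case_prod_unfold by (intro measurable_mix) simp_all
  \<comment> \<open>This is the conditional expectation of the resampled functional given the
    original configuration. It no longer sees the points inside \<open>S\<close>.\<close>
  define J where "J w = (\<integral>\<^sup>+ w'. \<Psi> (mix S w' w) \<partial>P)" for w
  have psi_m: "(\<lambda>p. \<Psi> (mix S (snd p) (fst p))) \<in> borel_measurable (NX \<Otimes>\<^sub>M P)"
    by (rule measurable_compose[OF measurable_mix assms(3)]) simp_all
  have J[measurable]: "J \<in> borel_measurable NX"
    unfolding J_def using psi_m by (intro borel_measurable_nn_integral) (simp add: case_prod_unfold)
  have J_mix: "J (mix S w w') = J w'" for w w'
  proof -
    have "mix S w'' (mix S w w') = mix S w'' w'" for w'' by (auto simp: mix_def)
    then show ?thesis by (simp add: J_def)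
  qed
  have J_int: "(\<integral>\<^sup>+ w. J w \<partial>P) = (\<integral>\<^sup>+ w. \<Psi> w \<partial>P)"
  proof -
    have "(\<integral>\<^sup>+ w. \<Psi> w \<partial>P) = (\<integral>\<^sup>+ w. \<Psi> w \<partial>distr (P \<Otimes>\<^sub>M P) NX (\<lambda>(w, w'). mix S w w'))"
      by (simp add: distr_mix)
    also have "\<dots> = (\<integral>\<^sup>+ p. \<Psi> ((\<lambda>(w, w'). mix S w w') p) \<partial>(P \<Otimes>\<^sub>M P))"
      by (rule nn_integral_distr[OF mix2]) (simp add: assms(3))
    also have "\<dots> = (\<integral>\<^sup>+ w'. \<integral>\<^sup>+ w. \<Psi> ((\<lambda>(w, w'). mix S w w') (w, w')) \<partial>P \<partial>P)"
      by (rule PP.nn_integral_snd[symmetric]) (use measurable_compose[OF mix2 assms(3)] in \<open>simp add: case_prod_unfold\<close>)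
    finally show ?thesis by (simp add: J_def)
  qed
  have "(\<integral>\<^sup>+ w. \<integral>\<^sup>+ w'. G w * \<Psi> (mix S w' w) \<partial>P \<partial>P) = (\<integral>\<^sup>+ w. G w * J w \<partial>P)"
  proof (rule nn_integral_cong)
    fix w assume "w \<in> space P"
    then have "(\<lambda>w'. (w, w')) \<in> P \<rightarrow>\<^sub>M NX \<Otimes>\<^sub>M P" by (intro measurable_Pair1') (simp add: space_NX)
    from measurable_compose[OF this psi_m]
    show "(\<integral>\<^sup>+ w'. G w * \<Psi> (mix S w' w) \<partial>P) = G w * J w"
      unfolding J_def by (intro nn_integral_cmult) simp
  qed
  \<comment> \<open>By \<open>distr_mix\<close> the configuration is itself a mixture of two
    independent ones. The factor \<open>G\<close> sees only the first and \<open>J\<close> only the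
    second, so the integral factorises.\<close>
  also have "\<dots> = (\<integral>\<^sup>+ w. G w * J w \<partial>distr (P \<Otimes>\<^sub>M P) NX (\<lambda>(w, w'). mix S w w'))"
    by (simp add: distr_mix)
  also have "\<dots> = (\<integral>\<^sup>+ p. (\<lambda>w. G w * J w) ((\<lambda>(w, w'). mix S w w') p) \<partial>(P \<Otimes>\<^sub>M P))"
    by (rule nn_integral_distr[OF mix2]) measurable
  also have "\<dots> = (\<integral>\<^sup>+ p. G (fst p) * J (snd p) \<partial>(P \<Otimes>\<^sub>M P))"
    by (rule nn_integral_cong) (auto simp: space_pair_measure J_mix G)
  also have "\<dots> = (\<integral>\<^sup>+ w. \<integral>\<^sup>+ w'. G w * J w' \<partial>P \<partial>P)"
    by (subst nn_integral_fst[symmetric]) simp_all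
  also have "\<dots> = (\<integral>\<^sup>+ w. G w \<partial>P) * (\<integral>\<^sup>+ w. J w \<partial>P)"
    by (simp add: nn_integral_cmult nn_integral_multc)
  finally show ?thesis by (simp add: J_int)
qed

end

section \<open>From the defining properties of a Poisson process to its law\<close>

lemma poisson_process_law:
  fixes K :: "'x::{second_countable_topology, t2_space} measure"
  assumes X: "relcompact_partition X"
    and K_sets: "sets K = sets borel"
    and K_lf: "\<And>C. compact C \<Longrightarrow> emeasure K C < \<infinity>"
    and PP: "poisson_process M K \<eta>"
  shows "poisson_law X (distr M NX \<eta>) K"
proof -
  interpret X: relcompact_partition X by fact
  interpret M: prob_space M using PP by (simp add: poisson_process_def)
  have \<eta>: "\<eta> \<in> M \<rightarrow>\<^sub>M NX" using PP by (simp add: poisson_process_def)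
  have K_fin: "emeasure K A < \<infinity>" if A: "relcompact A" for A
  proof -
    obtain C where C: "compact C" "A \<subseteq> C" using A unfolding relcompact_def by blast
    then have "emeasure K A \<le> emeasure K C"
      using K_sets by (intro emeasure_mono) (auto intro: borel_compact)
    then show ?thesis using K_lf[OF C(1)] by (rule le_less_trans)
  qed
  interpret D: prob_space "distr M NX \<eta>" by (rule M.prob_space_distr[OF \<eta>])
  show ?thesis
  proof (unfold_locales)
    show "sets (distr M NX \<eta>) = sets NX" by simp
    show "sets K = sets borel" by fact
    show "emeasure K A \<noteq> \<infinity>" if "relcompact A" for A using K_fin[OF that] by simp
    fix \<D> :: "'x set set" and n assume D: "finite \<D>" "disjoint \<D>" "\<And>D. D \<in> \<D> \<Longrightarrow> relcompact D"
    note Db = relcompact_borel[OF D(3)]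
    let ?E = "\<lambda>D. {w \<in> space M. cnt (\<eta> w) D = of_nat (n D)}"
    have prob_E: "M.prob (?E D) = pois (measure K D) (n D)" if "D \<in> \<D>" for D
    proof -
      have "M.prob {w \<in> space M. cnt (\<eta> w) D = of_nat m} = enn2real (emeasure K D) ^ m / fact m * exp (- enn2real (emeasure K D))" for m :: nat
        using PP Db[OF that] K_fin[OF D(3)[OF that]] unfolding poisson_process_def by blast
      then show ?thesis by (simp add: pois_def measure_def)
    qed
    have "measure (distr M NX \<eta>) (cell \<D> n) = M.prob (\<eta> -` cell \<D> n \<inter> space M)"
      using D(1) Db by (intro measure_distr[OF \<eta>] sets_cell)
    also have "\<eta> -` cell \<D> n \<inter> space M = {w \<in> space M. \<forall>D\<in>\<D>. cnt (\<eta> w) D = of_nat (n D)}"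
      using lf_count_measurable[OF \<eta>] by (auto simp: cell_def)
    also have "M.prob \<dots> = (\<Prod>D\<in>\<D>. pois (measure K D) (n D))"
    \<comment> \<open>Independence yields products over nonempty families indexed by an initial
      segment of the naturals, hence the enumeration \<open>h\<close>. For an empty family the event
      is the whole space.\<close>
    proof (cases "\<D> = {}")
      case True
      then show ?thesis by (simp add: M.prob_space)
    next
      case False
      obtain h where h: "bij_betw h {0..<card \<D>} \<D>" using ex_bij_betw_nat_finite[OF D(1)] by blast
      have inj: "inj_on h {..<card \<D>}" and img: "h ` {..<card \<D>} = \<D>"
        using h by (auto simp: bij_betw_def lessThan_atLeast0)
      have hD: "h i \<in> \<D>" if "i < card \<D>" for i using img that by blast
      have "disjoint_family_on h {..<card \<D>}"
        unfolding disjoint_family_on_def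
      proof (intro ballI impI)
        fix i j assume ij: "i \<in> {..<card \<D>}" "j \<in> {..<card \<D>}" "i \<noteq> j"
        then have "h i \<noteq> h j" using inj by (simp add: inj_on_eq_iff)
        then show "h i \<inter> h j = {}" using disjointD[OF D(2)] hD ij by simp
      qed
      moreover have "\<forall>i<card \<D>. h i \<in> sets borel" using hD Db by blast
      ultimately have "M.indep_vars (\<lambda>_. borel) (\<lambda>i w. cnt (\<eta> w) (h i)) {..<card \<D>}"
        using PP unfolding poisson_process_def by blast
      then have ind: "M.indep_sets (\<lambda>i. {(\<lambda>w. cnt (\<eta> w) (h i)) -` A \<inter> space M | A. A \<in> sets borel}) {..<card \<D>}"
        by (simp add: M.indep_vars_def2)
      have ne: "{..<card \<D>} \<noteq> {}" using False D(1) by (simp add: lessThan_empty_iff)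
      have "M.prob (\<Inter>i\<in>{..<card \<D>}. ?E (h i)) = (\<Prod>i\<in>{..<card \<D>}. M.prob (?E (h i)))"
      proof (rule M.indep_setsD[OF ind subset_refl ne finite_lessThan], rule ballI)
        fix i
        have "?E (h i) = (\<lambda>w. cnt (\<eta> w) (h i)) -` {of_nat (n (h i))} \<inter> space M" by auto
        then show "?E (h i) \<in> {(\<lambda>w. cnt (\<eta> w) (h i)) -` A \<inter> space M | A. A \<in> sets borel}"
          by (intro CollectI exI[of _ "{of_nat (n (h i))}"] conjI) simp_all
      qed
      also have "(\<Inter>i\<in>{..<card \<D>}. ?E (h i)) = {w \<in> space M. \<forall>D\<in>h ` {..<card \<D>}. cnt (\<eta> w) D = of_nat (n D)}"
        using ne by auto
      also have "\<dots> = {w \<in> space M. \<forall>D\<in>\<D>. cnt (\<eta> w) D = of_nat (n D)}" by (simp only: img)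
      also have "(\<Prod>i\<in>{..<card \<D>}. M.prob (?E (h i))) = (\<Prod>D\<in>\<D>. M.prob (?E D))"
        using prod.reindex[OF inj, of "\<lambda>D. M.prob (?E D)"] by (simp add: img)
      finally show ?thesis using prob_E by simp
    qed
    finally show "measure (distr M NX \<eta>) (cell \<D> n) = (\<Prod>D\<in>\<D>. pois (measure K D) (n D))" .
  qed
qed

section \<open>Symmetric sums over factorial measures\<close>

definition tuple_mset :: "nat \<Rightarrow> (nat \<Rightarrow> 'x) \<Rightarrow> 'x multiset" where
  "tuple_mset k x = image_mset x (mset_set {..<k})"

lemma size_tuple_mset: "size (tuple_mset k x) = k"
  by (simp add: tuple_mset_def)

lemma tuple_mset_0: "tuple_mset 0 x = {#}"
  by (simp add: tuple_mset_def)

lemma tuple_mset_upd: "tuple_mset (Suc k) (x(k := y)) = add_mset y (tuple_mset k x)"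
proof -
  have "image_mset (x(k := y)) (mset_set {..<k}) = image_mset x (mset_set {..<k})"
    by (rule image_mset_cong) auto
  then show ?thesis by (simp add: tuple_mset_def lessThan_Suc)
qed

text \<open>Tuples with the same multiset differ by a permutation of \<open>{..<k}\<close>. As
  extensional functions they agree outside this set, so the permutation relates them as functions,
  and any representative may define \<open>h'\<close>.\<close>

lemma symmetric_tup_mset:
  assumes "symmetric_tup k h"
  obtains h' where "\<And>x. x \<in> PiE {..<k} (\<lambda>_. UNIV) \<Longrightarrow> h x = h' (tuple_mset k x)"
proof -
  have *: "h x = h x'" if x: "x \<in> PiE {..<k} (\<lambda>_. UNIV)" "x' \<in> PiE {..<k} (\<lambda>_. UNIV)"
    and eq: "tuple_mset k x = tuple_mset k x'" for x x'
  proof -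
    obtain p where p: "p permutes {..<k}" "\<forall>i\<in>{..<k}. x i = x' (p i)"
      using image_mset_eq_implies_permutes[of "{..<k}" x x'] eq by (auto simp: tuple_mset_def)
    have "x = x' \<circ> p"
    proof
      fix i show "x i = (x' \<circ> p) i"
        using p permutes_not_in[OF p(1), of i] x by (cases "i < k") (auto simp: PiE_def extensional_def)
    qed
    then show ?thesis using assms p(1) x(2) by (simp add: symmetric_tup_def)
  qed
  define h' where "h' A = h (SOME x. x \<in> PiE {..<k} (\<lambda>_. UNIV) \<and> tuple_mset k x = A)" for A
  show ?thesis
  proof (rule that)
    fix x :: "nat \<Rightarrow> 'a" assume x: "x \<in> PiE {..<k} (\<lambda>_. UNIV)"
    let ?y = "SOME y. y \<in> PiE {..<k} (\<lambda>_. UNIV) \<and> tuple_mset k y = tuple_mset k x"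
    have "?y \<in> PiE {..<k} (\<lambda>_. UNIV) \<and> tuple_mset k ?y = tuple_mset k x"
      by (rule someI[of _ x]) (simp add: x)
    then show "h x = h' (tuple_mset k x)" unfolding h'_def using *[OF x, of ?y] by simp
  qed
qed

definition fs :: "('x \<Rightarrow> nat) \<Rightarrow> nat \<Rightarrow> ('x multiset \<Rightarrow> ennreal) \<Rightarrow> ennreal" where
  "fs w k h = fact_sum w k (\<lambda>x. h (tuple_mset k x))"

lemma fs_0: "fs w 0 h = h {#}"
  by (simp add: fs_def fact_sum_0 tuple_mset_0)

lemma fs_Suc: "fs w (Suc k) h = csum w (\<lambda>y. fs (del y w) k (\<lambda>A. h (add_mset y A)))"
  by (simp add: fs_def fact_sum_Suc tuple_mset_upd)

text \<open>A tuple either avoids the new copy of \<open>y\<close> or uses it in exactly one of its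
  \<open>k + 1\<close> positions. These positions contribute equally because only the multiset of
  entries matters.\<close>

lemma fs_ins_Suc:
  "fs (ins y w) (Suc k) h = fs w (Suc k) h + of_nat (Suc k) * fs w k (\<lambda>A. h (add_mset y A))"
proof (induction k arbitrary: w h)
  case 0
  show ?case by (simp add: fs_Suc fs_0 csum_ins)
next
  case (Suc j)
  have "fs (ins y w) (Suc (Suc j)) h
      = csum w (\<lambda>v. fs (del v (ins y w)) (Suc j) (\<lambda>A. h (add_mset v A))) + fs w (Suc j) (\<lambda>A. h (add_mset y A))"
    unfolding fs_Suc[of "ins y w"] csum_ins by (simp add: del_ins)
  also have "csum w (\<lambda>v. fs (del v (ins y w)) (Suc j) (\<lambda>A. h (add_mset v A)))
      = csum w (\<lambda>v. fs (del v w) (Suc j) (\<lambda>A. h (add_mset v A)) + of_nat (Suc j) * fs (del v w) j (\<lambda>A. h (add_mset y (add_mset v A))))"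
    by (rule csum_cong) (simp add: del_ins_commute Suc.IH add_mset_commute del: of_nat_Suc)
  also have "\<dots> = fs w (Suc (Suc j)) h + of_nat (Suc j) * fs w (Suc j) (\<lambda>A. h (add_mset y A))"
    by (simp only: csum_add csum_cmult fs_Suc)
  finally show ?case by (simp add: distrib_right add_ac)
qed

lemma fs_ins: "fs (ins y w) k h = fs w k h + of_nat k * fs w (k - 1) (\<lambda>A. h (add_mset y A))"
  by (cases k) (simp_all add: fs_0 fs_ins_Suc del: of_nat_Suc)

text \<open>The falling factorial. Truncation makes it 0 for \<open>j > k\<close>: a tuple of length
  \<open>k\<close> cannot use more than \<open>k\<close> new points.\<close>

definition falling :: "nat \<Rightarrow> nat \<Rightarrow> nat" where "falling k j = (\<Prod>l<j. k - l)"

lemma falling_Suc: "falling k (Suc j) = k * falling (k - 1) j"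
  by (simp only: falling_def prod.lessThan_Suc_shift) simp

lemma falling_fact: "j \<le> k \<Longrightarrow> falling k j * fact (k - j) = fact k"
proof (induction j arbitrary: k)
  case 0 then show ?case by (simp add: falling_def)
next
  case (Suc j)
  then obtain k' where k: "k = Suc k'" by (cases k) auto
  have IH: "falling k' j * fact (k' - j) = fact k'" using Suc k by simp
  have "falling k (Suc j) * fact (k - Suc j) = Suc k' * (falling k' j * fact (k' - j))"
    unfolding k falling_Suc by (simp only: diff_Suc_1 diff_Suc_Suc mult.assoc)
  then show ?case by (simp only: IH k fact_Suc of_nat_id)
qed

text \<open>The set \<open>I\<close> records which added points are used. They can be placed in
  \<open>falling k (card I)\<close> ways, and the remaining entries come from \<open>w\<close>. The
  configuration is \<open>add_pts w m x\<close> written out.\<close>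

lemma fs_add_pts:
  fixes w :: "'x \<Rightarrow> nat" and x :: "nat \<Rightarrow> 'x"
  shows "fs (\<lambda>y. w y + card {i. i < m \<and> x i = y}) k h = (\<Sum>I\<in>Pow {..<m}. of_nat (falling k (card I)) *
    fs w (k - card I) (\<lambda>A. h (image_mset x (mset_set I) + A)))"
proof (induction m arbitrary: k h)
  case 0
  show ?case by (simp add: falling_def)
next
  case (Suc m)
  let ?w = "\<lambda>m y. w y + card {i. i < m \<and> x i = y}"
  let ?S = "\<lambda>k h I. of_nat (falling k (card I)) * fs w (k - card I) (\<lambda>A. h (image_mset x (mset_set I) + A))"
  have "?w (Suc m) = ins (x m) (?w m)"
  proof
    fix y
    have "{i. i < Suc m \<and> x i = y} = {i. i < m \<and> x i = y} \<union> (if x m = y then {m} else {})" by (auto simp: less_Suc_eq)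
    then show "?w (Suc m) y = ins (x m) (?w m) y" by (auto simp: ins_def card_insert_disjoint)
  qed
  then have "fs (?w (Suc m)) k h = fs (?w m) k h + of_nat k * fs (?w m) (k - 1) (\<lambda>A. h (add_mset (x m) A))"
    by (simp only: fs_ins)
  also have "\<dots> = (\<Sum>I\<in>Pow {..<m}. ?S k h I) + (\<Sum>I\<in>Pow {..<m}. of_nat k * ?S (k - 1) (\<lambda>A. h (add_mset (x m) A)) I)"
    by (simp only: Suc.IH sum_distrib_left)
  also have "(\<Sum>I\<in>Pow {..<m}. of_nat k * ?S (k - 1) (\<lambda>A. h (add_mset (x m) A)) I) = (\<Sum>I\<in>Pow {..<m}. ?S k h (insert m I))"
  proof (rule sum.cong[OF refl])
    fix I assume I: "I \<in> Pow {..<m}"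
    then have f: "finite I" "m \<notin> I" by (auto intro: finite_subset)
    show "of_nat k * ?S (k - 1) (\<lambda>A. h (add_mset (x m) A)) I = ?S k h (insert m I)"
      using f by (simp add: falling_Suc mult.assoc)
  qed
  also have "\<dots> = (\<Sum>I\<in>insert m ` Pow {..<m}. ?S k h I)"
    by (subst sum.reindex) (auto simp: inj_on_def insert_ident)
  also have "(\<Sum>I\<in>Pow {..<m}. ?S k h I) + \<dots> = (\<Sum>I\<in>Pow {..<m} \<union> insert m ` Pow {..<m}. ?S k h I)"
    by (rule sum.union_disjoint[symmetric]) auto
  also have "Pow {..<m} \<union> insert m ` Pow {..<m} = Pow {..<Suc m}"
    by (simp add: lessThan_Suc Pow_insert)
  finally show ?case .
qed

text \<open>The number of ways to pick the points of \<open>B\<close> out of \<open>w\<close> when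
  copies of the same point are told apart.\<close>

definition mset_choose :: "('x \<Rightarrow> nat) \<Rightarrow> 'x multiset \<Rightarrow> nat" where
  "mset_choose w B = (\<Prod>v\<in>set_mset B. w v choose count B v)"

text \<open>The absorption identity \<open>n * (n - 1 choose m) = (m + 1) * (n choose m + 1)\<close>
  at the point \<open>v\<close>; the factors of all other points stay as they are.\<close>

lemma mset_choose_del:
  assumes "v \<in># B"
  shows "w v * mset_choose (del v w) (B - {#v#}) = count B v * mset_choose w B"
proof -
  let ?r = "\<Prod>u\<in>set_mset B - {v}. w u choose count B u"
  have "mset_choose (del v w) (B - {#v#}) = (\<Prod>u\<in>set_mset B. del v w u choose count (B - {#v#}) u)"
    unfolding mset_choose_def by (rule prod.mono_neutral_left) (auto dest: in_diffD simp: not_in_iff)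
  also have "\<dots> = (del v w v choose count (B - {#v#}) v) * (\<Prod>u\<in>set_mset B - {v}. del v w u choose count (B - {#v#}) u)"
    using assms by (intro prod.remove) auto
  also have "(\<Prod>u\<in>set_mset B - {v}. del v w u choose count (B - {#v#}) u) = ?r"
    by (intro prod.cong) (auto simp: del_def)
  finally have 1: "mset_choose (del v w) (B - {#v#}) = (del v w v choose count (B - {#v#}) v) * ?r" .
  have 2: "mset_choose w B = (w v choose count B v) * ?r"
    unfolding mset_choose_def using assms by (intro prod.remove) auto
  obtain m where m: "count B v = Suc m" using assms by (metis count_greater_zero_iff gr0_implies_Suc)
  have "w v * (del v w v choose count (B - {#v#}) v) = count B v * (w v choose count B v)"
    by (cases "w v")
       (simp_all add: del_def m Suc_times_binomial_eq mult.commute del: binomial_Suc_Suc mult_Suc mult_Suc_right)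
  then show ?thesis unfolding 1 2 by (simp add: mult.assoc[symmetric])
qed

text \<open>Every member of \<open>B\<close> may be the last entry of the tuple. The multiplicities
  \<open>count B v\<close> add up to the size of \<open>B\<close>, which supplies the next factor of
  the factorial.\<close>

lemma fs_singleton:
  "size B = k \<Longrightarrow> fs w k (\<lambda>A. of_bool (A = B)) = of_nat (fact k * mset_choose w B)"
proof (induction k arbitrary: w B)
  case 0
  then show ?case by (simp add: fs_0 mset_choose_def)
next
  case (Suc k)
  have zero: "fs w' k (\<lambda>_. 0) = 0" for w' :: "'a \<Rightarrow> nat" by (simp add: fs_def fact_sum_def)
  have inner: "fs (del v w) k (\<lambda>A. of_bool (add_mset v A = B)) = (if v \<in># B then of_nat (fact k * mset_choose (del v w) (B - {#v#})) else 0)" for v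
  proof (cases "v \<in># B")
    case True
    then have "add_mset v A = B \<longleftrightarrow> A = B - {#v#}" for A by auto
    then show ?thesis using True Suc.IH[of "B - {#v#}" "del v w"] Suc.prems by (simp add: size_Diff_singleton)
  next
    case False
    then have "add_mset v A \<noteq> B" for A by auto
    then show ?thesis using False zero by simp
  qed
  have "fs w (Suc k) (\<lambda>A. of_bool (A = B)) = csum w (\<lambda>v. if v \<in># B then of_nat (fact k * mset_choose (del v w) (B - {#v#})) else 0)"
    by (simp only: fs_Suc inner)
  also have "\<dots> = (\<Sum>v\<in>set_mset B. of_nat (w v) * (if v \<in># B then of_nat (fact k * mset_choose (del v w) (B - {#v#})) else 0))"
    by (rule csum_eq_sum) auto
  also have "\<dots> = (\<Sum>v\<in>set_mset B. of_nat (fact k * (count B v * mset_choose w B)))"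
  proof (rule sum.cong[OF refl])
    fix v assume v: "v \<in> set_mset B"
    have "w v * (fact k * mset_choose (del v w) (B - {#v#})) = fact k * (count B v * mset_choose w B)"
      using mset_choose_del[OF v, of w] by (metis mult.left_commute)
    then show "of_nat (w v) * (if v \<in># B then of_nat (fact k * mset_choose (del v w) (B - {#v#})) else 0) = (of_nat (fact k * (count B v * mset_choose w B)) :: ennreal)"
      using v by (simp only: if_True of_nat_mult[symmetric])
  qed
  also have "\<dots> = of_nat (\<Sum>v\<in>set_mset B. fact k * (count B v * mset_choose w B))"
    by (simp only: of_nat_sum)
  also have "(\<Sum>v\<in>set_mset B. fact k * (count B v * mset_choose w B)) = fact k * (size B * mset_choose w B)"
    by (simp only: size_multiset_overloaded_eq sum_distrib_left sum_distrib_right)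
  finally show ?case using Suc.prems by (simp add: algebra_simps)
qed

lemma nn_integral_count_space_of_nat:
  fixes f :: "'a \<Rightarrow> nat"
  shows "(\<integral>\<^sup>+ x. of_nat (f x) \<partial>count_space UNIV) = \<infinity> \<or> (\<exists>n::nat. (\<integral>\<^sup>+ x. of_nat (f x) \<partial>count_space UNIV) = of_nat n)"
proof (cases "finite {x. f x \<noteq> 0}")
  case True
  have "(\<integral>\<^sup>+ x. of_nat (f x) \<partial>count_space UNIV) = (\<Sum>x\<in>{x. f x \<noteq> 0}. of_nat (f x))"
    using True by (intro nn_integral_count_space') auto
  also have "\<dots> = of_nat (\<Sum>x\<in>{x. f x \<noteq> 0}. f x)" by simp
  finally show ?thesis by blast
next
  case False
  have "emeasure (count_space UNIV) {x. f x \<noteq> 0} = (\<integral>\<^sup>+ x. indicator {x. f x \<noteq> 0} x \<partial>count_space UNIV)"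
    by simp
  also have "\<dots> \<le> (\<integral>\<^sup>+ x. of_nat (f x) \<partial>count_space UNIV)"
  proof (rule nn_integral_mono)
    fix x
    show "indicator {x. f x \<noteq> 0} x \<le> (of_nat (f x) :: ennreal)"
      using of_nat_mono[of 1 "f x", where 'a = ennreal] by (cases "f x = 0") auto
  qed
  finally show ?thesis using False by (simp add: top.extremum_unique)
qed

text \<open>Grouping tuples by their multiset extracts the factor \<open>fact k\<close> from a sum
  of naturals. It is cancelled by the normalisation, and this makes the total mass a natural number
  or infinity.\<close>

lemma fs_of_nat:
  fixes h :: "'x multiset \<Rightarrow> nat"
  shows "fs w k (\<lambda>A. of_nat (h A)) = fact k * (\<integral>\<^sup>+ B. of_nat (if size B = k then h B * mset_choose w B else 0) \<partial>count_space UNIV)"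
proof -
  let ?P = "PiE {..<k} (\<lambda>_. UNIV :: 'x set)"
  let ?G = "\<lambda>x B. of_nat (fmult w k x) * (of_nat (h B) * of_bool (tuple_mset k x = B)) * indicator ?P x :: ennreal"
  have 1: "(\<integral>\<^sup>+ x. ?G x B \<partial>count_space UNIV) = of_nat (h B) * fs w k (\<lambda>A. of_bool (A = B))" for B
  proof -
    have "(\<integral>\<^sup>+ x. ?G x B \<partial>count_space UNIV) = (\<integral>\<^sup>+ x. of_nat (fmult w k x) * (of_nat (h B) * of_bool (tuple_mset k x = B)) \<partial>count_space ?P)"
      by (rule nn_integral_count_space_indicator[symmetric]) simp
    also have "\<dots> = (\<integral>\<^sup>+ x. of_nat (h B) * (of_nat (fmult w k x) * of_bool (tuple_mset k x = B)) \<partial>count_space ?P)"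
      by (simp only: mult.left_commute)
    also have "\<dots> = of_nat (h B) * fs w k (\<lambda>A. of_bool (A = B))"
      unfolding fs_def fact_sum_def by (rule nn_integral_cmult) simp
    finally show ?thesis .
  qed
  have 2: "(\<integral>\<^sup>+ B. ?G x B \<partial>count_space UNIV) = of_nat (fmult w k x) * of_nat (h (tuple_mset k x)) * indicator ?P x" for x
  proof -
    have "(\<integral>\<^sup>+ B. ?G x B \<partial>count_space UNIV) = (\<Sum>B\<in>{tuple_mset k x}. ?G x B)"
      by (rule nn_integral_count_space') auto
    also have "\<dots> = ?G x (tuple_mset k x)"
      by (simp only: sum.insert finite.emptyI empty_iff not_False_eq_True sum.empty add_0_right)
    finally show ?thesis by simp
  qed
  have "fs w k (\<lambda>A. of_nat (h A)) = (\<integral>\<^sup>+ x. of_nat (fmult w k x) * of_nat (h (tuple_mset k x)) * indicator ?P x \<partial>count_space UNIV)"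
    unfolding fs_def fact_sum_def by (rule nn_integral_count_space_indicator) simp
  also have "\<dots> = (\<integral>\<^sup>+ x. \<integral>\<^sup>+ B. ?G x B \<partial>count_space UNIV \<partial>count_space UNIV)"
    by (simp only: 2)
  also have "\<dots> = (\<integral>\<^sup>+ p. (\<lambda>(x, B). ?G x B) p \<partial>count_space UNIV)"
    using nn_integral_fst_count_space[of "\<lambda>(x, B). ?G x B"] by simp
  also have "\<dots> = (\<integral>\<^sup>+ B. \<integral>\<^sup>+ x. ?G x B \<partial>count_space UNIV \<partial>count_space UNIV)"
    using nn_integral_snd_count_space[of "\<lambda>(x, B). ?G x B"] by simp
  also have "\<dots> = (\<integral>\<^sup>+ B. fact k * of_nat (if size B = k then h B * mset_choose w B else 0) \<partial>count_space UNIV)"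
    unfolding 1
  proof (rule nn_integral_cong)
    fix B :: "'x multiset"
    show "of_nat (h B) * fs w k (\<lambda>A. of_bool (A = B)) = fact k * of_nat (if size B = k then h B * mset_choose w B else 0)"
    proof (cases "size B = k")
      case True
      then show ?thesis by (simp add: fs_singleton mult_ac)
    next
      case False
      then have "tuple_mset k x \<noteq> B" for x using size_tuple_mset by metis
      then show ?thesis using False by (simp add: fs_def fact_sum_def)
    qed
  qed
  also have "\<dots> = fact k * (\<integral>\<^sup>+ B. of_nat (if size B = k then h B * mset_choose w B else 0) \<partial>count_space UNIV)"
    by (rule nn_integral_cmult) simp
  finally show ?thesis .
qed

lemma ennreal_fact_inverse: "ennreal (1 / fact k) * (fact k * c) = c"
proof -
  have "ennreal (1 / fact k) * fact k = ennreal (1 / fact k) * ennreal (fact k)"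
    by (metis ennreal_of_nat_eq_real_of_nat of_nat_fact)
  also have "\<dots> = 1" by (subst ennreal_mult[symmetric]) simp_all
  finally show ?thesis by (simp add: mult.assoc[symmetric])
qed

text \<open>The orbit of a tuple under permutations contributes a multiple of \<^term>\<open>fact k\<close> to the sum.\<close>

lemma symmetric_fact_sum_nat:
  assumes sym: "symmetric_tup k h" and h: "\<And>x. h x \<in> {0, 1 :: real}"
  shows "ennreal (1 / fact k) * fact_sum w k (\<lambda>x. ennreal (h x)) = \<infinity> \<or>
    (\<exists>n::nat. ennreal (1 / fact k) * fact_sum w k (\<lambda>x. ennreal (h x)) = of_nat n)"
proof -
  obtain h' where h': "\<And>x. x \<in> PiE {..<k} (\<lambda>_. UNIV) \<Longrightarrow> h x = h' (tuple_mset k x)"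
    using symmetric_tup_mset[OF sym] by blast
  define n where "n A = (if h' A = 1 then 1 else 0 :: nat)" for A
  have "fact_sum w k (\<lambda>x. ennreal (h x)) = fs w k (\<lambda>A. of_nat (n A))"
    unfolding fs_def
  proof (rule fact_sum_cong)
    fix x assume "in_fact w k x"
    then have "h x = h' (tuple_mset k x)" by (simp add: in_fact_def h')
    then show "ennreal (h x) = of_nat (n (tuple_mset k x))" using h[of x] by (auto simp: n_def)
  qed
  then show ?thesis
    unfolding fs_of_nat by (simp only: ennreal_fact_inverse nn_integral_count_space_of_nat)
qed

lemma tuple_mset_join:
  assumes "I \<subseteq> {..<k}"
  shows "tuple_mset k (join_tup k I x z) = image_mset x (mset_set I) + tuple_mset (k - card I) z"
proof -
  have fin: "finite I" using assms finite_subset by blast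
  define c where "c = card I"
  have c: "c \<le> k" using assms card_mono[of "{..<k}" I] by (simp add: c_def)
  let ?j = "join_tup k I x z" and ?l = "sorted_list_of_set I"
  have len: "length ?l = c" by (simp add: c_def)
  have "{..<k} = {..<c} \<union> {c..<k}" using c by auto
  then have "mset_set {..<k} = mset_set ({..<c} \<union> {c..<k})" by (simp only:)
  also have "\<dots> = mset_set {..<c} + mset_set {c..<k}" by (rule mset_set_Union) auto
  finally have "mset_set {..<k} = mset_set {..<c} + mset_set {c..<k}" .
  then have "tuple_mset k ?j = image_mset ?j (mset_set {..<c}) + image_mset ?j (mset_set {c..<k})"
    by (simp add: tuple_mset_def)
  also have "image_mset ?j (mset_set {..<c}) = image_mset (\<lambda>i. x (?l ! i)) (mset_set {..<c})"
    by (rule image_mset_cong) (simp add: join_tup_def c_def)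
  also have "\<dots> = image_mset x (mset (map (\<lambda>i. ?l ! i) [0..<c]))"
    by (simp add: multiset.map_comp comp_def lessThan_atLeast0)
  also have "map (\<lambda>i. ?l ! i) [0..<c] = ?l" using map_nth[of ?l] len by simp
  also have "mset ?l = mset_set I" using fin by (metis mset_set_set distinct_sorted_list_of_set set_sorted_list_of_set)
  also have "mset_set {c..<k} = image_mset (\<lambda>i. c + i) (mset_set {..<k - c})"
  proof -
    have "(\<lambda>i. c + i) ` {..<k - c} = {c..<k}"
      using image_add_atLeastLessThan[of c 0 "k - c"] c by (simp add: lessThan_atLeast0)
    then show ?thesis by (subst image_mset_mset_set) (auto simp: inj_on_def)
  qed
  also have "image_mset ?j \<dots> = image_mset z (mset_set {..<k - c})"
    unfolding multiset.map_comp comp_def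
    by (rule image_mset_cong) (use c in \<open>auto simp: join_tup_def c_def\<close>)
  finally show ?thesis by (simp add: tuple_mset_def c_def)
qed

lemma join_tup_PiE: "I \<subseteq> {..<k} \<Longrightarrow> join_tup k I x z \<in> PiE {..<k} (\<lambda>_. UNIV)"
  using card_mono[of "{..<k}" I] by (auto simp: join_tup_def PiE_def extensional_def)

text \<open>Tuples of the enlarged configuration are sorted by the part of \<open>x\<close> that
  they use: nothing gives the old sum, all of \<open>x\<close> the single term \<open>h x\<close>,
  and a proper nonempty part a term of the last sum. The weights come from
  \<open>falling k j / k! = 1 / (k - j)!\<close>. For \<open>k \<ge> 1\<close> the first two cases
  are distinct.\<close>

lemma fact_sum_add_pts:
  assumes sym: "symmetric_tup k h" and x: "x \<in> PiE {..<k} (\<lambda>_. UNIV)" and k: "k \<ge> 1"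
  shows "ennreal (1 / fact k) * fact_sum (add_pts w k x) k (\<lambda>z. ennreal (h z))
    = ennreal (1 / fact k) * fact_sum w k (\<lambda>z. ennreal (h z)) + ennreal (h x)
      + (\<Sum>I \<in> {I. I \<subseteq> {..<k} \<and> I \<noteq> {} \<and> I \<noteq> {..<k}}. ennreal (1 / fact (k - card I)) *
          fact_sum w (k - card I) (\<lambda>z. ennreal (h (join_tup k I x z))))"
proof -
  obtain h' where h': "\<And>x. x \<in> PiE {..<k} (\<lambda>_. UNIV) \<Longrightarrow> h x = h' (tuple_mset k x)"
    using symmetric_tup_mset[OF sym] by blast
  have fs_h: "fact_sum w' k (\<lambda>z. ennreal (h z)) = fs w' k (\<lambda>A. ennreal (h' A))" for w'
    unfolding fs_def by (rule fact_sum_cong) (simp add: in_fact_def h')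
  let ?T = "\<lambda>I. ennreal (1 / fact (k - card I)) * fs w (k - card I) (\<lambda>A. ennreal (h' (image_mset x (mset_set I) + A)))"
  let ?J = "{I. I \<subseteq> {..<k} \<and> I \<noteq> {} \<and> I \<noteq> {..<k}}"
  have fs_join: "fact_sum w (k - card I) (\<lambda>z. ennreal (h (join_tup k I x z))) = fs w (k - card I) (\<lambda>A. ennreal (h' (image_mset x (mset_set I) + A)))"
    if "I \<subseteq> {..<k}" for I
    unfolding fs_def using h'[OF join_tup_PiE[OF that]] by (simp add: tuple_mset_join[OF that])
  have coeff: "ennreal (1 / fact k) * of_nat (falling k (card I)) = ennreal (1 / fact (k - card I))" if "I \<subseteq> {..<k}" for I
  proof -
    have "card I \<le> k" using card_mono[of "{..<k}" I] that by simp
    then have "real (falling k (card I)) * fact (k - card I) = fact k"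
      using falling_fact[of "card I" k] by (metis of_nat_fact of_nat_mult)
    then have "1 / fact k * real (falling k (card I)) = 1 / fact (k - card I)" by (simp add: field_simps)
    then show ?thesis by (simp add: ennreal_of_nat_eq_real_of_nat ennreal_mult[symmetric])
  qed
  have "ennreal (1 / fact k) * fact_sum (add_pts w k x) k (\<lambda>z. ennreal (h z))
     = (\<Sum>I\<in>Pow {..<k}. ennreal (1 / fact k) * (of_nat (falling k (card I)) * fs w (k - card I) (\<lambda>A. ennreal (h' (image_mset x (mset_set I) + A)))))"
    unfolding fs_h add_pts_def fs_add_pts sum_distrib_left ..
  also have "\<dots> = (\<Sum>I\<in>Pow {..<k}. ?T I)"
    by (intro sum.cong refl) (simp add: coeff mult.assoc[symmetric])
  also have "Pow {..<k} = insert {} (insert {..<k} ?J)" by auto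
  also have "(\<Sum>I\<in>insert {} (insert {..<k} ?J). ?T I) = ?T {} + (?T {..<k} + (\<Sum>I\<in>?J. ?T I))"
  proof -
    have "finite ?J" by (rule finite_subset[of _ "Pow {..<k}"]) auto
    moreover have "{..<k} \<noteq> {}" using k by (simp add: lessThan_empty_iff)
    ultimately show ?thesis by simp
  qed
  also have "?T {} = ennreal (1 / fact k) * fact_sum w k (\<lambda>z. ennreal (h z))"
    by (simp add: fs_h)
  also have "?T {..<k} = ennreal (h x)" by (simp add: fs_0 h'[OF x] tuple_mset_def)
  also have "(\<Sum>I\<in>?J. ?T I) = (\<Sum>I \<in> ?J. ennreal (1 / fact (k - card I)) *
          fact_sum w (k - card I) (\<lambda>z. ennreal (h (join_tup k I x z))))"
    by (intro sum.cong refl) (simp add: fs_join)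
  finally show ?thesis by (simp add: add.assoc)
qed

section \<open>Disjointness of closed sets in the Fell topology\<close>

lemma space_fell_sets: "space fell_sets = {F. closed F}"
proof -
  have "topspace fell_topology = {F :: 'a set. closed F}"
    unfolding fell_topology_def topology_generated_by_topspace
  proof (intro set_eqI iffI)
    fix F :: "'a set" assume "F \<in> {F. closed F}"
    then show "F \<in> \<Union> ({{F. closed F \<and> F \<inter> C = {}} |C. compact C} \<union> {{F. closed F \<and> F \<inter> G \<noteq> {}} |G. open G})"
      by (intro UnionI[of "{F. closed F \<and> F \<inter> {} = {}}"] UnI1 CollectI exI[of _ "{}"] conjI) simp_all
  qed auto
  moreover have "space fell_sets = topspace (fell_topology :: 'a set topology)"
    unfolding fell_sets_def by (rule space_measure_of) (auto dest: openin_subset)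
  ultimately show ?thesis by simp
qed

lemma sets_fell_miss:
  assumes "compact C" shows "{F. closed F \<and> F \<inter> C = {}} \<in> sets fell_sets"
proof -
  have "openin fell_topology {F. closed F \<and> F \<inter> C = {}}"
    unfolding fell_topology_def by (rule topology_generated_by_Basis) (use assms in blast)
  moreover have "sets fell_sets = sigma_sets (topspace fell_topology) {U :: 'a set set. openin fell_topology U}"
    unfolding fell_sets_def by (rule sets_measure_of) (auto dest: openin_subset)
  ultimately show ?thesis by (simp add: sigma_sets.Basic)
qed

lemma measurable_miss_compact:
  assumes "S \<in> N \<rightarrow>\<^sub>M fell_sets" "compact C"
  shows "{p \<in> space N. S p \<inter> C = {}} \<in> sets N"
proof -
  have "{p \<in> space N. S p \<inter> C = {}} = S -` {F. closed F \<and> F \<inter> C = {}} \<inter> space N"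
    using measurable_space[OF assms(1)] by (auto simp: space_fell_sets)
  then show ?thesis using measurable_sets[OF assms(1) sets_fell_miss[OF assms(2)]] by simp
qed

text \<open>Only compact sets can be separated in a Hausdorff space directly, so \<open>F\<close> is
  replaced by its trace on a compact neighbourhood of \<open>y\<close>. Keeping the new
  neighbourhood inside that compact set makes its closure compact.\<close>

lemma locally_compact_separation:
  fixes F :: "'x::{second_countable_topology, t2_space} set"
  assumes lc: "locally_compact_space (euclidean :: 'x topology)" and F: "closed F" "y \<notin> F"
  obtains V where "open V" "y \<in> V" "compact (closure V)" "F \<inter> closure V = {}"
proof -
  obtain U C where UC: "open U" "compact C" "y \<in> U" "U \<subseteq> C"
    using lc by (simp add: locally_compact_space_def) metis
  have "compact (F \<inter> C)" using F(1) UC(2) by (rule closed_Int_compact)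
  then have "compactin euclidean {y}" "compactin euclidean (F \<inter> C)" "disjnt {y} (F \<inter> C)"
    using F(2) by (auto simp: disjnt_def)
  moreover have "Hausdorff_space (euclidean :: 'x topology)"
    unfolding Hausdorff_space_def disjnt_def using hausdorff by simp blast
  ultimately have "\<exists>A B. open A \<and> open B \<and> {y} \<subseteq> A \<and> F \<inter> C \<subseteq> B \<and> disjnt A B"
    using Hausdorff_space_compact_separation[of "euclidean :: 'x topology" "{y}" "F \<inter> C"] open_openin by metis
  then
  obtain A B where AB: "open A" "open B" "y \<in> A" "F \<inter> C \<subseteq> B" "A \<inter> B = {}"
    by (auto simp: disjnt_def)
  have "closure (A \<inter> U) \<subseteq> C"
    using UC by (intro closure_minimal) (auto intro: compact_imp_closed)
  moreover have "closure (A \<inter> U) \<inter> B = {}"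
    using AB(2,5) open_Int_closure_eq_empty[of B "A \<inter> U"] by blast
  ultimately have "F \<inter> closure (A \<inter> U) = {}" using AB(4) by blast
  moreover have "compact (closure (A \<inter> U))"
    using \<open>closure (A \<inter> U) \<subseteq> C\<close> UC(2) by (metis closed_Int_compact closed_closure inf.absorb1)
  ultimately show ?thesis using AB UC by (intro that[of "A \<inter> U"]) auto
qed

text \<open>Two closed sets are disjoint iff every compact set of a countable exhaustion has a finite cover by
  basic sets whose closures each miss one of the two; this needs only countably many Fell-measurable events.\<close>

lemma measurable_disjoint_fell:
  fixes S :: "'p \<Rightarrow> 'x::{second_countable_topology, t2_space} set"
  assumes lc: "locally_compact_space (euclidean :: 'x topology)"
    and S: "S \<in> N \<rightarrow>\<^sub>M fell_sets" "S' \<in> N \<rightarrow>\<^sub>M fell_sets"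
  shows "{p \<in> space N. S p \<inter> S' p = {}} \<in> sets N"
proof -
  obtain B :: "'x set set" where B: "countable B" "topological_basis B"
    using ex_countable_basis by auto
  define D where "D = {b \<in> B. compact (closure b)}"
  have D: "countable D" "\<And>d. d \<in> D \<Longrightarrow> compact (closure d)" "\<And>d. d \<in> D \<Longrightarrow> open d"
    using B(1) topological_basis_open[OF B(2)] by (auto simp: D_def)
  have basis: "\<exists>d\<in>D. y \<in> d \<and> F \<inter> closure d = {}" if F: "closed F" "y \<notin> F" for F y
  proof -
    obtain V where V: "open V" "y \<in> V" "compact (closure V)" "F \<inter> closure V = {}"
      using locally_compact_separation[OF lc F] by metis
    obtain b where b: "b \<in> B" "y \<in> b" "b \<subseteq> V" using topological_basisE[OF B(2) V(1,2)] by metis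
    have cl: "closure b \<subseteq> closure V" using b(3) by (rule closure_mono)
    then have "compact (closure b)" using V(3) by (metis closed_Int_compact closed_closure inf.absorb1)
    then show ?thesis using b(1,2) V(4) cl unfolding D_def by blast
  qed
  define \<E> where "\<E> b = {E. finite E \<and> E \<subseteq> D \<and> closure b \<subseteq> \<Union>E}" for b
  have \<E>: "countable (\<E> b)" for b
    using countable_Collect_finite_subset[OF D(1)] by (rule countable_subset[rotated]) (auto simp: \<E>_def)
  let ?M = "\<lambda>d. {p \<in> space N. S p \<inter> closure d = {} \<or> S' p \<inter> closure d = {}}"
  have M: "?M d \<in> sets N" if "d \<in> D" for d
  proof -
    have "?M d = {p \<in> space N. S p \<inter> closure d = {}} \<union> {p \<in> space N. S' p \<inter> closure d = {}}" by auto
    then show ?thesis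
      using measurable_miss_compact[OF S(1) D(2)[OF that]] measurable_miss_compact[OF S(2) D(2)[OF that]] by simp
  qed
  have "{p \<in> space N. S p \<inter> S' p = {}} = {p \<in> space N. \<forall>b\<in>D. \<exists>E\<in>\<E> b. \<forall>d\<in>E. S p \<inter> closure d = {} \<or> S' p \<inter> closure d = {}}"
  proof (intro Collect_cong conj_cong refl iffI)
    fix p assume p: "p \<in> space N" and dj: "S p \<inter> S' p = {}"
    have cl: "closed (S p)" "closed (S' p)"
      using measurable_space[OF S(1) p] measurable_space[OF S(2) p] by (auto simp: space_fell_sets)
    show "\<forall>b\<in>D. \<exists>E\<in>\<E> b. \<forall>d\<in>E. S p \<inter> closure d = {} \<or> S' p \<inter> closure d = {}"
    proof
      fix b assume b: "b \<in> D"
      \<comment> \<open>When the two sets are disjoint, each point misses one of them and has a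
        basic neighbourhood whose closure misses it as well. So \<open>C\<close> covers the space,
        and compactness leaves finitely many members.\<close>
      define C where "C = {d \<in> D. S p \<inter> closure d = {} \<or> S' p \<inter> closure d = {}}"
      have "y \<in> \<Union>C" for y
      proof (cases "y \<in> S p")
        case True
        then have "y \<notin> S' p" using dj by blast
        from basis[OF cl(2) this] show ?thesis unfolding C_def by blast
      next
        case False
        from basis[OF cl(1) this] show ?thesis unfolding C_def by blast
      qed
      then have cover: "closure b \<subseteq> \<Union>C" by blast
      have "open d" if "d \<in> C" for d using that D(3) by (simp add: C_def)
      then obtain E where E: "E \<subseteq> C" "finite E" "closure b \<subseteq> \<Union>E"
        using compactE[OF D(2)[OF b] cover] by metis
      have "E \<in> \<E> b" using E by (auto simp: \<E>_def C_def)
      moreover have "\<forall>d\<in>E. S p \<inter> closure d = {} \<or> S' p \<inter> closure d = {}" using E(1) by (auto simp: C_def)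
      ultimately show "\<exists>E\<in>\<E> b. \<forall>d\<in>E. S p \<inter> closure d = {} \<or> S' p \<inter> closure d = {}" by (rule bexI[rotated])
    qed
  next
    fix p assume *: "\<forall>b\<in>D. \<exists>E\<in>\<E> b. \<forall>d\<in>E. S p \<inter> closure d = {} \<or> S' p \<inter> closure d = {}"
    show "S p \<inter> S' p = {}"
    proof (rule ccontr)
      assume "S p \<inter> S' p \<noteq> {}"
      then obtain y where y: "y \<in> S p" "y \<in> S' p" by blast
      obtain b where b: "b \<in> D" "y \<in> b" using basis[of "{}" y] by auto
      then obtain E where E: "E \<in> \<E> b" "\<forall>d\<in>E. S p \<inter> closure d = {} \<or> S' p \<inter> closure d = {}" using * by blast
      have "y \<in> closure b" using b(2) closure_subset by blast
      then have "y \<in> \<Union>E" using E(1) by (auto simp: \<E>_def)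
      then obtain d where d: "d \<in> E" "y \<in> d" by (rule UnionE)
      then have "y \<in> closure d" using closure_subset by blast
      then show False using E(2) d(1) y by blast
    qed
  qed
  also have "\<dots> = space N - (\<Union>b\<in>D. space N - (\<Union>E\<in>\<E> b. {p \<in> space N. \<forall>d\<in>E. S p \<inter> closure d = {} \<or> S' p \<inter> closure d = {}}))"
    by auto
  also have "\<dots> \<in> sets N"
  proof (intro sets.compl_sets sets.countable_UN'' D(1) \<E>)
    fix b E assume "E \<in> \<E> b"
    then show "{p \<in> space N. \<forall>d\<in>E. S p \<inter> closure d = {} \<or> S' p \<inter> closure d = {}} \<in> sets N"
      by (intro sets.sets_Collect_finite_All M) (auto simp: \<E>_def)
  qed
  finally show ?thesis .
qed

section \<open>Tuples of enlarged configurations, and functions of a possibly infinite count\<close>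

lemma fmult_mono:
  assumes "\<And>y. w y \<le> w' y" shows "fmult w k x \<le> fmult w' k x"
  unfolding fmult_def by (intro prod_mono conjI diff_le_mono assms) auto

lemma in_fact_add_pts: "in_fact w k z \<Longrightarrow> in_fact (add_pts w k x) k z"
  using fmult_mono[of w "add_pts w k x" k z] by (auto simp: in_fact_def add_pts_def)

lemma in_fact_add_pts_self: "x \<in> PiE {..<k} (\<lambda>_. UNIV) \<Longrightarrow> in_fact (add_pts w k x) k x"
  by (auto simp: in_fact_def fmult_def add_pts_def intro!: prod_pos)

lemma fmult_cong: "(\<And>i. i < k \<Longrightarrow> w (x i) = w' (x i)) \<Longrightarrow> fmult w k x = fmult w' k x"
  unfolding fmult_def by (intro prod.cong refl) auto

text \<open>The value at infinity is 0, so that an infinite count on the left of an estimate costs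
  nothing. Negative values of \<open>h\<close> are cut off by \<open>ennreal\<close>; the function
  finally inserted is nonnegative.\<close>

definition eval_count :: "(nat \<Rightarrow> real) \<Rightarrow> ennreal \<Rightarrow> ennreal" where
  "eval_count h w = (if w = \<infinity> then 0 else ennreal (h (nat \<lfloor>enn2real w\<rfloor>)))"

lemma eval_count_of_nat: "eval_count h (of_nat n) = ennreal (h n)"
  by (simp add: eval_count_def enn2real_of_nat)

lemma borel_measurable_eval_count[measurable]: "eval_count h \<in> borel_measurable borel"
proof -
  have "(\<lambda>w. ennreal (h (nat \<lfloor>enn2real w\<rfloor>))) \<in> borel_measurable borel"
    by (rule measurable_compose[of _ _ "count_space UNIV"]) simp_all
  then show ?thesis unfolding eval_count_def by measurable
qed

text \<open>Here \<open>V\<close> is the part common to two counts. If both counts are finite, they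
  differ by at most \<open>r + s\<close>. If the left count is infinite, its value is 0; if only the
  right one is, then \<open>s\<close> is infinite and so is the bound, since
  \<open>c > 0\<close>.\<close>

lemma eval_count_lipschitz:
  fixes V r s :: ennreal
  assumes c: "c > 0" and lip: "\<And>m n. \<bar>h (Suc m) - h (Suc n)\<bar> \<le> c * \<bar>real m - real n\<bar>"
    and u: "V + r = \<infinity> \<or> (\<exists>n::nat. V + r = of_nat n)" and v: "V + s = \<infinity> \<or> (\<exists>n::nat. V + s = of_nat n)"
  shows "eval_count h (V + r + 1) \<le> eval_count h (V + s + 1) + ennreal c * (r + s)"
proof (cases "V + r = \<infinity>")
  case True
  then show ?thesis by (simp add: eval_count_def)
next
  case Vr: False
  then obtain m :: nat where m: "V + r = of_nat m" using u by blast
  show ?thesis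
  proof (cases "V + s = \<infinity>")
    case True
    then have "s = \<infinity>" using Vr by auto
    then have "ennreal c * (r + s) = \<infinity>" using c by (simp add: ennreal_mult_top)
    then show ?thesis by simp
  next
    case False
    then obtain n :: nat where n: "V + s = of_nat n" using v by blast
    have "h (Suc m) \<le> h (Suc n) + c * \<bar>real m - real n\<bar>" using lip[of m n] by linarith
    then have "ennreal (h (Suc m)) \<le> ennreal (h (Suc n) + c * \<bar>real m - real n\<bar>)" by (rule ennreal_leI)
    also have "\<dots> \<le> ennreal (h (Suc n)) + ennreal (c * \<bar>real m - real n\<bar>)"
      using c by (cases "h (Suc n) \<ge> 0") (auto simp: ennreal_plus ennreal_neg intro!: ennreal_leI)
    also have "ennreal (c * \<bar>real m - real n\<bar>) = ennreal c * ennreal \<bar>real m - real n\<bar>"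
      using c by (simp add: ennreal_mult)
    also have "ennreal \<bar>real m - real n\<bar> \<le> r + s"
    proof -
      have "V < \<infinity>" "r < \<infinity>" "s < \<infinity>" using m n by (metis ennreal_add_eq_top ennreal_of_nat_neq_top infinity_ennreal_def less_top)+
      then obtain V' r' s' where e: "V = ennreal V'" "r = ennreal r'" "s = ennreal s'" "V' \<ge> 0" "r' \<ge> 0" "s' \<ge> 0"
        by (metis ennreal_cases infinity_ennreal_def less_irrefl)
      then have "V' + r' = real m" "V' + s' = real n"
        using m n by (simp_all add: ennreal_of_nat_eq_real_of_nat flip: ennreal_plus)
      then have "\<bar>real m - real n\<bar> \<le> r' + s'" using e by linarith
      then show ?thesis using e by (simp flip: ennreal_plus add: ennreal_leI)
    qed
    finally have *: "ennreal (h (Suc m)) \<le> ennreal (h (Suc n)) + ennreal c * (r + s)"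
      by (simp add: mult_left_mono)
    have "of_nat m + 1 = (of_nat (Suc m) :: ennreal)" "of_nat n + 1 = (of_nat (Suc n) :: ennreal)" by simp_all
    then show ?thesis unfolding m n by (simp only: eval_count_of_nat *)
  qed
qed

section \<open>Stabilizing functionals\<close>

text \<open>Locality is available only for tuples of points of the configuration in question. Each
  use therefore first establishes \<open>in_fact\<close>, for \<open>x\<close> after adding
  \<open>x\<close> itself and for tuples of \<open>w\<close> because adding points preserves
  them.\<close>

locale stabilizing_functional = poisson_law X P K
  for X :: "nat \<Rightarrow> 'x::{second_countable_topology, t2_space} set" and P :: "('x \<Rightarrow> nat) measure" and K +
  fixes k :: nat and g :: "(nat \<Rightarrow> 'x) \<Rightarrow> ('x \<Rightarrow> nat) \<Rightarrow> real" and S :: "(nat \<Rightarrow> 'x) \<Rightarrow> 'x set"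
  assumes lc: "locally_compact_space (euclidean :: 'x topology)"
    and k_pos: "k \<ge> 1"
    and g_meas: "(\<lambda>(x, w). g x w) \<in> borel_measurable (PiM {..<k} (\<lambda>_. borel) \<Otimes>\<^sub>M NX)"
    and g_01: "\<And>x w. g x w \<in> {0, 1}"
    and g_sym: "symmetric_tup k g"
    and S_meas: "S \<in> PiM {..<k} (\<lambda>_. borel) \<rightarrow>\<^sub>M fell_sets"
    and S_contains: "\<And>w x i. lf_count w \<Longrightarrow> in_fact w k x \<Longrightarrow> i < k \<Longrightarrow> x i \<in> S x"
    and g_local: "\<And>w x. lf_count w \<Longrightarrow> in_fact w k x \<Longrightarrow> g x w = g x (restr w (S x))"
begin

abbreviation tup :: "nat \<Rightarrow> (nat \<Rightarrow> 'x) measure" where "tup j \<equiv> PiM {..<j} (\<lambda>_. borel)"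
abbreviation Kt :: "nat \<Rightarrow> (nat \<Rightarrow> 'x) measure" where "Kt j \<equiv> PiM {..<j} (\<lambda>_. K)"

lemma sets_Kt[measurable_cong, simp]: "sets (Kt j) = sets (tup j)"
  by (rule sets_PiM_cong) simp_all

lemma space_Kt: "space (Kt j) = PiE {..<j} (\<lambda>_. UNIV)"
  by (simp add: space_PiM)

lemma sigma_finite_Kt: "sigma_finite_measure (Kt j)"
  by (rule Kk.sigma_finite) simp

lemma g_compose:
  assumes "f \<in> N \<rightarrow>\<^sub>M tup k" "L \<in> N \<rightarrow>\<^sub>M NX" shows "(\<lambda>p. g (f p) (L p)) \<in> borel_measurable N"
  using measurable_compose[OF measurable_Pair[OF assms] g_meas] by simp

lemma measurable_tup_component: "f \<in> N \<rightarrow>\<^sub>M tup j \<Longrightarrow> i < j \<Longrightarrow> (\<lambda>p. f p i) \<in> borel_measurable N"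
  by (rule measurable_compose[OF _ measurable_component_singleton]) auto

lemma add_pts_compose:
  assumes "L \<in> N \<rightarrow>\<^sub>M NX" "f \<in> N \<rightarrow>\<^sub>M tup j" shows "(\<lambda>p. add_pts (L p) j (f p)) \<in> N \<rightarrow>\<^sub>M NX"
  using assms by (intro measurable_add_pts measurable_tup_component)

lemma join_compose:
  assumes "f \<in> N \<rightarrow>\<^sub>M tup k" "f' \<in> N \<rightarrow>\<^sub>M tup (k - card I)" "I \<subseteq> {..<k}"
  shows "(\<lambda>p. join_tup k I (f p) (f' p)) \<in> N \<rightarrow>\<^sub>M tup k"
proof -
  have c: "card I \<le> k" using card_mono[of "{..<k}" I] assms(3) by simp
  have fin: "finite I" using assms(3) finite_subset by blast
  have "(\<lambda>p. join_tup k I (f p) (f' p)) = (\<lambda>p. \<lambda>j\<in>{..<k}. if j < card I then f p (sorted_list_of_set I ! j) else f' p (j - card I))"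
    using c by (auto simp: join_tup_def fun_eq_iff)
  also have "\<dots> \<in> N \<rightarrow>\<^sub>M tup k"
  proof (rule measurable_restrict)
    fix j assume j: "j \<in> {..<k}"
    show "(\<lambda>p. if j < card I then f p (sorted_list_of_set I ! j) else f' p (j - card I)) \<in> borel_measurable N"
    proof (cases "j < card I")
      case True
      then have "sorted_list_of_set I ! j \<in> set (sorted_list_of_set I)" by (intro nth_mem) simp
      then have "sorted_list_of_set I ! j < k" using fin assms(3) by auto
      then show ?thesis using True measurable_tup_component[OF assms(1)] by simp
    next
      case False
      then have "j - card I < k - card I" using j by auto
      then show ?thesis using False measurable_tup_component[OF assms(2)] by simp
    qed
  qed
  finally show ?thesis .
qed

definition hit :: "(nat \<Rightarrow> 'x) \<Rightarrow> (nat \<Rightarrow> 'x) \<Rightarrow> ennreal" where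
  "hit x z = indicator {p. fst p \<inter> snd p \<noteq> {}} (S x, S z)"

lemma hit_compose:
  assumes "f \<in> N \<rightarrow>\<^sub>M tup k" "f' \<in> N \<rightarrow>\<^sub>M tup k"
  shows "(\<lambda>p. hit (f p) (f' p)) \<in> borel_measurable N"
proof -
  have "{p \<in> space N. S (f p) \<inter> S (f' p) = {}} \<in> sets N"
    by (rule measurable_disjoint_fell[OF lc measurable_compose[OF assms(1) S_meas] measurable_compose[OF assms(2) S_meas]])
  then have "(\<lambda>p. 1 - indicator {p \<in> space N. S (f p) \<inter> S (f' p) = {}} p :: ennreal) \<in> borel_measurable N" by measurable
  moreover have "hit (f p) (f' p) = 1 - indicator {p \<in> space N. S (f p) \<inter> S (f' p) = {}} p" if "p \<in> space N" for p
    using that by (auto simp: hit_def indicator_def)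
  ultimately show ?thesis by (subst measurable_cong) auto
qed

abbreviation e :: "nat \<Rightarrow> ennreal" where "e j \<equiv> ennreal (1 / fact j)"

abbreviation gg :: "(nat \<Rightarrow> 'x) \<Rightarrow> ('x \<Rightarrow> nat) \<Rightarrow> ennreal" where "gg x w \<equiv> ennreal (g x w)"

definition W :: "('x \<Rightarrow> nat) \<Rightarrow> ennreal" where "W w = e k * fact_sum w k (\<lambda>z. gg z w)"

text \<open>\<open>R2\<close>, \<open>R3\<close> and \<open>R4\<close> are the parts that the two
  compared sums do not share with each other. \<open>R2\<close> is going to be evaluated at the
  resampled configuration; \<open>R3\<close> and \<open>R4\<close> describe the original one after
  \<open>x\<close> has been added.\<close>

definition R2 :: "(nat \<Rightarrow> 'x) \<Rightarrow> ('x \<Rightarrow> nat) \<Rightarrow> ennreal" where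
  "R2 x w = e k * fact_sum w k (\<lambda>z. hit x z * gg z w)"

definition R3 :: "(nat \<Rightarrow> 'x) \<Rightarrow> ('x \<Rightarrow> nat) \<Rightarrow> ennreal" where
  "R3 x w = e k * fact_sum w k (\<lambda>z. hit x z * gg z (add_pts w k x))"

abbreviation sub :: "nat set set" where "sub \<equiv> {I. I \<subseteq> {..<k} \<and> I \<noteq> {} \<and> I \<noteq> {..<k}}"

definition R4 :: "(nat \<Rightarrow> 'x) \<Rightarrow> ('x \<Rightarrow> nat) \<Rightarrow> ennreal" where
  "R4 x w = (\<Sum>I\<in>sub. e (k - card I) * fact_sum w (k - card I) (\<lambda>z. gg (join_tup k I x z) (add_pts w k x)))"

definition V :: "(nat \<Rightarrow> 'x) \<Rightarrow> ('x \<Rightarrow> nat) \<Rightarrow> ennreal" where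
  "V x w = e k * fact_sum w k (\<lambda>z. (1 - hit x z) * gg z w)"

lemma hit_01: "hit x z = 0 \<or> hit x z = 1"
  by (simp add: hit_def indicator_def)

lemma hit_0: "hit x z = 0 \<longleftrightarrow> S x \<inter> S z = {}"
  by (simp add: hit_def indicator_def)

lemma hit_split: "c = (1 - hit x z) * c + hit x z * (c :: ennreal)"
  using hit_01[of x z] by auto

lemma W_nat: "W w = \<infinity> \<or> (\<exists>n::nat. W w = of_nat n)"
  unfolding W_def
proof (rule symmetric_fact_sum_nat[where h = "\<lambda>z. g z w"])
  show "symmetric_tup k (\<lambda>z. g z w)" using g_sym by (simp add: symmetric_tup_def)
qed (rule g_01)

lemma W_split: "W w = V x w + R2 x w"
proof -
  have "fact_sum w k (\<lambda>z. gg z w) = fact_sum w k (\<lambda>z. (1 - hit x z) * gg z w + hit x z * gg z w)"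
    by (rule fact_sum_cong) (rule hit_split)
  then show ?thesis by (simp only: W_def V_def R2_def fact_sum_add distrib_left)
qed

text \<open>If \<open>S z\<close> misses \<open>S x\<close>, the added points lie in
  \<open>S x\<close> and hence outside \<open>S z\<close>, so by locality they do not change the
  summand of \<open>z\<close>. The tuple \<open>x\<close> itself contributes the separate
  summand.\<close>

lemma W_add_pts:
  assumes lf: "lf_count w" and x: "x \<in> PiE {..<k} (\<lambda>_. UNIV)"
  shows "W (add_pts w k x) = V x w + R3 x w + gg x (add_pts w k x) + R4 x w"
proof -
  let ?w = "add_pts w k x"
  have xS: "x i \<in> S x" if "i < k" for i
    using S_contains[OF lf_count_add_pts[OF lf] in_fact_add_pts_self[OF x] that] .
  have "fact_sum w k (\<lambda>z. gg z ?w) = fact_sum w k (\<lambda>z. (1 - hit x z) * gg z w + hit x z * gg z ?w)"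
  proof (rule fact_sum_cong)
    fix z assume z: "in_fact w k z"
    show "gg z ?w = (1 - hit x z) * gg z w + hit x z * gg z ?w"
    proof (cases "hit x z = 0")
      case True
      then have dj: "S x \<inter> S z = {}" by (simp add: hit_0)
      have "restr ?w (S z) = restr w (S z)"
      proof
        fix y
        have "{i. i < k \<and> x i = y} = {}" if "y \<in> S z" using xS dj that by blast
        then show "restr ?w (S z) y = restr w (S z) y" by (simp add: restr_def add_pts_def)
      qed
      moreover have "g z ?w = g z (restr ?w (S z))"
        by (rule g_local[OF lf_count_add_pts[OF lf] in_fact_add_pts[OF z]])
      moreover have "g z w = g z (restr w (S z))" by (rule g_local[OF lf z])
      ultimately show ?thesis using True by simp
    next
      case False
      then show ?thesis using hit_01[of x z] by simp
    qed
  qed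
  then have 1: "e k * fact_sum w k (\<lambda>z. gg z ?w) = V x w + R3 x w"
    by (simp only: V_def R3_def fact_sum_add distrib_left)
  have "W ?w = e k * fact_sum w k (\<lambda>z. gg z ?w) + gg x ?w + R4 x w"
    unfolding W_def R4_def
  proof (rule fact_sum_add_pts[OF _ x k_pos])
    show "symmetric_tup k (\<lambda>z. g z ?w)" using g_sym by (simp add: symmetric_tup_def)
  qed
  then show ?thesis unfolding 1 .
qed

text \<open>For \<open>S z\<close> disjoint from \<open>S x\<close> the entries of \<open>z\<close>
  lie in \<open>S z\<close>, where the two configurations coincide; so both the weight of
  \<open>z\<close> and the value of \<open>g\<close> agree. Locality needs \<open>z\<close> to be a
  tuple of the configuration, and this may be known for either one, hence the auxiliary fact is
  applied in both directions.\<close>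

lemma V_mix:
  assumes "lf_count w" "lf_count w'"
  shows "V x (mix (S x) w' w) = V x w"
proof -
  let ?m = "mix (S x) w' w"
  have *: "fmult w1 k z * ((1 - hit x z) * gg z w1) = fmult w2 k z * ((1 - hit x z) * gg z w2)"
    if z: "in_fact w1 k z" and lf: "lf_count w1" "lf_count w2" and eq: "\<And>y. y \<notin> S x \<Longrightarrow> w1 y = w2 y" for w1 w2 z
  proof (cases "hit x z = 0")
    case True
    then have dj: "S x \<inter> S z = {}" by (simp add: hit_0)
    have zS: "z i \<in> S z" if "i < k" for i by (rule S_contains[OF lf(1) z that])
    then have fm: "fmult w1 k z = fmult w2 k z" using dj eq by (intro fmult_cong) blast
    then have z2: "in_fact w2 k z" using z by (simp add: in_fact_def)
    have "restr w1 (S z) = restr w2 (S z)" using dj eq by (auto simp: restr_def fun_eq_iff)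
    then have "g z w1 = g z w2" using g_local[OF lf(1) z] g_local[OF lf(2) z2] by simp
    then show ?thesis using fm by simp
  next
    case False
    then show ?thesis using hit_01[of x z] by simp
  qed
  have lf: "lf_count ?m" using assms by (intro lf_count_mix)
  have m: "?m y = w y" if "y \<notin> S x" for y using that by (simp add: mix_def)
  have "fact_sum ?m k (\<lambda>z. (1 - hit x z) * gg z ?m) = fact_sum w k (\<lambda>z. (1 - hit x z) * gg z w)"
    unfolding fact_sum_def
  proof (rule nn_integral_cong)
    fix z assume "z \<in> space (count_space (PiE {..<k} (\<lambda>_. UNIV :: 'x set)))"
    then have z: "z \<in> PiE {..<k} (\<lambda>_. UNIV)" by simp
    consider "in_fact ?m k z" | "in_fact w k z" | "fmult ?m k z = 0" "fmult w k z = 0"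
      using z by (auto simp: in_fact_def)
    then show "fmult ?m k z * ((1 - hit x z) * gg z ?m) = fmult w k z * ((1 - hit x z) * gg z w)"
    proof cases
      case 1 then show ?thesis by (rule *[OF _ lf assms(1)]) (rule m)
    next
      case 2 then show ?thesis by (rule *[symmetric, OF _ assms(1) lf]) (rule m[symmetric])
    qed simp
  qed
  then show ?thesis by (simp add: V_def)
qed

lemma gg_01: "gg x w = 0 \<or> gg x w = 1"
  using g_01[of x w] by auto

lemma S_borel: assumes "x \<in> PiE {..<k} (\<lambda>_. UNIV)" shows "S x \<in> sets borel"
proof -
  have "x \<in> space (tup k)" using assms by (simp add: space_PiM)
  then have "closed (S x)" using measurable_space[OF S_meas] by (auto simp: space_fell_sets)
  then show ?thesis by (rule borel_closed)
qed

lemma g_mix: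
  assumes x: "x \<in> PiE {..<k} (\<lambda>_. UNIV)" and lf: "lf_count w" "lf_count w'"
  shows "g x (add_pts (mix (S x) w w') k x) = g x (add_pts w k x)"
proof -
  have "restr (add_pts (mix (S x) w w') k x) (S x) = restr (add_pts w k x) (S x)"
    by (auto simp: restr_def add_pts_def mix_def fun_eq_iff)
  then show ?thesis
    using g_local[OF lf_count_add_pts[OF lf_count_mix[OF lf]] in_fact_add_pts_self[OF x]]
      g_local[OF lf_count_add_pts[OF lf(1)] in_fact_add_pts_self[OF x]] by simp
qed

text \<open>The part \<^term>\<open>V x\<close> of the sum, over tuples whose neighbourhood avoids \<^term>\<open>S x\<close>, is unaffected both by
  adding \<^term>\<open>x\<close> and by resampling inside \<^term>\<open>S x\<close>, so it cancels in the comparison.\<close>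

lemma pointwise_comparison:
  fixes c :: real
  assumes c: "c > 0" and lip: "\<And>m n. \<bar>h (Suc m) - h (Suc n)\<bar> \<le> c * \<bar>real m - real n\<bar>"
    and x: "x \<in> PiE {..<k} (\<lambda>_. UNIV)" and lf: "lf_count w" "lf_count w'"
  defines "G \<equiv> gg x (add_pts w k x)" and "m \<equiv> mix (S x) w' w"
  shows "G * eval_count h (W m + 1) \<le> G * eval_count h (W (add_pts w k x)) + ennreal c * (G * R2 x m + (G * R3 x w + G * R4 x w))"
    and "G * eval_count h (W (add_pts w k x)) \<le> G * eval_count h (W m + 1) + ennreal c * (G * R2 x m + (G * R3 x w + G * R4 x w))"
proof -
  let ?err = "ennreal c * (G * R2 x m + (G * R3 x w + G * R4 x w))"
  have "V x m = V x w" unfolding m_def by (rule V_mix[OF lf])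
  then have Wm: "W m = V x w + R2 x m" using W_split[of m x] by (simp only:)
  have Wa: "W (add_pts w k x) = V x w + (R3 x w + R4 x w) + 1" if "G = 1"
    using W_add_pts[OF lf(1) x] that by (simp add: G_def add_ac)
  have n1: "V x w + R2 x m = \<infinity> \<or> (\<exists>n::nat. V x w + R2 x m = of_nat n)"
    using W_nat[of m] by (simp add: Wm)
  \<comment> \<open>Integrality is known for the full sums \<open>W\<close> only. Here it is
    transferred to the sum without \<open>x\<close>, whose contribution is 1.\<close>
  have n2: "V x w + (R3 x w + R4 x w) = \<infinity> \<or> (\<exists>n::nat. V x w + (R3 x w + R4 x w) = of_nat n)" if "G = 1"
  proof -
    define u where "u = V x w + (R3 x w + R4 x w)"
    have "u + 1 = \<infinity> \<or> (\<exists>n::nat. u + 1 = of_nat n)" using W_nat[of "add_pts w k x"] by (simp add: Wa[OF that] u_def)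
    then show ?thesis unfolding u_def[symmetric]
    proof
      assume "u + 1 = \<infinity>" then show "u = \<infinity> \<or> (\<exists>n::nat. u = of_nat n)" by simp
    next
      assume "\<exists>n::nat. u + 1 = of_nat n"
      then obtain n :: nat where n: "u + 1 = of_nat n" by blast
      then have "n \<noteq> 0" by (metis add_eq_0_iff_both_eq_0 of_nat_0 zero_neq_one)
      then obtain n' where n': "n = Suc n'" by (cases n) auto
      have "u = (u + 1) - 1" by simp
      also have "\<dots> = (of_nat n' + 1) - 1" using n n' by (simp add: add.commute)
      also have "\<dots> = of_nat n'" by simp
      finally show "u = \<infinity> \<or> (\<exists>n::nat. u = of_nat n)" by blast
    qed
  qed
  consider "G = 0" | "G = 1" using gg_01[of x "add_pts w k x"] by (auto simp: G_def)
  then have "G * eval_count h (W m + 1) \<le> G * eval_count h (W (add_pts w k x)) + ?err \<and>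
    G * eval_count h (W (add_pts w k x)) \<le> G * eval_count h (W m + 1) + ?err"
  proof cases
    case 2
    show ?thesis
      using eval_count_lipschitz[OF c lip n1 n2[OF 2]] eval_count_lipschitz[OF c lip n2[OF 2] n1]
      by (simp add: 2 Wa[OF 2] Wm add.commute[of _ "R2 x m"])
  qed simp
  then show "G * eval_count h (W m + 1) \<le> G * eval_count h (W (add_pts w k x)) + ?err"
    "G * eval_count h (W (add_pts w k x)) \<le> G * eval_count h (W m + 1) + ?err" by blast+
qed

end

section \<open>Measurability and expectations of the remainders\<close>

context stabilizing_functional begin

lemma measurable_Kt: "f \<in> N \<rightarrow>\<^sub>M Kt j \<Longrightarrow> f \<in> N \<rightarrow>\<^sub>M tup j"
  unfolding measurable_cong_sets[OF refl sets_Kt] .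

lemma measurable_NX_P: "f \<in> N \<rightarrow>\<^sub>M P \<Longrightarrow> f \<in> N \<rightarrow>\<^sub>M NX"
  unfolding measurable_cong_sets[OF refl sets_P] .

lemma gg_compose:
  assumes "f \<in> N \<rightarrow>\<^sub>M tup k" "L \<in> N \<rightarrow>\<^sub>M NX" shows "(\<lambda>p. gg (f p) (L p)) \<in> borel_measurable N"
  using g_compose[OF assms] by measurable

lemma const_tup: "x \<in> PiE {..<j} (\<lambda>_. UNIV) \<Longrightarrow> (\<lambda>_. x) \<in> N \<rightarrow>\<^sub>M tup j"
  by (rule measurable_const) (simp add: space_PiM)

lemma W_measurable[measurable]: "W \<in> borel_measurable NX"
  unfolding W_def
  by (intro borel_measurable_times_ennreal borel_measurable_const fact_sum_measurable_NX)
     (simp add: case_prod_unfold gg_compose)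

context
  fixes x :: "nat \<Rightarrow> 'x" assumes x: "x \<in> PiE {..<k} (\<lambda>_. UNIV)"
begin

lemma add_x: "L \<in> N \<rightarrow>\<^sub>M NX \<Longrightarrow> (\<lambda>p. add_pts (L p) k x) \<in> N \<rightarrow>\<^sub>M NX"
  by (rule add_pts_compose[OF _ const_tup[OF x]])

lemma gg_x_measurable[measurable]: "(\<lambda>w. gg x (add_pts w k x)) \<in> borel_measurable NX"
  by (intro gg_compose const_tup[OF x] add_x) simp

lemma hit_gg_measurable: "(\<lambda>(w, z). hit x z * gg z w) \<in> borel_measurable (NX \<Otimes>\<^sub>M tup k)"
  unfolding case_prod_unfold by (intro borel_measurable_times_ennreal hit_compose const_tup[OF x] gg_compose) simp_all

lemma R2_measurable[measurable]: "R2 x \<in> borel_measurable NX"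
  unfolding R2_def
  by (intro borel_measurable_times_ennreal borel_measurable_const fact_sum_measurable_NX hit_gg_measurable)

lemma hit_gg_add_measurable: "(\<lambda>(w, z). hit x z * gg z (add_pts w k x)) \<in> borel_measurable (NX \<Otimes>\<^sub>M tup k)"
  unfolding case_prod_unfold by (intro borel_measurable_times_ennreal hit_compose const_tup[OF x] gg_compose add_x) simp_all

lemma R3_measurable[measurable]: "R3 x \<in> borel_measurable NX"
  unfolding R3_def
  by (intro borel_measurable_times_ennreal borel_measurable_const fact_sum_measurable_NX hit_gg_add_measurable)

lemma join_gg_measurable:
  "I \<subseteq> {..<k} \<Longrightarrow> (\<lambda>(w, z). gg (join_tup k I x z) (add_pts w k x)) \<in> borel_measurable (NX \<Otimes>\<^sub>M tup (k - card I))"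
  unfolding case_prod_unfold by (intro gg_compose join_compose const_tup[OF x] add_x) simp_all

lemma R4_summand_measurable:
  assumes "I \<subseteq> {..<k}"
  shows "(\<lambda>w. fact_sum w (k - card I) (\<lambda>z. gg (join_tup k I x z) (add_pts w k x))) \<in> borel_measurable NX"
  by (rule fact_sum_measurable_NX[OF join_gg_measurable[OF assms]])

lemma R4_measurable[measurable]: "R4 x \<in> borel_measurable NX"
  unfolding R4_def
  by (intro borel_measurable_sum borel_measurable_times_ennreal R4_summand_measurable borel_measurable_const) auto

end

definition pr :: "(nat \<Rightarrow> 'x) \<Rightarrow> ennreal" where "pr x = (\<integral>\<^sup>+ w. gg x (add_pts w k x) \<partial>P)"

text \<open>\<open>b2\<close>, \<open>b3\<close> and \<open>b4 I\<close> are the inner integrals of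
  \<open>E2\<close>, of \<open>E3\<close> and of the summand \<open>I\<close> of \<open>E4\<close>,
  for fixed \<open>x\<close>.\<close>

definition b2 :: "(nat \<Rightarrow> 'x) \<Rightarrow> ennreal" where "b2 x = (\<integral>\<^sup>+ z. hit x z * pr x * pr z \<partial>Kt k)"

definition b3 :: "(nat \<Rightarrow> 'x) \<Rightarrow> ennreal" where
  "b3 x = (\<integral>\<^sup>+ z. hit x z * (\<integral>\<^sup>+ w. ennreal (g x (add_pts (add_pts w k x) k z)
      * g z (add_pts (add_pts w k x) k z)) \<partial>P) \<partial>Kt k)"

definition b4 :: "nat set \<Rightarrow> (nat \<Rightarrow> 'x) \<Rightarrow> ennreal" where
  "b4 I x = (\<integral>\<^sup>+ z. (\<integral>\<^sup>+ w. ennreal (g x (add_pts (add_pts w k x) (k - card I) z)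
      * g (join_tup k I x z) (add_pts (add_pts w k x) (k - card I) z)) \<partial>P) \<partial>Kt (k - card I))"

lemma g_mult: "ennreal (g x w * g z w') = gg x w * gg z w'"
  using g_01[of x w] g_01[of z w'] by (intro ennreal_mult) auto

lemma g_mult_compose:
  assumes "f \<in> N \<rightarrow>\<^sub>M tup k" "f' \<in> N \<rightarrow>\<^sub>M tup k" "L \<in> N \<rightarrow>\<^sub>M NX"
  shows "(\<lambda>p. ennreal (g (f p) (L p) * g (f' p) (L p))) \<in> borel_measurable N"
  unfolding g_mult by (intro borel_measurable_times_ennreal gg_compose assms)

lemma pr_measurable[measurable]: "pr \<in> borel_measurable (tup k)"
  unfolding pr_def
proof (rule borel_measurable_nn_integral)
  show "(\<lambda>(x, w). gg x (add_pts w k x)) \<in> borel_measurable (tup k \<Otimes>\<^sub>M P)"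
    unfolding case_prod_unfold by (intro gg_compose add_pts_compose measurable_NX_P) simp_all
qed

lemma b2_measurable[measurable]: "b2 \<in> borel_measurable (tup k)"
  unfolding b2_def
proof (rule sigma_finite_measure.borel_measurable_nn_integral[OF sigma_finite_Kt])
  show "(\<lambda>(x, z). hit x z * pr x * pr z) \<in> borel_measurable (tup k \<Otimes>\<^sub>M Kt k)"
    unfolding case_prod_unfold
    by (intro borel_measurable_times_ennreal hit_compose measurable_Kt measurable_compose[OF _ pr_measurable]) simp_all
qed

lemma b3_measurable[measurable]: "b3 \<in> borel_measurable (tup k)"
  unfolding b3_def
proof (rule sigma_finite_measure.borel_measurable_nn_integral[OF sigma_finite_Kt])
  let ?F = "\<lambda>x z w. ennreal (g x (add_pts (add_pts w k x) k z) * g z (add_pts (add_pts w k x) k z))"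
  have "(\<lambda>p. \<integral>\<^sup>+ w. ?F (fst p) (snd p) w \<partial>P) \<in> borel_measurable (tup k \<Otimes>\<^sub>M Kt k)"
  proof (rule borel_measurable_nn_integral)
    show "(\<lambda>(p, w). ?F (fst p) (snd p) w) \<in> borel_measurable ((tup k \<Otimes>\<^sub>M Kt k) \<Otimes>\<^sub>M P)"
      unfolding case_prod_unfold
      by (intro g_mult_compose add_pts_compose measurable_NX_P measurable_Kt measurable_compose[OF measurable_fst]) simp_all
  qed
  then show "(\<lambda>(x, z). hit x z * (\<integral>\<^sup>+ w. ?F x z w \<partial>P)) \<in> borel_measurable (tup k \<Otimes>\<^sub>M Kt k)"
    unfolding case_prod_unfold
    by (intro borel_measurable_times_ennreal hit_compose measurable_Kt) simp_all
qed

lemma b4_measurable: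
  assumes "I \<subseteq> {..<k}" shows "b4 I \<in> borel_measurable (tup k)"
  unfolding b4_def
proof (rule sigma_finite_measure.borel_measurable_nn_integral[OF sigma_finite_Kt])
  let ?j = "k - card I"
  let ?F = "\<lambda>x z w. ennreal (g x (add_pts (add_pts w k x) ?j z) * g (join_tup k I x z) (add_pts (add_pts w k x) ?j z))"
  have "(\<lambda>p. \<integral>\<^sup>+ w. ?F (fst p) (snd p) w \<partial>P) \<in> borel_measurable (tup k \<Otimes>\<^sub>M Kt ?j)"
  proof (rule borel_measurable_nn_integral)
    show "(\<lambda>(p, w). ?F (fst p) (snd p) w) \<in> borel_measurable ((tup k \<Otimes>\<^sub>M Kt ?j) \<Otimes>\<^sub>M P)"
      unfolding case_prod_unfold using assms
      by (intro g_mult_compose join_compose add_pts_compose measurable_NX_P measurable_Kt measurable_compose[OF measurable_fst]) simp_all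
  qed
  then show "(\<lambda>(x, z). \<integral>\<^sup>+ w. ?F x z w \<partial>P) \<in> borel_measurable (tup k \<Otimes>\<^sub>M Kt ?j)"
    by (simp only: case_prod_unfold)
qed

text \<open>Resampling has made \<open>R2\<close> independent of the factor belonging to
  \<open>x\<close>, so the Mecke formula acts on \<open>R2\<close> alone; the result contains a
  product of two expectations.\<close>

lemma R2_integral:
  assumes x: "x \<in> PiE {..<k} (\<lambda>_. UNIV)"
  shows "pr x * (\<integral>\<^sup>+ w. R2 x w \<partial>P) = e k * b2 x"
proof -
  have fm: "(\<lambda>w. fact_sum w k (\<lambda>z. hit x z * gg z w)) \<in> borel_measurable P"
    using fact_sum_measurable_NX[OF hit_gg_measurable[OF x]] by simp
  have "(\<integral>\<^sup>+ w. R2 x w \<partial>P) = e k * (\<integral>\<^sup>+ w. fact_sum w k (\<lambda>z. hit x z * gg z w) \<partial>P)"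
    unfolding R2_def by (rule nn_integral_cmult[OF fm])
  also have "(\<integral>\<^sup>+ w. fact_sum w k (\<lambda>z. hit x z * gg z w) \<partial>P) = (\<integral>\<^sup>+ z. \<integral>\<^sup>+ w. hit x z * gg z (add_pts w k z) \<partial>P \<partial>Kt k)"
    by (rule mecke[OF hit_gg_measurable[OF x]])
  also have "\<dots> = (\<integral>\<^sup>+ z. hit x z * pr z \<partial>Kt k)"
    unfolding pr_def
  proof (rule nn_integral_cong)
    fix z assume "z \<in> space (Kt k)"
    then have "(\<lambda>w. gg z (add_pts w k z)) \<in> borel_measurable P" using gg_x_measurable by (simp add: space_Kt)
    then show "(\<integral>\<^sup>+ w. hit x z * gg z (add_pts w k z) \<partial>P) = hit x z * (\<integral>\<^sup>+ w. gg z (add_pts w k z) \<partial>P)"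
      by (rule nn_integral_cmult)
  qed
  finally have "pr x * (\<integral>\<^sup>+ w. R2 x w \<partial>P) = e k * (pr x * (\<integral>\<^sup>+ z. hit x z * pr z \<partial>Kt k))"
    by (simp only: mult.left_commute)
  also have "pr x * (\<integral>\<^sup>+ z. hit x z * pr z \<partial>Kt k) = (\<integral>\<^sup>+ z. pr x * (hit x z * pr z) \<partial>Kt k)"
  proof (rule nn_integral_cmult[symmetric])
    have "(\<lambda>z. hit x z * pr z) \<in> borel_measurable (tup k)"
      by (intro borel_measurable_times_ennreal hit_compose const_tup[OF x] pr_measurable) simp
    then show "(\<lambda>z. hit x z * pr z) \<in> borel_measurable (Kt k)" by simp
  qed
  also have "\<dots> = b2 x"
    unfolding b2_def by (rule nn_integral_cong) (simp add: mult_ac)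
  finally show ?thesis .
qed

text \<open>In contrast to \<open>R2\<close>, the remainder depends on the same configuration as the
  factor of \<open>x\<close>. That factor is moved into the sum before the Mecke formula is applied,
  which produces a joint expectation with both tuples added.\<close>

lemma R3_integral:
  assumes x: "x \<in> PiE {..<k} (\<lambda>_. UNIV)"
  shows "(\<integral>\<^sup>+ w. gg x (add_pts w k x) * R3 x w \<partial>P) = e k * b3 x"
proof -
  let ?H = "\<lambda>w z. gg x (add_pts w k x) * (hit x z * gg z (add_pts w k x))"
  have Hm: "(\<lambda>(w, z). ?H w z) \<in> borel_measurable (NX \<Otimes>\<^sub>M tup k)"
    unfolding case_prod_unfold
    by (intro borel_measurable_times_ennreal hit_compose const_tup[OF x] gg_compose add_x[OF x]) simp_all
  have fm: "(\<lambda>w. fact_sum w k (?H w)) \<in> borel_measurable P"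
    using fact_sum_measurable_NX[OF Hm] by simp
  have "(\<integral>\<^sup>+ w. gg x (add_pts w k x) * R3 x w \<partial>P) = (\<integral>\<^sup>+ w. e k * fact_sum w k (?H w) \<partial>P)"
    unfolding R3_def fact_sum_cmult by (simp only: mult.left_commute)
  also have "\<dots> = e k * (\<integral>\<^sup>+ w. fact_sum w k (?H w) \<partial>P)" by (rule nn_integral_cmult[OF fm])
  also have "(\<integral>\<^sup>+ w. fact_sum w k (?H w) \<partial>P) = (\<integral>\<^sup>+ z. \<integral>\<^sup>+ w. ?H (add_pts w k z) z \<partial>P \<partial>Kt k)"
    by (rule mecke[OF Hm])
  also have "\<dots> = b3 x"
    unfolding b3_def
  proof (rule nn_integral_cong)
    fix z assume "z \<in> space (Kt k)"
    then have z: "z \<in> PiE {..<k} (\<lambda>_. UNIV)" by (simp add: space_Kt)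
    have "(\<lambda>w. ennreal (g x (add_pts (add_pts w k x) k z) * g z (add_pts (add_pts w k x) k z))) \<in> borel_measurable P"
      by (intro g_mult_compose const_tup x z add_x measurable_NX_P) simp
    from nn_integral_cmult[OF this, of "hit x z"]
    show "(\<integral>\<^sup>+ w. ?H (add_pts w k z) z \<partial>P) = hit x z * (\<integral>\<^sup>+ w. ennreal (g x (add_pts (add_pts w k x) k z) * g z (add_pts (add_pts w k x) k z)) \<partial>P)"
      by (simp only: g_mult mult.left_commute add_pts_commute[of _ k z])
  qed
  finally show ?thesis .
qed

lemma R4_integral:
  assumes x: "x \<in> PiE {..<k} (\<lambda>_. UNIV)"
  shows "(\<integral>\<^sup>+ w. gg x (add_pts w k x) * R4 x w \<partial>P) = (\<Sum>I\<in>sub. e (k - card I) * b4 I x)"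
proof -
  let ?H = "\<lambda>I w z. gg x (add_pts w k x) * gg (join_tup k I x z) (add_pts w k x)"
  have Hm: "(\<lambda>(w, z). ?H I w z) \<in> borel_measurable (NX \<Otimes>\<^sub>M tup (k - card I))" if "I \<in> sub" for I
    unfolding case_prod_unfold using that
    by (intro borel_measurable_times_ennreal const_tup[OF x] gg_compose join_compose add_x[OF x]) simp_all
  have fm: "(\<lambda>w. fact_sum w (k - card I) (?H I w)) \<in> borel_measurable P" if "I \<in> sub" for I
    using fact_sum_measurable_NX[OF Hm[OF that]] by simp
  have "(\<integral>\<^sup>+ w. gg x (add_pts w k x) * R4 x w \<partial>P) = (\<integral>\<^sup>+ w. (\<Sum>I\<in>sub. e (k - card I) * fact_sum w (k - card I) (?H I w)) \<partial>P)"
    unfolding R4_def fact_sum_cmult sum_distrib_left by (simp only: mult.left_commute)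
  also have "\<dots> = (\<Sum>I\<in>sub. \<integral>\<^sup>+ w. e (k - card I) * fact_sum w (k - card I) (?H I w) \<partial>P)"
    by (rule nn_integral_sum) (intro borel_measurable_times_ennreal borel_measurable_const fm)
  also have "\<dots> = (\<Sum>I\<in>sub. e (k - card I) * b4 I x)"
  proof (rule sum.cong[OF refl])
    fix I assume I: "I \<in> sub"
    have "(\<integral>\<^sup>+ w. e (k - card I) * fact_sum w (k - card I) (?H I w) \<partial>P) = e (k - card I) * (\<integral>\<^sup>+ w. fact_sum w (k - card I) (?H I w) \<partial>P)"
      by (rule nn_integral_cmult[OF fm[OF I]])
    also have "(\<integral>\<^sup>+ w. fact_sum w (k - card I) (?H I w) \<partial>P) = (\<integral>\<^sup>+ z. \<integral>\<^sup>+ w. ?H I (add_pts w (k - card I) z) z \<partial>P \<partial>Kt (k - card I))"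
      by (rule mecke[OF Hm[OF I]])
    also have "\<dots> = b4 I x"
      unfolding b4_def by (simp only: g_mult add_pts_commute[of _ "k - card I" _ k x])
    finally show "(\<integral>\<^sup>+ w. e (k - card I) * fact_sum w (k - card I) (?H I w) \<partial>P) = e (k - card I) * b4 I x" .
  qed
  finally show ?thesis .
qed

definition b :: "(nat \<Rightarrow> 'x) \<Rightarrow> ennreal" where
  "b x = e k * b2 x + (e k * b3 x + (\<Sum>I\<in>sub. e (k - card I) * b4 I x))"

text \<open>The pointwise estimate is integrated over the configuration and its independent copy. By
  \<open>resample\<close>, the term at the mixed configuration becomes \<open>pr x * EH\<close> and
  the term with \<open>R2\<close> also factorises; the other terms do not involve the copy.\<close>

lemma integrated_comparison:
  fixes c :: real
  assumes c: "c > 0" and lip: "\<And>m n. \<bar>h (Suc m) - h (Suc n)\<bar> \<le> c * \<bar>real m - real n\<bar>"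
    and x: "x \<in> PiE {..<k} (\<lambda>_. UNIV)"
  defines "J \<equiv> (\<integral>\<^sup>+ w. gg x (add_pts w k x) * eval_count h (W (add_pts w k x)) \<partial>P)"
    and "EH \<equiv> (\<integral>\<^sup>+ w. eval_count h (W w + 1) \<partial>P)"
  shows "pr x * EH \<le> J + ennreal c * b x" and "J \<le> pr x * EH + ennreal c * b x"
proof -
  let ?G = "\<lambda>w. gg x (add_pts w k x)"
  let ?m = "\<lambda>w w'. mix (S x) w' w"
  let ?A = "\<lambda>w w'. ?G w * eval_count h (W (?m w w') + 1)"
  let ?B = "\<lambda>w. ?G w * eval_count h (W (add_pts w k x))"
  let ?C = "\<lambda>w w'. ?G w * R2 x (?m w w')"
  let ?D = "\<lambda>w. ?G w * R3 x w + ?G w * R4 x w"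
  note [measurable] = gg_x_measurable[OF x] R2_measurable[OF x] R3_measurable[OF x] R4_measurable[OF x]
  have Sx: "S x \<in> sets borel" by (rule S_borel[OF x])
  have add_m[measurable]: "(\<lambda>w. add_pts w k x) \<in> NX \<rightarrow>\<^sub>M NX" by (rule add_x[OF x]) simp
  have EH_m[measurable]: "(\<lambda>w. eval_count h (W w + 1)) \<in> borel_measurable NX" by measurable
  have inv: "?G (mix (S x) w w') = ?G w" if "lf_count w" "lf_count w'" for w w'
    by (simp only: g_mix[OF x that])
  have A_int: "(\<integral>\<^sup>+ w. \<integral>\<^sup>+ w'. ?A w w' \<partial>P \<partial>P) = pr x * EH"
    unfolding pr_def EH_def by (rule resample[OF Sx gg_x_measurable[OF x] EH_m inv])
  have C_int: "(\<integral>\<^sup>+ w. \<integral>\<^sup>+ w'. ?C w w' \<partial>P \<partial>P) = e k * b2 x"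
    unfolding R2_integral[OF x, symmetric] pr_def
    by (rule resample[OF Sx gg_x_measurable[OF x] R2_measurable[OF x] inv])
  have D_int: "(\<integral>\<^sup>+ w. ?D w \<partial>P) = e k * b3 x + (\<Sum>I\<in>sub. e (k - card I) * b4 I x)"
    by (subst nn_integral_add) (simp_all add: R3_integral[OF x] R4_integral[OF x])
  have mix_m: "(\<lambda>p. ?m (fst p) (snd p)) \<in> NX \<Otimes>\<^sub>M P \<rightarrow>\<^sub>M NX"
    by (intro measurable_mix Sx measurable_NX_P) simp_all
  have mix_m': "?m w \<in> P \<rightarrow>\<^sub>M NX" if "w \<in> space P" for w
    using that by (intro measurable_mix Sx measurable_NX_P measurable_const) (simp_all add: space_NX)
  have inner: "(\<lambda>w. \<integral>\<^sup>+ w'. ?G w * \<Psi> (?m w w') \<partial>P) \<in> borel_measurable P" if \<Psi>: "\<Psi> \<in> borel_measurable NX" for \<Psi>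
  proof -
    have "(\<lambda>p. ?G (fst p) * \<Psi> (?m (fst p) (snd p))) \<in> borel_measurable (NX \<Otimes>\<^sub>M P)"
      by (intro borel_measurable_times_ennreal measurable_compose[OF mix_m \<Psi>] measurable_compose[OF measurable_fst gg_x_measurable[OF x]])
    then have "(\<lambda>w. \<integral>\<^sup>+ w'. ?G w * \<Psi> (?m w w') \<partial>P) \<in> borel_measurable NX"
      by (intro borel_measurable_nn_integral) (simp add: case_prod_unfold)
    then show ?thesis by simp
  qed
  have J: "J = (\<integral>\<^sup>+ w. ?B w \<partial>P)" by (simp add: J_def)
  have err: "(\<integral>\<^sup>+ w. \<integral>\<^sup>+ w'. U w w' + ennreal c * (?C w w' + ?D w) \<partial>P \<partial>P)
      = (\<integral>\<^sup>+ w. \<integral>\<^sup>+ w'. U w w' \<partial>P \<partial>P) + ennreal c * b x"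
    if U: "\<And>w. w \<in> space P \<Longrightarrow> U w \<in> borel_measurable P" "(\<lambda>w. \<integral>\<^sup>+ w'. U w w' \<partial>P) \<in> borel_measurable P" for U
  proof -
    define CI where "CI w = (\<integral>\<^sup>+ w'. ?C w w' \<partial>P)" for w
    define UI where "UI w = (\<integral>\<^sup>+ w'. U w w' \<partial>P)" for w
    have [measurable]: "CI \<in> borel_measurable P" "UI \<in> borel_measurable P"
      unfolding CI_def UI_def by (rule inner[OF R2_measurable[OF x]], rule U(2))
    have "(\<integral>\<^sup>+ w'. U w w' + ennreal c * (?C w w' + ?D w) \<partial>P) = (\<integral>\<^sup>+ w'. U w w' \<partial>P) + ennreal c * ((\<integral>\<^sup>+ w'. ?C w w' \<partial>P) + ?D w)"
      if w: "w \<in> space P" for w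
    proof -
      have [measurable]: "?C w \<in> borel_measurable P" "U w \<in> borel_measurable P"
        by (intro borel_measurable_times_ennreal borel_measurable_const measurable_compose[OF mix_m'[OF w] R2_measurable[OF x]])
           (rule U(1)[OF w])
      show ?thesis by (simp add: nn_integral_add nn_integral_cmult[of "\<lambda>w'. ?C w w' + ?D w"] emeasure_space_1[simplified])
    qed
    then have "(\<integral>\<^sup>+ w. \<integral>\<^sup>+ w'. U w w' + ennreal c * (?C w w' + ?D w) \<partial>P \<partial>P)
        = (\<integral>\<^sup>+ w. (\<integral>\<^sup>+ w'. U w w' \<partial>P) + ennreal c * ((\<integral>\<^sup>+ w'. ?C w w' \<partial>P) + ?D w) \<partial>P)"
      by (rule nn_integral_cong)
    also have "\<dots> = (\<integral>\<^sup>+ w. UI w \<partial>P) + ennreal c * ((\<integral>\<^sup>+ w. CI w \<partial>P) + (\<integral>\<^sup>+ w. ?D w \<partial>P))"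
      by (simp add: UI_def[symmetric] CI_def[symmetric] nn_integral_add nn_integral_cmult[of "\<lambda>w. CI w + ?D w"])
    finally show ?thesis unfolding UI_def CI_def C_int D_int b_def .
  qed
  have BB: "(\<integral>\<^sup>+ w. \<integral>\<^sup>+ w'. ?B w \<partial>P \<partial>P) = J" unfolding J by (simp add: emeasure_space_1[simplified])
  have "pr x * EH \<le> (\<integral>\<^sup>+ w. \<integral>\<^sup>+ w'. ?B w + ennreal c * (?C w w' + ?D w) \<partial>P \<partial>P)"
    unfolding A_int[symmetric]
    by (intro nn_integral_mono pointwise_comparison(1)[OF c lip x]) simp_all
  also have "\<dots> = (\<integral>\<^sup>+ w. \<integral>\<^sup>+ w'. ?B w \<partial>P \<partial>P) + ennreal c * b x"
    by (rule err) (simp_all add: emeasure_space_1[simplified])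
  finally show "pr x * EH \<le> J + ennreal c * b x" unfolding BB .
  have "J \<le> (\<integral>\<^sup>+ w. \<integral>\<^sup>+ w'. ?A w w' + ennreal c * (?C w w' + ?D w) \<partial>P \<partial>P)"
    unfolding BB[symmetric]
    by (intro nn_integral_mono pointwise_comparison(2)[OF c lip x]) simp_all
  also have "\<dots> = (\<integral>\<^sup>+ w. \<integral>\<^sup>+ w'. ?A w w' \<partial>P \<partial>P) + ennreal c * b x"
  proof (rule err)
    fix w assume w: "w \<in> space P"
    show "?A w \<in> borel_measurable P"
      by (intro borel_measurable_times_ennreal borel_measurable_const measurable_compose[OF mix_m'[OF w] EH_m])
  qed (rule inner[OF EH_m])
  finally show "J \<le> pr x * EH + ennreal c * b x" unfolding A_int .
qed

text \<open>With \<open>u = 1\<close> this computes the mean of \<open>W\<close>, with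
  \<open>u = eval_count h\<close> the mean of \<open>W * h(W)\<close>. In the latter the function is
  evaluated after \<open>x\<close> has been added.\<close>

lemma fact_sum_gg_mecke:
  assumes u: "u \<in> borel_measurable borel"
  shows "(\<integral>\<^sup>+ w. W w * u (W w) \<partial>P) = e k * (\<integral>\<^sup>+ x. \<integral>\<^sup>+ w. gg x (add_pts w k x) * u (W (add_pts w k x)) \<partial>P \<partial>Kt k)"
proof -
  let ?H = "\<lambda>w x. u (W w) * gg x w"
  have Hm: "(\<lambda>(w, x). ?H w x) \<in> borel_measurable (NX \<Otimes>\<^sub>M tup k)"
    unfolding case_prod_unfold
    by (intro borel_measurable_times_ennreal gg_compose measurable_compose[OF measurable_fst measurable_compose[OF W_measurable u]]) simp_all
  have fm: "(\<lambda>w. fact_sum w k (?H w)) \<in> borel_measurable P"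
    using fact_sum_measurable_NX[OF Hm] by simp
  have "W w * u (W w) = e k * fact_sum w k (?H w)" for w
    unfolding fact_sum_cmult by (simp add: W_def mult_ac)
  then have "(\<integral>\<^sup>+ w. W w * u (W w) \<partial>P) = e k * (\<integral>\<^sup>+ w. fact_sum w k (?H w) \<partial>P)"
    by (simp only: nn_integral_cmult[OF fm])
  also have "(\<integral>\<^sup>+ w. fact_sum w k (?H w) \<partial>P) = (\<integral>\<^sup>+ x. \<integral>\<^sup>+ w. ?H (add_pts w k x) x \<partial>P \<partial>Kt k)"
    by (rule mecke[OF Hm])
  finally show ?thesis by (simp only: mult.commute)
qed

text \<open>One half of the sum of \<open>E2\<close>, \<open>E3\<close> and \<open>E4\<close>; the
  factor 2 in each of them balances the factor 1/2 in the bound.\<close>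

definition err :: ennreal where
  "err = e k * (\<integral>\<^sup>+ x. b x \<partial>Kt k)"

theorem stein_comparison:
  fixes c :: real
  assumes c: "c > 0" and lip: "\<And>m n. \<bar>h (Suc m) - h (Suc n)\<bar> \<le> c * \<bar>real m - real n\<bar>"
  defines "EW \<equiv> (\<integral>\<^sup>+ w. W w \<partial>P)" and "EWH \<equiv> (\<integral>\<^sup>+ w. W w * eval_count h (W w) \<partial>P)"
    and "EH \<equiv> (\<integral>\<^sup>+ w. eval_count h (W w + 1) \<partial>P)"
  shows "EW * EH \<le> EWH + ennreal c * err" and "EWH \<le> EW * EH + ennreal c * err"
proof -
  let ?J = "\<lambda>x. \<integral>\<^sup>+ w. gg x (add_pts w k x) * eval_count h (W (add_pts w k x)) \<partial>P"
  have EW: "EW = e k * (\<integral>\<^sup>+ x. pr x \<partial>Kt k)"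
    using fact_sum_gg_mecke[of "\<lambda>_. 1"] by (simp add: EW_def pr_def)
  have EWH: "EWH = e k * (\<integral>\<^sup>+ x. ?J x \<partial>Kt k)"
    unfolding EWH_def by (rule fact_sum_gg_mecke) simp
  have pr_m: "pr \<in> borel_measurable (Kt k)" by simp
  have J_m: "?J \<in> borel_measurable (Kt k)"
  proof -
    have "?J \<in> borel_measurable (tup k)"
    proof (rule borel_measurable_nn_integral)
      show "(\<lambda>(x, w). gg x (add_pts w k x) * eval_count h (W (add_pts w k x))) \<in> borel_measurable (tup k \<Otimes>\<^sub>M P)"
        unfolding case_prod_unfold
        by (intro borel_measurable_times_ennreal gg_compose add_pts_compose measurable_NX_P
            measurable_compose[OF _ measurable_compose[OF W_measurable borel_measurable_eval_count]]) simp_all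
    qed
    then show ?thesis by simp
  qed
  have b_m: "b \<in> borel_measurable (Kt k)"
  proof -
    have "b \<in> borel_measurable (tup k)"
      unfolding b_def
      by (intro borel_measurable_add borel_measurable_sum borel_measurable_times_ennreal borel_measurable_const
          b2_measurable b3_measurable b4_measurable) auto
    then show ?thesis by simp
  qed
  have cb_m: "(\<lambda>x. ennreal c * b x) \<in> borel_measurable (Kt k)" using b_m by simp
  have prE_m: "(\<lambda>x. pr x * EH) \<in> borel_measurable (Kt k)" using pr_m by simp
  have prE: "(\<integral>\<^sup>+ x. pr x * EH \<partial>Kt k) = (\<integral>\<^sup>+ x. pr x \<partial>Kt k) * EH" by (rule nn_integral_multc[OF pr_m])
  have cb: "(\<integral>\<^sup>+ x. ennreal c * b x \<partial>Kt k) = ennreal c * (\<integral>\<^sup>+ x. b x \<partial>Kt k)" by (rule nn_integral_cmult[OF b_m])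
  have "(\<integral>\<^sup>+ x. pr x * EH \<partial>Kt k) \<le> (\<integral>\<^sup>+ x. ?J x + ennreal c * b x \<partial>Kt k)"
    unfolding EH_def by (intro nn_integral_mono integrated_comparison(1)[OF c lip]) (simp add: space_Kt)
  also have "\<dots> = (\<integral>\<^sup>+ x. ?J x \<partial>Kt k) + ennreal c * (\<integral>\<^sup>+ x. b x \<partial>Kt k)"
    unfolding cb[symmetric] by (rule nn_integral_add[OF J_m cb_m])
  finally have "e k * ((\<integral>\<^sup>+ x. pr x \<partial>Kt k) * EH) \<le> e k * ((\<integral>\<^sup>+ x. ?J x \<partial>Kt k) + ennreal c * (\<integral>\<^sup>+ x. b x \<partial>Kt k))"
    unfolding prE by (rule mult_left_mono) simp
  then show "EW * EH \<le> EWH + ennreal c * err"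
    unfolding EW EWH err_def by (simp only: distrib_left mult.assoc mult.left_commute[of "ennreal c"])
  have "(\<integral>\<^sup>+ x. ?J x \<partial>Kt k) \<le> (\<integral>\<^sup>+ x. pr x * EH + ennreal c * b x \<partial>Kt k)"
    unfolding EH_def by (intro nn_integral_mono integrated_comparison(2)[OF c lip]) (simp add: space_Kt)
  also have "\<dots> = (\<integral>\<^sup>+ x. pr x \<partial>Kt k) * EH + ennreal c * (\<integral>\<^sup>+ x. b x \<partial>Kt k)"
    unfolding cb[symmetric] prE[symmetric] by (rule nn_integral_add[OF prE_m cb_m])
  finally have "e k * (\<integral>\<^sup>+ x. ?J x \<partial>Kt k) \<le> e k * ((\<integral>\<^sup>+ x. pr x \<partial>Kt k) * EH + ennreal c * (\<integral>\<^sup>+ x. b x \<partial>Kt k))"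
    by (rule mult_left_mono) simp
  then show "EWH \<le> EW * EH + ennreal c * err"
    unfolding EW EWH err_def by (simp only: distrib_left mult.assoc mult.left_commute[of "ennreal c"])
qed

end

section \<open>Poisson approximation\<close>

lemma lipschitz_from_increments:
  fixes h :: "nat \<Rightarrow> real"
  assumes "\<And>j. \<bar>h (Suc j) - h j\<bar> \<le> c"
  shows "\<bar>h m - h n\<bar> \<le> c * \<bar>real m - real n\<bar>"
proof -
  have *: "\<bar>h (n + d) - h n\<bar> \<le> c * real d" for n d
  proof (induction d)
    case (Suc d)
    have "\<bar>h (n + Suc d) - h n\<bar> \<le> \<bar>h (Suc (n + d)) - h (n + d)\<bar> + \<bar>h (n + d) - h n\<bar>" by simp
    also have "\<dots> \<le> c + c * real d" using assms[of "n + d"] Suc by (intro add_mono)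
    finally show ?case by (simp add: algebra_simps)
  qed simp
  show ?thesis
  proof (cases "n \<le> m")
    case True
    then show ?thesis using *[of n "m - n"] by (simp add: of_nat_diff)
  next
    case False
    then show ?thesis using *[of m "n - m"] by (simp add: of_nat_diff abs_minus_commute)
  qed
qed

text \<open>The passage from \<open>ennreal\<close> comparisons to real expectations. The premise is
  used for one function per set \<open>A\<close>, a shifted Stein solution, and the bound it gives
  does not depend on \<open>A\<close>.\<close>

lemma (in prob_space) dTV_poisson_le:
  fixes w :: "'a \<Rightarrow> ennreal" and a :: real and err :: ennreal
  assumes a: "a > 0"
    and w[measurable]: "w \<in> borel_measurable M"
    and w_nat: "\<And>\<omega>. w \<omega> = \<infinity> \<or> (\<exists>n::nat. w \<omega> = of_nat n)"
    and fin: "(\<integral>\<^sup>+ \<omega>. w \<omega> \<partial>M) < \<infinity>"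
    and comparison: "\<And>h. (\<And>m n. \<bar>h (Suc m) - h (Suc n)\<bar> \<le> min 1 (1 / a) * \<bar>real m - real n\<bar>) \<Longrightarrow>
      (\<integral>\<^sup>+ \<omega>. w \<omega> \<partial>M) * (\<integral>\<^sup>+ \<omega>. eval_count h (w \<omega> + 1) \<partial>M)
        \<le> (\<integral>\<^sup>+ \<omega>. w \<omega> * eval_count h (w \<omega>) \<partial>M) + ennreal (min 1 (1 / a)) * err \<and>
      (\<integral>\<^sup>+ \<omega>. w \<omega> * eval_count h (w \<omega>) \<partial>M)
        \<le> (\<integral>\<^sup>+ \<omega>. w \<omega> \<partial>M) * (\<integral>\<^sup>+ \<omega>. eval_count h (w \<omega> + 1) \<partial>M) + ennreal (min 1 (1 / a)) * err"
  shows "ennreal (dTV M w (poisson_pmf a))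
    \<le> ennreal (min 1 (1 / sqrt a) * \<bar>enn2real (\<integral>\<^sup>+ \<omega>. w \<omega> \<partial>M) - a\<bar>) + ennreal (min 1 (1 / a)) * err"
proof (cases "err = \<infinity>")
  case True
  have "ennreal (min 1 (1 / a)) \<noteq> 0" using a by (simp add: ennreal_eq_0_iff min_le_iff_disj)
  then have "ennreal (min 1 (1 / a)) * err = \<infinity>" unfolding True by (simp add: ennreal_mult_eq_top_iff)
  then show ?thesis by simp
next
  case False
  define c where "c = min 1 (1 / a)"
  define B where "B = min 1 (1 / sqrt a)"
  define r where "r = enn2real err"
  define lam where "lam = enn2real (\<integral>\<^sup>+ \<omega>. w \<omega> \<partial>M)"
  have c0: "c > 0" and B0: "B > 0" and r0: "r \<ge> 0" and lam0: "lam \<ge> 0" using a by (auto simp: c_def B_def r_def lam_def)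
  have err: "err = ennreal r" using False by (simp add: r_def less_top)
  have lam: "(\<integral>\<^sup>+ \<omega>. w \<omega> \<partial>M) = ennreal lam" using fin by (simp add: lam_def)
  \<comment> \<open>The mean is finite, so \<open>w\<close> is almost surely finite and agrees with
    the natural-number variable \<open>N\<close>. All real integrals are taken of functions of
    \<open>N\<close>.\<close>
  define N where "N \<omega> = nat \<lfloor>enn2real (w \<omega>)\<rfloor>" for \<omega>
  have N_meas[measurable]: "N \<in> M \<rightarrow>\<^sub>M count_space UNIV" unfolding N_def by measurable
  have "AE \<omega> in M. w \<omega> \<noteq> \<infinity>" using fin by (intro nn_integral_PInf_AE) auto
  then have wN: "AE \<omega> in M. w \<omega> = of_nat (N \<omega>)"
  proof eventually_elim
    case (elim \<omega>)
    then obtain n :: nat where "w \<omega> = of_nat n" using w_nat by blast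
    then show ?case by (simp add: N_def enn2real_of_nat)
  qed
  have fN[measurable]: "(\<lambda>\<omega>. u (N \<omega>)) \<in> borel_measurable M" for u :: "nat \<Rightarrow> real"
    by (rule measurable_compose[OF N_meas]) simp
  have N_nn: "(\<integral>\<^sup>+ \<omega>. ennreal (real (N \<omega>)) \<partial>M) = ennreal lam"
    unfolding lam[symmetric] using wN by (intro nn_integral_cong_AE) (auto simp: ennreal_of_nat_eq_real_of_nat)
  have N_int: "integrable M (\<lambda>\<omega>. real (N \<omega>))"
    by (rule integrableI_nn_integral_finite[OF _ _ N_nn]) simp_all
  have N_eq: "(\<integral>\<omega>. real (N \<omega>) \<partial>M) = lam"
    by (rule integral_eq_nn_integral[THEN trans]) (simp_all add: N_nn lam0)
  have main: "\<bar>measure M {\<omega> \<in> space M. w \<omega> \<in> of_nat ` A} - measure_pmf.prob (poisson_pmf a) A\<bar> \<le> B * \<bar>lam - a\<bar> + c * r" for A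
  proof -
    obtain h :: "nat \<Rightarrow> real" where
      h_eq: "\<And>j. a * h (Suc j) - real j * h j = indicator A j - measure_pmf.prob (poisson_pmf a) A"
      and h_le: "\<And>j. \<bar>h (Suc j)\<bar> \<le> B"
      and h_inc: "\<And>j. \<bar>h (Suc (Suc j)) - h (Suc j)\<bar> \<le> c"
      using stein_chen_solution[OF a, of A] unfolding B_def c_def by metis
    \<comment> \<open>Adding the bound \<open>B\<close> places the values at positive arguments in
      \<open>[0, 2 * B]\<close> without changing increments between them. The value at 0 is reset to
      0: it is multiplied by 0 in the Stein equation, and the Lipschitz condition compares positive
      arguments only.\<close>
    define h' where "h' j = (if j = 0 then 0 else h j + B)" for j
    have h'_Suc: "h' (Suc j) = h (Suc j) + B" for j by (simp add: h'_def)
    have h'_nn: "h' j \<ge> 0" for j using h_le[of "j - 1"] by (cases j) (auto simp: h'_def abs_le_iff)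
    have h'_le: "h' j \<le> 2 * B" for j using h_le[of "j - 1"] B0 by (cases j) (auto simp: h'_def abs_le_iff)
    have lip: "\<bar>h' (Suc m) - h' (Suc n)\<bar> \<le> c * \<bar>real m - real n\<bar>" for m n
      using lipschitz_from_increments[of "\<lambda>j. h (Suc j)" c, OF h_inc] by (simp add: h'_Suc)
    have int1: "integrable M (\<lambda>\<omega>. h' (Suc (N \<omega>)))"
      by (rule integrable_const_bound[where B = "2 * B"]) (use h'_nn h'_le in auto)
    have int2: "integrable M (\<lambda>\<omega>. real (N \<omega>) * h' (N \<omega>))"
    proof (rule Bochner_Integration.integrable_bound)
      show "integrable M (\<lambda>\<omega>. real (N \<omega>) * (2 * B))" using N_int by simp
      show "AE \<omega> in M. norm (real (N \<omega>) * h' (N \<omega>)) \<le> norm (real (N \<omega>) * (2 * B))"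
        using h'_nn h'_le B0 by (intro AE_I2) (simp add: abs_mult mult_left_mono)
    qed (use fN[of "\<lambda>n. real n * h' n"] in simp)
    define E1 where "E1 = (\<integral>\<omega>. h' (Suc (N \<omega>)) \<partial>M)"
    define E2 where "E2 = (\<integral>\<omega>. real (N \<omega>) * h' (N \<omega>) \<partial>M)"
    have E0: "E1 \<ge> 0" "E2 \<ge> 0" unfolding E1_def E2_def using h'_nn by (intro integral_nonneg_AE AE_I2; simp)+
    have "(\<integral>\<^sup>+ \<omega>. eval_count h' (w \<omega> + 1) \<partial>M) = (\<integral>\<^sup>+ \<omega>. ennreal (h' (Suc (N \<omega>))) \<partial>M)"
    proof (rule nn_integral_cong_AE)
      show "AE \<omega> in M. eval_count h' (w \<omega> + 1) = ennreal (h' (Suc (N \<omega>)))"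
        using wN
      proof eventually_elim
        case (elim \<omega>)
        then have "w \<omega> + 1 = of_nat (Suc (N \<omega>))" by simp
        then show ?case by (simp only: eval_count_of_nat)
      qed
    qed
    also have "\<dots> = ennreal E1" unfolding E1_def using int1 h'_nn by (intro nn_integral_eq_integral) auto
    finally have EH: "(\<integral>\<^sup>+ \<omega>. eval_count h' (w \<omega> + 1) \<partial>M) = ennreal E1" .
    have "(\<integral>\<^sup>+ \<omega>. w \<omega> * eval_count h' (w \<omega>) \<partial>M) = (\<integral>\<^sup>+ \<omega>. ennreal (real (N \<omega>) * h' (N \<omega>)) \<partial>M)"
    proof (rule nn_integral_cong_AE)
      show "AE \<omega> in M. w \<omega> * eval_count h' (w \<omega>) = ennreal (real (N \<omega>) * h' (N \<omega>))"
        using wN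
      proof eventually_elim
        case (elim \<omega>)
        then have "w \<omega> * eval_count h' (w \<omega>) = of_nat (N \<omega>) * ennreal (h' (N \<omega>))" by (simp only: eval_count_of_nat)
        then show ?case by (simp add: ennreal_of_nat_eq_real_of_nat ennreal_mult h'_nn)
      qed
    qed
    also have "\<dots> = ennreal E2" unfolding E2_def using int2 h'_nn by (intro nn_integral_eq_integral) auto
    finally have EWH: "(\<integral>\<^sup>+ \<omega>. w \<omega> * eval_count h' (w \<omega>) \<partial>M) = ennreal E2" .
    have "ennreal lam * ennreal E1 \<le> ennreal E2 + ennreal c * ennreal r"
      "ennreal E2 \<le> ennreal lam * ennreal E1 + ennreal c * ennreal r"
      using comparison[OF lip[unfolded c_def]] unfolding EH EWH lam err c_def by simp_all
    then have "ennreal (lam * E1) \<le> ennreal (E2 + c * r)" "ennreal E2 \<le> ennreal (lam * E1 + c * r)"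
      using c0 r0 E0 lam0 by (simp_all add: ennreal_mult ennreal_plus)
    moreover have "0 \<le> E2 + c * r" "0 \<le> lam * E1 + c * r" using c0 r0 E0 lam0 by simp_all
    ultimately have cmp: "lam * E1 \<le> E2 + c * r" "E2 \<le> lam * E1 + c * r" by (simp_all only: ennreal_le_iff)
    have "measure M {\<omega> \<in> space M. w \<omega> \<in> of_nat ` A} = measure M {\<omega> \<in> space M. N \<omega> \<in> A}"
    proof (rule measure_eq_AE)
      show "AE \<omega> in M. \<omega> \<in> {\<omega> \<in> space M. w \<omega> \<in> of_nat ` A} \<longleftrightarrow> \<omega> \<in> {\<omega> \<in> space M. N \<omega> \<in> A}"
        using wN
      proof eventually_elim
        case (elim \<omega>)
        have "(of_nat (N \<omega>) :: ennreal) \<in> of_nat ` A \<longleftrightarrow> N \<omega> \<in> A"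
          by (rule inj_image_mem_iff) (simp add: inj_def)
        then show ?case by (simp only: mem_Collect_eq elim)
      qed
      have "(of_nat ` A :: ennreal set) \<in> sets borel"
        by (rule sets.countable[OF _ countable_image[OF countableI_type]]) simp
      from measurable_sets[OF w this]
      show "{\<omega> \<in> space M. w \<omega> \<in> of_nat ` A} \<in> sets M" by (simp add: vimage_def Int_def conj_commute)
      have "N -` A \<inter> space M \<in> sets M" by (rule measurable_sets[OF N_meas]) simp
      then show "{\<omega> \<in> space M. N \<omega> \<in> A} \<in> sets M" by (simp add: vimage_def Int_def conj_commute)
    qed
    also have "\<dots> = (\<integral>\<omega>. indicator A (N \<omega>) \<partial>M)"
    proof -
      have "(\<integral>\<omega>. indicator A (N \<omega>) \<partial>M) = (\<integral>\<omega>. indicator {\<omega> \<in> space M. N \<omega> \<in> A} \<omega> \<partial>M :: real)"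
        by (intro Bochner_Integration.integral_cong) (auto simp: indicator_def)
      then show ?thesis by (simp add: Collect_conj_eq Int_absorb1)
    qed
    finally have pA: "measure M {\<omega> \<in> space M. w \<omega> \<in> of_nat ` A} = (\<integral>\<omega>. indicator A (N \<omega>) \<partial>M)" .
    \<comment> \<open>The Stein equation for \<open>h\<close> rewritten for \<open>h'\<close>: the
      shift contributes \<open>a * B\<close> in the first term and \<open>n * B\<close> in the
      second, which also holds at \<open>n = 0\<close>.\<close>
    have ptw: "indicator A n = measure_pmf.prob (poisson_pmf a) A + a * (h' (Suc n) - B) - (real n * h' n - B * real n)" for n
      using h_eq[of n] by (cases n) (simp_all add: h'_def algebra_simps)
    have "(\<integral>\<omega>. indicator A (N \<omega>) \<partial>M) = measure_pmf.prob (poisson_pmf a) A + a * (E1 - B) - (E2 - B * lam)"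
      unfolding ptw E1_def E2_def N_eq[symmetric] using int1 int2 N_int
      by (simp add: prob_space)
    \<comment> \<open>Subtracting and adding \<open>lam * (E1 - B)\<close> separates the wrong mean
      from the failure of the Poisson identity. Since \<open>E1 - B\<close> is the mean of the
      unshifted solution at \<open>N + 1\<close>, its size is at most \<open>B\<close>.\<close>
    then have "measure M {\<omega> \<in> space M. w \<omega> \<in> of_nat ` A} - measure_pmf.prob (poisson_pmf a) A = (a - lam) * (E1 - B) + (lam * E1 - E2)"
      unfolding pA by (simp add: algebra_simps)
    moreover have "\<bar>(a - lam) * (E1 - B)\<bar> \<le> B * \<bar>lam - a\<bar>"
    proof -
      have "E1 \<le> (\<integral>\<omega>. 2 * B \<partial>M)" unfolding E1_def using int1 h'_le by (intro integral_mono) auto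
      then have "\<bar>E1 - B\<bar> \<le> B" using E0 by (simp add: prob_space abs_le_iff)
      then have "\<bar>a - lam\<bar> * \<bar>E1 - B\<bar> \<le> \<bar>a - lam\<bar> * B" by (intro mult_left_mono) auto
      then show ?thesis by (simp add: abs_mult abs_minus_commute mult.commute)
    qed
    moreover have "\<bar>lam * E1 - E2\<bar> \<le> c * r" using cmp by (simp add: abs_le_iff)
    ultimately show ?thesis by linarith
  qed
  have "dTV M w (poisson_pmf a) \<le> B * \<bar>lam - a\<bar> + c * r"
    unfolding dTV_def by (rule cSUP_least) (use main in auto)
  then have "ennreal (dTV M w (poisson_pmf a)) \<le> ennreal (B * \<bar>lam - a\<bar> + c * r)" by (rule ennreal_leI)
  also have "\<dots> = ennreal (B * \<bar>lam - a\<bar>) + ennreal c * err"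
    using B0 c0 r0 by (simp add: err ennreal_plus ennreal_mult)
  finally show ?thesis unfolding B_def c_def lam_def .
qed

section \<open>Identification of the error terms and the final bound\<close>

context stabilizing_functional begin

lemma twice_err:
  "2 * err = ennreal (2 / (fact k)\<^sup>2) * (\<integral>\<^sup>+ x. b2 x \<partial>Kt k) + ennreal (2 / (fact k)\<^sup>2) * (\<integral>\<^sup>+ x. b3 x \<partial>Kt k)
    + ennreal (2 / fact k) * (\<Sum>I\<in>sub. e (k - card I) * (\<integral>\<^sup>+ x. b4 I x \<partial>Kt k))"
proof -
  have m: "b2 \<in> borel_measurable (Kt k)" "b3 \<in> borel_measurable (Kt k)" by simp_all
  have m4: "b4 I \<in> borel_measurable (Kt k)" if "I \<in> sub" for I using b4_measurable[of I] that by simp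
  have m4s: "(\<lambda>x. \<Sum>I\<in>sub. e (k - card I) * b4 I x) \<in> borel_measurable (Kt k)"
    by (intro borel_measurable_sum borel_measurable_times_ennreal borel_measurable_const m4)
  have "(\<integral>\<^sup>+ x. b x \<partial>Kt k) = (\<integral>\<^sup>+ x. e k * b2 x \<partial>Kt k) + (\<integral>\<^sup>+ x. e k * b3 x + (\<Sum>I\<in>sub. e (k - card I) * b4 I x) \<partial>Kt k)"
    unfolding b_def using m m4s by (intro nn_integral_add borel_measurable_add borel_measurable_times_ennreal) simp_all
  also have "(\<integral>\<^sup>+ x. e k * b3 x + (\<Sum>I\<in>sub. e (k - card I) * b4 I x) \<partial>Kt k)
      = (\<integral>\<^sup>+ x. e k * b3 x \<partial>Kt k) + (\<integral>\<^sup>+ x. (\<Sum>I\<in>sub. e (k - card I) * b4 I x) \<partial>Kt k)"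
    using m m4s by (intro nn_integral_add borel_measurable_times_ennreal) simp_all
  also have "(\<integral>\<^sup>+ x. (\<Sum>I\<in>sub. e (k - card I) * b4 I x) \<partial>Kt k) = (\<Sum>I\<in>sub. \<integral>\<^sup>+ x. e (k - card I) * b4 I x \<partial>Kt k)"
    by (rule nn_integral_sum) (intro borel_measurable_times_ennreal borel_measurable_const m4)
  also have "\<dots> = (\<Sum>I\<in>sub. e (k - card I) * (\<integral>\<^sup>+ x. b4 I x \<partial>Kt k))"
    by (intro sum.cong refl nn_integral_cmult m4)
  finally have bint: "(\<integral>\<^sup>+ x. b x \<partial>Kt k) = e k * (\<integral>\<^sup>+ x. b2 x \<partial>Kt k) + (e k * (\<integral>\<^sup>+ x. b3 x \<partial>Kt k)
      + (\<Sum>I\<in>sub. e (k - card I) * (\<integral>\<^sup>+ x. b4 I x \<partial>Kt k)))"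
    by (simp only: nn_integral_cmult[OF m(1)] nn_integral_cmult[OF m(2)])
  have two: "2 * e k = ennreal (2 / fact k)"
    by (simp add: ennreal_mult[symmetric] flip: ennreal_numeral)
  have sq: "ennreal (2 / fact k) * e k = ennreal (2 / (fact k)\<^sup>2)"
    by (simp add: ennreal_mult[symmetric] power2_eq_square)
  show ?thesis
    unfolding err_def bint
    by (simp only: mult.assoc[symmetric] two distrib_left sq add.assoc)
qed

end

theorem theorem2p2:
  fixes K :: "'x::{second_countable_topology, t2_space} measure"
    and f :: "(nat \<Rightarrow> 'x) \<Rightarrow> ('x \<Rightarrow> nat) \<Rightarrow> 'y::{second_countable_topology, t2_space}"
    and g :: "(nat \<Rightarrow> 'x) \<Rightarrow> ('x \<Rightarrow> nat) \<Rightarrow> real"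
    and S :: "(nat \<Rightarrow> 'x) \<Rightarrow> 'x set"
    and M :: "'a measure" and \<eta> :: "'a \<Rightarrow> 'x \<Rightarrow> nat"
    and k :: nat and a :: real
  assumes X_lc: "locally_compact_space (euclidean :: 'x topology)"
    and Y_lc: "locally_compact_space (euclidean :: 'y topology)"
    and k_pos: "k \<ge> 1"
    and f_meas: "(\<lambda>(x, \<omega>). f x \<omega>) \<in> (PiM {..<k} (\<lambda>_. borel) \<Otimes>\<^sub>M NX) \<rightarrow>\<^sub>M borel"
    and g_meas: "(\<lambda>(x, \<omega>). g x \<omega>) \<in> borel_measurable (PiM {..<k} (\<lambda>_. borel) \<Otimes>\<^sub>M NX)"
    and g_01: "\<And>x \<omega>. g x \<omega> \<in> {0, 1}"
    and f_sym: "symmetric_tup k f" and g_sym: "symmetric_tup k g"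
    and K_sets: "sets K = sets borel"
    and K_lf: "\<And>C. compact C \<Longrightarrow> emeasure K C < \<infinity>"
    and PP: "poisson_process M K \<eta>"
    and L_fin: "(\<integral>\<^sup>+ \<omega>. xi k f g (\<eta> \<omega>) UNIV \<partial>M) < \<infinity>"
    and S_meas: "S \<in> PiM {..<k} (\<lambda>_. borel) \<rightarrow>\<^sub>M fell_sets"
    and S_sym: "symmetric_tup k S"
    and S_loc: "\<And>\<omega> x. lf_count \<omega> \<Longrightarrow> in_fact \<omega> k x \<Longrightarrow>
        (\<forall>i<k. x i \<in> S x) \<and> g x \<omega> = g x (restr \<omega> (S x)) \<and>
        (g x \<omega> = 1 \<longrightarrow> f x \<omega> = f x (restr \<omega> (S x)))"
    and a_pos: "a > 0"
  shows "ennreal (dTV M (\<lambda>\<omega>. xi k f g (\<eta> \<omega>) UNIV) (poisson_pmf a))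
    \<le> ennreal (min 1 (1 / sqrt a) * \<bar>enn2real (\<integral>\<^sup>+ \<omega>. xi k f g (\<eta> \<omega>) UNIV \<partial>M) - a\<bar>)
      + ennreal (min 1 (1 / a) / 2) * (E2 M K \<eta> k g S + E3 M K \<eta> k g S + E4 M K \<eta> k g)"
proof -
  obtain X :: "nat \<Rightarrow> 'x set" where X: "relcompact_partition X"
    using ex_relcompact_partition[OF X_lc] by blast
  define P where "P = distr M NX \<eta>"
  have law: "poisson_law X P K" unfolding P_def by (rule poisson_process_law[OF X K_sets K_lf PP])
  interpret F: stabilizing_functional X P K k g S
  proof (intro stabilizing_functional.intro law stabilizing_functional_axioms.intro)
    show "x i \<in> S x" if "lf_count \<omega>" "in_fact \<omega> k x" "i < k" for \<omega> x i
      using S_loc[OF that(1,2)] that(3) by simp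
    show "g x \<omega> = g x (restr \<omega> (S x))" if "lf_count \<omega>" "in_fact \<omega> k x" for \<omega> x
      using S_loc[OF that] by simp
  qed (fact X_lc k_pos g_meas g_01 g_sym S_meas)+
  interpret M: prob_space M using PP by (simp add: poisson_process_def)
  have \<eta>: "\<eta> \<in> M \<rightarrow>\<^sub>M NX" using PP by (simp add: poisson_process_def)
  \<comment> \<open>The process enters the mean, the comparison and the error terms only through its
    law, so each such integral can be moved to the space of configurations.\<close>
  have transfer: "(\<integral>\<^sup>+ \<omega>. u (\<eta> \<omega>) \<partial>M) = (\<integral>\<^sup>+ \<omega>. u \<omega> \<partial>P)" if "u \<in> borel_measurable NX" for u
    unfolding P_def using that by (subst nn_integral_distr[OF \<eta>]) simp_all
  have W: "xi k f g (\<eta> \<omega>) UNIV = F.W (\<eta> \<omega>)" for \<omega>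
    by (simp add: xi_def F.W_def)
  have EW: "(\<integral>\<^sup>+ \<omega>. F.W (\<eta> \<omega>) \<partial>M) = (\<integral>\<^sup>+ \<omega>. F.W \<omega> \<partial>P)" by (rule transfer) simp
  have bound: "ennreal (dTV M (\<lambda>\<omega>. F.W (\<eta> \<omega>)) (poisson_pmf a))
    \<le> ennreal (min 1 (1 / sqrt a) * \<bar>enn2real (\<integral>\<^sup>+ \<omega>. F.W (\<eta> \<omega>) \<partial>M) - a\<bar>) + ennreal (min 1 (1 / a)) * F.err"
  proof (rule M.dTV_poisson_le[OF a_pos])
    show "(\<lambda>\<omega>. F.W (\<eta> \<omega>)) \<in> borel_measurable M" by (rule measurable_compose[OF \<eta>]) simp
    show "F.W (\<eta> \<omega>) = \<infinity> \<or> (\<exists>n::nat. F.W (\<eta> \<omega>) = of_nat n)" for \<omega> by (rule F.W_nat)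
    show "(\<integral>\<^sup>+ \<omega>. F.W (\<eta> \<omega>) \<partial>M) < \<infinity>" using L_fin by (simp only: W)
    fix h :: "nat \<Rightarrow> real"
    assume lip: "\<And>m n. \<bar>h (Suc m) - h (Suc n)\<bar> \<le> min 1 (1 / a) * \<bar>real m - real n\<bar>"
    have c: "min 1 (1 / a) > 0" using a_pos by simp
    have 1: "(\<integral>\<^sup>+ \<omega>. eval_count h (F.W (\<eta> \<omega>) + 1) \<partial>M) = (\<integral>\<^sup>+ \<omega>. eval_count h (F.W \<omega> + 1) \<partial>P)"
      by (rule transfer) measurable
    have 2: "(\<integral>\<^sup>+ \<omega>. F.W (\<eta> \<omega>) * eval_count h (F.W (\<eta> \<omega>)) \<partial>M) = (\<integral>\<^sup>+ \<omega>. F.W \<omega> * eval_count h (F.W \<omega>) \<partial>P)"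
      by (rule transfer) measurable
    show "(\<integral>\<^sup>+ \<omega>. F.W (\<eta> \<omega>) \<partial>M) * (\<integral>\<^sup>+ \<omega>. eval_count h (F.W (\<eta> \<omega>) + 1) \<partial>M)
        \<le> (\<integral>\<^sup>+ \<omega>. F.W (\<eta> \<omega>) * eval_count h (F.W (\<eta> \<omega>)) \<partial>M) + ennreal (min 1 (1 / a)) * F.err \<and>
      (\<integral>\<^sup>+ \<omega>. F.W (\<eta> \<omega>) * eval_count h (F.W (\<eta> \<omega>)) \<partial>M)
        \<le> (\<integral>\<^sup>+ \<omega>. F.W (\<eta> \<omega>) \<partial>M) * (\<integral>\<^sup>+ \<omega>. eval_count h (F.W (\<eta> \<omega>) + 1) \<partial>M) + ennreal (min 1 (1 / a)) * F.err"
      unfolding 1 2 EW using F.stein_comparison[OF c lip] by (intro conjI)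
  qed
  have pr: "(\<integral>\<^sup>+ \<omega>. ennreal (g x (add_pts (\<eta> \<omega>) k x)) \<partial>M) = F.pr x" if "x \<in> space (F.Kt k)" for x
    unfolding F.pr_def using that by (intro transfer F.gg_x_measurable) (simp add: F.space_Kt)
  have "E2 M K \<eta> k g S = ennreal (2 / (fact k)\<^sup>2) * (\<integral>\<^sup>+ x. F.b2 x \<partial>F.Kt k)"
    unfolding E2_def F.b2_def F.hit_def
    by (intro arg_cong[where f = "(*) _"] nn_integral_cong) (simp only: pr)
  moreover have "E3 M K \<eta> k g S = ennreal (2 / (fact k)\<^sup>2) * (\<integral>\<^sup>+ x. F.b3 x \<partial>F.Kt k)"
    unfolding E3_def F.b3_def F.hit_def
    by (intro arg_cong[where f = "(*) _"] nn_integral_cong transfer F.g_mult_compose F.add_pts_compose F.const_tup)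
       (simp_all add: F.space_Kt)
  moreover have "E4 M K \<eta> k g = ennreal (2 / fact k) * (\<Sum>I \<in> {I. I \<subseteq> {..<k} \<and> I \<noteq> {} \<and> I \<noteq> {..<k}}. ennreal (1 / fact (k - card I)) * (\<integral>\<^sup>+ x. F.b4 I x \<partial>F.Kt k))"
    unfolding E4_def F.b4_def
    by (intro arg_cong[where f = "(*) _"] sum.cong refl nn_integral_cong transfer F.g_mult_compose F.join_compose F.add_pts_compose F.const_tup)
       (simp_all add: F.space_Kt)
  ultimately have E: "E2 M K \<eta> k g S + E3 M K \<eta> k g S + E4 M K \<eta> k g = 2 * F.err"
    by (simp only: F.twice_err)
  have half: "ennreal (min 1 (1 / a) / 2) * (2 * F.err) = ennreal (min 1 (1 / a)) * F.err"
  proof -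
    have "ennreal (min 1 (1 / a) / 2) * 2 = ennreal (min 1 (1 / a) / 2) * ennreal 2" by simp
    also have "\<dots> = ennreal (min 1 (1 / a))" using a_pos by (subst ennreal_mult[symmetric]) simp_all
    finally show ?thesis by (simp only: mult.assoc[symmetric])
  qed
  show ?thesis using bound unfolding W E half .
qed

end
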